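(* Let $d\in\{2,3\}$, let $\Omega\subset\mathbb{R}^d$ be a bounded domain with Lipschitz continuous boundary, let $\mathbb{G},\mathbb{U},\mathbb{S}$ and $\mathcal{A}$ be as in the context, and let $\{(\mathbb{G}_h,\mathbb{U}_h,\mathbb{S}_h)\}_{h>0}$ be a family of finite element subspaces (finite dimensional, $\mathbb{G}_h\subset\mathbb{G}$, $\mathbb{U}_h\subset\mathbb{U}$, $\mathbb{S}_h\subset\mathbb{S}$) constructed over a regular family of quasi-uniform triangulations of $\Omega$, such that there are constants $c_b,C_0>0$ independent of $h$ with $$\sup_{0\ne(G_h,u_h)\in\mathbb{G}_h\times\mathbb{U}_h}\frac{(G_h,S_h)+(u_h,\mathrm{div}(S_h))}{\|(G_h,u_h)\|}\ge c_b\|S_h\|_{\mathbb{S}}\quad\text{for all }S_h\in\mathbb{S}_h,$$ $$\|(G_h^{skw},u_h)\|\le C_0\|G_h^{sym}\|_{L^2(\Omega)}\quad\text{for all }(G_h,u_h)\in\mathbb{Z}_h,$$ where $\mathbb{Z}_h=\{(G_h,u_h)\in\mathbb{G}_h\times\mathbb{U}_h:(G_h,S_h)+(u_h,\mathrm{div}(S_h))=0\ \text{for all }S_h\in\mathbb{S}_h\}$. Let $f\in L^{4/3}(\Omega)^d$. Assume that $(G,u,S)\in\mathbb{G}\times\mathbb{U}\times\mathbb{S}$ satisfies $$(\mathcal{A}(G),H)-\tfrac12(u\otimes u,H)-(S,H)=0\quad\text{for all } H\in\mathbb{G},$$ $$\tfrac12(Gu,v)-(\mathrm{div}(S),v)=(f,v)\quad\text{for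 all } v\in\mathbb{U},$$ $$(G,T)+(u,\mathrm{div}(T))=0\quad\text{for all } T\in\mathbb{S},$$ and that for each $h$, $(G_h,u_h,S_h)\in\mathbb{G}_h\times\mathbb{U}_h\times\mathbb{S}_h$ satisfies $$(\mathcal{A}(G_h),H_h)-\tfrac12(u_h\otimes u_h,H_h)-(S_h,H_h)=0\quad\text{for all }H_h\in\mathbb{G}_h,$$ $$\tfrac12(G_hu_h,v_h)-(\mathrm{div}(S_h),v_h)=(f,v_h)\quad\text{for all }v_h\in\mathbb{U}_h,$$ $$(G_h,T_h)+(u_h,\mathrm{div}(T_h))=0\quad\text{for all }T_h\in\mathbb{S}_h.$$ If $\|f\|_{L^{4/3}(\Omega)}$ is sufficiently small (smaller than a positive threshold independent of $h$), then there is a constant $C$, independent of $h$, such that $$\|G-G_h\|_{L^2(\Omega)}+\|u-u_h\|_{L^4(\Omega)}+\|S-S_h\|_{\mathbb{S}}\le C\Big\{\inf_{H_h\in\mathbb{G}_h}\|G-H_h\|_{L^2(\Omega)}+\inf_{v_h\in\mathbb{U}_h}\|u-v_h\|_{L^4(\Omega)}+\inf_{T_h\in\mathbb{S}_h}\|S-T_h\|_{\mathbb{S}}\Big\}.$$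
   Context: $(\cdot,\cdot)$ denotes the $L^2(\Omega)$ pairing $\int_\Omega$ of scalar, vector, or tensor functions (also used for the $L^4$–$L^{4/3}$ duality). The divergence of a tensor field is taken row-wise. The spaces are $$\mathbb{G}=\{G\in L^2(\Omega)^{d\times d}: \mathrm{tr}(G)=0\},\qquad \mathbb{U}=L^4(\Omega)^d,$$ $$\mathbb{S}=\{S\in L^2(\Omega)^{d\times d}: \mathrm{div}(S)\in L^{4/3}(\Omega)^d,\ \int_\Omega \mathrm{tr}(S)=0\},$$ with norms $\|S\|_{\mathbb{S}}^2=\|S\|_{L^2(\Omega)}^2+\|\mathrm{div}(S)\|_{L^{4/3}(\Omega)}^2$ and $\|(G,u)\|^2=\|G\|_{L^2(\Omega)}^2+\|u\|_{L^4(\Omega)}^2$. For a matrix field $G$, $G^{sym}=\tfrac12(G+G^\top)$, $G^{skw}=\tfrac12(G-G^\top)$. Constitutive relation: $\mathcal{A}:\mathbb{R}^{d\times d}\to\mathbb{R}^{d\times d}_{sym}$ is linear (applied pointwise to matrix fields), and there are constants $C_{\mathcal A},\nu>0$ such that for all $G,H\in L^2(\Omega)^{d\times d}$: $\mathcal{A}(G)=\mathcal{A}(G^{sym})$; $(\mathcal{A}(G),G)\ge\nu\|G^{sym}\|_{L^2(\Omega)}^2$; $(\mathcal{A}(G),H)\le C_{\mathcal A}\|G\|_{L^2(\Omega)}\|H\|_{L^2(\Omega)}$. A family of simplicial triangulations is regular if the ratio of element diameter to inscribed-ball diameter is bounded uniformly in the family, and quasi-uniform if all elements of the mesh with parameter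 $h$ have diameter bounded below by a fixed multiple of $h$, where $h$ is the maximal diameter. *)

theory Defs
  imports "HOL-Analysis.Analysis"
begin

section \<open>Lebesgue spaces, represented by functions up to equality almost everywhere\<close>

definition Lp_space :: "real \<Rightarrow> 'a::euclidean_space set \<Rightarrow> ('a \<Rightarrow> 'b::euclidean_space) set" where
  "Lp_space p \<Omega> = {f. f \<in> borel_measurable (lebesgue_on \<Omega>) \<and>
      integrable (lebesgue_on \<Omega>) (\<lambda>x. norm (f x) powr p)}"

text \<open>For tensor fields, the norm of \<^typ>\<open>real^'n^'n\<close> is the Frobenius norm.\<close>

definition Lp_norm :: "real \<Rightarrow> 'a::euclidean_space set \<Rightarrow> ('a \<Rightarrow> 'b::euclidean_space) \<Rightarrow> real" where
  "Lp_norm p \<Omega> f = (LINT x|lebesgue_on \<Omega>. norm (f x) powr p) powr (1 / p)"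

definition pairing ::
  "'a::euclidean_space set \<Rightarrow> ('a \<Rightarrow> 'b::euclidean_space) \<Rightarrow> ('a \<Rightarrow> 'b) \<Rightarrow> real" where
  "pairing \<Omega> f g = (LINT x|lebesgue_on \<Omega>. f x \<bullet> g x)"


section \<open>Lipschitz domains\<close>

text \<open>Near every boundary point the domain is the strict epigraph, in some direction \<open>e\<close>, of a
  Lipschitz function on the hyperplane orthogonal to \<open>e\<close>. The point
  \<open>x - (x \<bullet> e) *\<^sub>R e\<close> is the projection of \<open>x\<close> to this hyperplane.\<close>

definition bounded_lipschitz_domain :: "'a::euclidean_space set \<Rightarrow> bool" where
  "bounded_lipschitz_domain \<Omega> \<longleftrightarrow>
     open \<Omega> \<and> connected \<Omega> \<and> \<Omega> \<noteq> {} \<and> bounded \<Omega> \<and>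
     (\<forall>p \<in> frontier \<Omega>. \<exists>e r L (\<gamma> :: 'a \<Rightarrow> real). norm e = 1 \<and> r > 0 \<and>
        L-lipschitz_on {y. y \<bullet> e = 0} \<gamma> \<and>
        \<Omega> \<inter> ball p r = {x \<in> ball p r. x \<bullet> e > \<gamma> (x - (x \<bullet> e) *\<^sub>R e)})"


section \<open>Weak divergence\<close>

primrec Ck :: "nat \<Rightarrow> ('a::euclidean_space \<Rightarrow> real) \<Rightarrow> bool" where
  "Ck 0 \<phi> \<longleftrightarrow> continuous_on UNIV \<phi>"
| "Ck (Suc k) \<phi> \<longleftrightarrow> (\<forall>x. \<phi> differentiable at x) \<and>
     (\<forall>b \<in> Basis. Ck k (\<lambda>x. frechet_derivative \<phi> (at x) b))"

definition test_function :: "'a::euclidean_space set \<Rightarrow> ('a \<Rightarrow> real) \<Rightarrow> bool" where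
  "test_function \<Omega> \<phi> \<longleftrightarrow> (\<forall>k. Ck k \<phi>) \<and>
     compact (closure {x. \<phi> x \<noteq> 0}) \<and> closure {x. \<phi> x \<noteq> 0} \<subseteq> \<Omega>"

definition grad :: "(real^'n \<Rightarrow> real) \<Rightarrow> real^'n \<Rightarrow> real^'n" where
  "grad \<phi> x = (\<chi> j. frechet_derivative \<phi> (at x) (axis j 1))"

text \<open>The distributional divergence acts on the rows \<open>S x $ i\<close>.\<close>

definition has_weak_div ::
  "(real^'n) set \<Rightarrow> (real^'n \<Rightarrow> real^'n^'n) \<Rightarrow> (real^'n \<Rightarrow> real^'n) \<Rightarrow> bool" where
  "has_weak_div \<Omega> S g \<longleftrightarrow>
     (\<forall>K. compact K \<and> K \<subseteq> \<Omega> \<longrightarrow> g absolutely_integrable_on K) \<and>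
     (\<forall>\<phi> i. test_function \<Omega> \<phi> \<longrightarrow>
        (LINT x|lebesgue_on \<Omega>. (S x $ i) \<bullet> grad \<phi> x) =
        - (LINT x|lebesgue_on \<Omega>. (g x $ i) * \<phi> x))"

text \<open>A representative of the weak divergence, which is unique up to null sets; meaningful only
  if a weak divergence exists.\<close>

definition weak_div ::
  "(real^'n) set \<Rightarrow> (real^'n \<Rightarrow> real^'n^'n) \<Rightarrow> real^'n \<Rightarrow> real^'n" where
  "weak_div \<Omega> S = (SOME g. has_weak_div \<Omega> S g)"


section \<open>The spaces and their norms\<close>

definition G_space :: "(real^'n) set \<Rightarrow> (real^'n \<Rightarrow> real^'n^'n) set" where
  "G_space \<Omega> = {G \<in> Lp_space 2 \<Omega>. AE x in lebesgue_on \<Omega>. trace (G x) = 0}"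

definition U_space :: "(real^'n) set \<Rightarrow> (real^'n \<Rightarrow> real^'n) set" where
  "U_space \<Omega> = Lp_space 4 \<Omega>"

definition S_space :: "(real^'n) set \<Rightarrow> (real^'n \<Rightarrow> real^'n^'n) set" where
  "S_space \<Omega> = {S \<in> Lp_space 2 \<Omega>.
     (\<exists>g \<in> Lp_space (4/3) \<Omega>. has_weak_div \<Omega> S g) \<and>
     (LINT x|lebesgue_on \<Omega>. trace (S x)) = 0}"

definition S_norm :: "(real^'n) set \<Rightarrow> (real^'n \<Rightarrow> real^'n^'n) \<Rightarrow> real" where
  "S_norm \<Omega> S = sqrt ((Lp_norm 2 \<Omega> S)\<^sup>2 + (Lp_norm (4/3) \<Omega> (weak_div \<Omega> S))\<^sup>2)"

definition GU_norm ::
  "(real^'n) set \<Rightarrow> (real^'n \<Rightarrow> real^'n^'n) \<Rightarrow> (real^'n \<Rightarrow> real^'n) \<Rightarrow> real" where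
  "GU_norm \<Omega> G u = sqrt ((Lp_norm 2 \<Omega> G)\<^sup>2 + (Lp_norm 4 \<Omega> u)\<^sup>2)"


section \<open>The constitutive relation\<close>

definition sym_part :: "real^'n^'n \<Rightarrow> real^'n^'n" where
  "sym_part M = (1/2) *\<^sub>R (M + transpose M)"

definition skw_part :: "real^'n^'n \<Rightarrow> real^'n^'n" where
  "skw_part M = (1/2) *\<^sub>R (M - transpose M)"

definition outer :: "real^'n \<Rightarrow> real^'n \<Rightarrow> real^'n^'n" where
  "outer a b = (\<chi> i j. a $ i * b $ j)"

definition constitutive ::
  "(real^'n) set \<Rightarrow> real \<Rightarrow> real \<Rightarrow> (real^'n^'n \<Rightarrow> real^'n^'n) \<Rightarrow> bool" where
  "constitutive \<Omega> C\<^sub>A \<nu> \<A> \<longleftrightarrow>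
     linear \<A> \<and> (\<forall>M. transpose (\<A> M) = \<A> M) \<and>
     (\<forall>G \<in> Lp_space 2 \<Omega>. AE x in lebesgue_on \<Omega>. \<A> (G x) = \<A> (sym_part (G x))) \<and>
     (\<forall>G \<in> Lp_space 2 \<Omega>.
        pairing \<Omega> (\<lambda>x. \<A> (G x)) G \<ge> \<nu> * (Lp_norm 2 \<Omega> (\<lambda>x. sym_part (G x)))\<^sup>2) \<and>
     (\<forall>G \<in> Lp_space 2 \<Omega>. \<forall>H \<in> Lp_space 2 \<Omega>.
        pairing \<Omega> (\<lambda>x. \<A> (G x)) H \<le> C\<^sub>A * Lp_norm 2 \<Omega> G * Lp_norm 2 \<Omega> H)"


section \<open>Meshes and finite element spaces\<close>

text \<open>\<^const>\<open>triangulation\<close> only says that the simplices are finitely many and meet in common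
  faces. A mesh consists of the full-dimensional simplices and covers the closed domain.\<close>

definition mesh_of :: "'a::euclidean_space set \<Rightarrow> 'a set set \<Rightarrow> bool" where
  "mesh_of \<Omega> \<T> \<longleftrightarrow>
     triangulation \<T> \<and> (\<forall>K \<in> \<T>. int DIM('a) simplex K) \<and> \<Union>\<T> = closure \<Omega>"

definition inball_diameter :: "'a::euclidean_space set \<Rightarrow> real" where
  "inball_diameter K = (SUP r \<in> {r. r \<ge> 0 \<and> (\<exists>x. cball x r \<subseteq> K)}. 2 * r)"

text \<open>The meshes are indexed by their mesh sizes \<open>h\<close>, which range over an arbitrary set of
  positive reals: a bounded domain has no mesh of size \<open>h\<close> if \<open>h\<close> is large.\<close>

definition regular_quasi_uniform_meshes ::
  "'a::euclidean_space set \<Rightarrow> real set \<Rightarrow> (real \<Rightarrow> 'a set set) \<Rightarrow> bool" where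
  "regular_quasi_uniform_meshes \<Omega> hs \<T> \<longleftrightarrow>
     (\<forall>h \<in> hs. h > 0 \<and> mesh_of \<Omega> (\<T> h) \<and> h = Max (diameter ` \<T> h)) \<and>
     (\<exists>\<sigma>. \<forall>h \<in> hs. \<forall>K \<in> \<T> h. diameter K / inball_diameter K \<le> \<sigma>) \<and>
     (\<exists>c > 0. \<forall>h \<in> hs. \<forall>K \<in> \<T> h. diameter K \<ge> c * h)"

text \<open>A finite-dimensional linear subspace \<open>V\<close> of \<open>X\<close> whose members are polynomial on each
  element of the mesh. There is no assumption on continuity across faces other than what
  \<open>V \<subseteq> X\<close> implies, and none on the polynomial degrees.\<close>

definition fe_subspace ::
  "'a::euclidean_space set \<Rightarrow> 'a set set \<Rightarrow> ('a \<Rightarrow> 'b::euclidean_space) set \<Rightarrow>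
   ('a \<Rightarrow> 'b) set \<Rightarrow> bool" where
  "fe_subspace \<Omega> \<T> X V \<longleftrightarrow>
     V \<subseteq> X \<and>
     (\<lambda>x. 0) \<in> V \<and> (\<forall>v \<in> V. \<forall>w \<in> V. (\<lambda>x. v x + w x) \<in> V) \<and>
     (\<forall>c. \<forall>v \<in> V. (\<lambda>x. c *\<^sub>R v x) \<in> V) \<and>
     (\<exists>B. finite B \<and> B \<subseteq> V \<and>
        (\<forall>v \<in> V. \<exists>c. AE x in lebesgue_on \<Omega>. v x = (\<Sum>b\<in>B. c b *\<^sub>R b x))) \<and>
     (\<forall>v \<in> V. \<forall>K \<in> \<T>. \<exists>p. polynomial_function p \<and> (AE x in lebesgue_on K. v x = p x))"


section \<open>The dual-mixed formulation\<close>

definition b_form ::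
  "(real^'n) set \<Rightarrow> (real^'n \<Rightarrow> real^'n^'n) \<Rightarrow> (real^'n \<Rightarrow> real^'n) \<Rightarrow>
   (real^'n \<Rightarrow> real^'n^'n) \<Rightarrow> real" where
  "b_form \<Omega> G u S = pairing \<Omega> G S + pairing \<Omega> u (weak_div \<Omega> S)"

definition Z_space ::
  "(real^'n) set \<Rightarrow> (real^'n \<Rightarrow> real^'n^'n) set \<Rightarrow> (real^'n \<Rightarrow> real^'n) set \<Rightarrow>
   (real^'n \<Rightarrow> real^'n^'n) set \<Rightarrow> ((real^'n \<Rightarrow> real^'n^'n) \<times> (real^'n \<Rightarrow> real^'n)) set" where
  "Z_space \<Omega> VG VU VS = {(G, u). G \<in> VG \<and> u \<in> VU \<and> (\<forall>S \<in> VS. b_form \<Omega> G u S = 0)}"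

text \<open>The supremum is taken in the extended reals, and a pair is nonzero iff its norm is, since
  fields are identified up to null sets.\<close>

definition inf_sup ::
  "(real^'n) set \<Rightarrow> real \<Rightarrow> (real^'n \<Rightarrow> real^'n^'n) set \<Rightarrow> (real^'n \<Rightarrow> real^'n) set \<Rightarrow>
   (real^'n \<Rightarrow> real^'n^'n) set \<Rightarrow> bool" where
  "inf_sup \<Omega> c\<^sub>b VG VU VS \<longleftrightarrow>
     (\<forall>S \<in> VS. (SUP (G, u) \<in> {(G, u). G \<in> VG \<and> u \<in> VU \<and> GU_norm \<Omega> G u \<noteq> 0}.
        ereal (b_form \<Omega> G u S / GU_norm \<Omega> G u)) \<ge> ereal (c\<^sub>b * S_norm \<Omega> S))"

definition kernel_bound ::
  "(real^'n) set \<Rightarrow> real \<Rightarrow> (real^'n \<Rightarrow> real^'n^'n) set \<Rightarrow> (real^'n \<Rightarrow> real^'n) set \<Rightarrow>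
   (real^'n \<Rightarrow> real^'n^'n) set \<Rightarrow> bool" where
  "kernel_bound \<Omega> C\<^sub>0 VG VU VS \<longleftrightarrow>
     (\<forall>(G, u) \<in> Z_space \<Omega> VG VU VS.
        GU_norm \<Omega> (\<lambda>x. skw_part (G x)) u \<le> C\<^sub>0 * Lp_norm 2 \<Omega> (\<lambda>x. sym_part (G x)))"

text \<open>Trial and test spaces coincide; both the continuous and the discrete problem are of this
  form.\<close>

definition solves ::
  "(real^'n) set \<Rightarrow> (real^'n^'n \<Rightarrow> real^'n^'n) \<Rightarrow> (real^'n \<Rightarrow> real^'n) \<Rightarrow>
   (real^'n \<Rightarrow> real^'n^'n) set \<Rightarrow> (real^'n \<Rightarrow> real^'n) set \<Rightarrow> (real^'n \<Rightarrow> real^'n^'n) set \<Rightarrow>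
   (real^'n \<Rightarrow> real^'n^'n) \<Rightarrow> (real^'n \<Rightarrow> real^'n) \<Rightarrow> (real^'n \<Rightarrow> real^'n^'n) \<Rightarrow> bool" where
  "solves \<Omega> \<A> f VG VU VS G u S \<longleftrightarrow>
     G \<in> VG \<and> u \<in> VU \<and> S \<in> VS \<and>
     (\<forall>H \<in> VG. pairing \<Omega> (\<lambda>x. \<A> (G x)) H - 1/2 * pairing \<Omega> (\<lambda>x. outer (u x) (u x)) H
        - pairing \<Omega> S H = 0) \<and>
     (\<forall>v \<in> VU. 1/2 * pairing \<Omega> (\<lambda>x. G x *v u x) v - pairing \<Omega> (weak_div \<Omega> S) v
        = pairing \<Omega> f v) \<and>
     (\<forall>T \<in> VS. pairing \<Omega> G T + pairing \<Omega> u (weak_div \<Omega> T) = 0)"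

end

theory Submission
  imports Defs "HOL-Library.Function_Algebras"
begin

text \<open>
  Testing the discrete problem with its own solution and using the kernel bound shows that
  \<open>(G\<^sub>h, u\<^sub>h)\<close> is bounded by a multiple of \<open>f\<close>. Smallness of the discrete solution is all that
  is needed: if the difference of the convective terms is split as
  \<open>c(x - x\<^sub>h; x\<^sub>h, e) + c(x; x - x\<^sub>h, e)\<close>, the second term sees only the approximation error,
  because \<open>c(x; e, e) = 0\<close>. In particular no Korn or Poincare inequality for the continuous kernel
  enters, and the constant may depend on the norm of the exact solution \<open>x\<close>.

  To test with \<open>e = x\<^sub>h - z\<close> one needs \<open>z\<close> in the discrete kernel. The distance of a discrete field
  \<open>y\<close> to the kernel is the value at \<open>y\<close> of a linear functional that is dominated by the norm
  and vanishes on the kernel (Hahn-Banach). By finite dimensionality this functional is of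
  the form \<open>b(\<cdot>, S\<^sub>h)\<close>, so the inf-sup condition bounds the distance by the residual of \<open>y\<close>. The error of \<open>S\<^sub>h\<close> then follows from the inf-sup condition.

  Since \<open>weak_div\<close> is a choice of representative, its linearity up to null sets rests on the
  fundamental lemma of the calculus of variations.
\<close>

text \<open>Fields are functions rather than classes, so every norm is a seminorm and a finite
  element space is finite-dimensional only modulo fields of norm zero. This shapes the abstract
  part: seminorms live on carrier sets, generation is required only up to norm zero, and the
  distance to the kernel is an infimum that need not be attained, which costs a factor 2.

  The smallness threshold comes from one absorption. With coercivity constant
  \<open>\<alpha>\<close> on the discrete kernel and a convective form of norm at most 1, a load of
  size at most \<open>\<alpha>\<^sup>2 / 2\<close> gives \<open>n xh \<le> \<alpha> / 2\<close>. The
  only contribution to the error bound that is quadratic in \<open>e\<close> is then at most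
  \<open>\<alpha> / 2 * (n e)\<^sup>2\<close>, half of what coercivity provides.

  The residual of a discrete \<open>y\<close> is an approximation error because the exact pair
  satisfies \<open>b x R = 0\<close> for every discrete \<open>R\<close>, so that
  \<open>b y R = b (y - x) R\<close>.\<close>

section \<open>Sublinear functionals and the Hahn-Banach theorem\<close>

text \<open>Pointwise scaling makes fields vectors, so that \<open>subspace\<close> and
  \<open>span\<close> apply to sets of fields and a pair \<open>(G, u)\<close> is a vector of the
  product type.\<close>

instantiation "fun" :: (type, real_vector) real_vector
begin

definition "scaleR r f = (\<lambda>x. r *\<^sub>R f x)"

instance
  by standard (auto simp: scaleR_fun_def plus_fun_def scaleR_add_right scaleR_add_left)

end

text \<open>Linearity is relative to a carrier because the integral of a non-integrable function has
  the default value 0: a pairing is additive only on a space where its integrals exist.\<close>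

definition linear_functional_on :: "'a::real_vector set \<Rightarrow> ('a \<Rightarrow> real) \<Rightarrow> bool" where
  "linear_functional_on V f \<longleftrightarrow>
     (\<forall>x\<in>V. \<forall>y\<in>V. f (x + y) = f x + f y) \<and> (\<forall>x\<in>V. \<forall>c. f (c *\<^sub>R x) = c * f x)"

definition sublinear_on :: "'a::real_vector set \<Rightarrow> ('a \<Rightarrow> real) \<Rightarrow> bool" where
  "sublinear_on V q \<longleftrightarrow>
     (\<forall>x\<in>V. \<forall>y\<in>V. q (x + y) \<le> q x + q y) \<and> (\<forall>x\<in>V. \<forall>c\<ge>0. q (c *\<^sub>R x) = c * q x)"

definition seminorm_on :: "'a::real_vector set \<Rightarrow> ('a \<Rightarrow> real) \<Rightarrow> bool" where
  "seminorm_on V n \<longleftrightarrow>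
     (\<forall>x\<in>V. 0 \<le> n x) \<and> (\<forall>x\<in>V. \<forall>y\<in>V. n (x + y) \<le> n x + n y) \<and>
     (\<forall>x\<in>V. \<forall>c. n (c *\<^sub>R x) = \<bar>c\<bar> * n x)"

lemma linear_functional_onD:
  assumes "linear_functional_on V f" "subspace V"
  shows "x \<in> V \<Longrightarrow> y \<in> V \<Longrightarrow> f (x + y) = f x + f y"
    and "x \<in> V \<Longrightarrow> f (c *\<^sub>R x) = c * f x"
    and "f 0 = 0"
    and "x \<in> V \<Longrightarrow> f (- x) = - f x"
    and "x \<in> V \<Longrightarrow> y \<in> V \<Longrightarrow> f (x - y) = f x - f y"
proof -
  show add: "x \<in> V \<Longrightarrow> y \<in> V \<Longrightarrow> f (x + y) = f x + f y" for x y
    using assms by (simp add: linear_functional_on_def)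
  show scale: "x \<in> V \<Longrightarrow> f (c *\<^sub>R x) = c * f x" for x c
    using assms by (simp add: linear_functional_on_def)
  show "f 0 = 0"
    using scale[of 0 0] subspace_0[OF assms(2)] by simp
  show neg: "x \<in> V \<Longrightarrow> f (- x) = - f x" for x
    using scale[of x "-1"] by simp
  show "x \<in> V \<Longrightarrow> y \<in> V \<Longrightarrow> f (x - y) = f x - f y"
    using add[of x "- y"] neg[of y] subspace_neg[OF assms(2)] by simp
qed

lemma linear_functional_on_sum:
  assumes "linear_functional_on V f" "subspace V" "finite I" "\<And>i. i \<in> I \<Longrightarrow> v i \<in> V"
  shows "f (\<Sum>i\<in>I. c i *\<^sub>R v i) = (\<Sum>i\<in>I. c i * f (v i))"
  using assms(3,4)
proof (induction I rule: finite_induct)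
  case empty
  then show ?case using linear_functional_onD(3)[OF assms(1,2)] by simp
next
  case (insert i I)
  have "(\<Sum>i\<in>I. c i *\<^sub>R v i) \<in> V"
    using insert.prems by (intro subspace_sum subspace_scale assms(2)) auto
  then show ?case
    using insert linear_functional_onD(1,2)[OF assms(1,2)]
    by (simp add: subspace_scale[OF assms(2)])
qed

lemma linear_functional_on_subset:
  "linear_functional_on V f \<Longrightarrow> W \<subseteq> V \<Longrightarrow> linear_functional_on W f"
  unfolding linear_functional_on_def by blast

lemma linear_functional_on_diff:
  "linear_functional_on V f \<Longrightarrow> linear_functional_on V g \<Longrightarrow>
    linear_functional_on V (\<lambda>x. f x - g x)"
  unfolding linear_functional_on_def by (auto simp: algebra_simps)

lemma linear_functional_on_combination:
  "(\<And>i. i \<in> I \<Longrightarrow> linear_functional_on V (g i)) \<Longrightarrow>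
    linear_functional_on V (\<lambda>x. \<Sum>i\<in>I. a i * g i x)"
  unfolding linear_functional_on_def
  by (auto simp: sum.distrib sum_distrib_left distrib_left mult.left_commute intro!: sum.cong)

lemma seminorm_onD:
  assumes "seminorm_on V n" "subspace V"
  shows "x \<in> V \<Longrightarrow> 0 \<le> n x"
    and "x \<in> V \<Longrightarrow> y \<in> V \<Longrightarrow> n (x + y) \<le> n x + n y"
    and "x \<in> V \<Longrightarrow> n (c *\<^sub>R x) = \<bar>c\<bar> * n x"
    and "n 0 = 0"
    and "x \<in> V \<Longrightarrow> n (- x) = n x"
    and "x \<in> V \<Longrightarrow> y \<in> V \<Longrightarrow> n (x - y) \<le> n x + n y"
proof -
  show "x \<in> V \<Longrightarrow> 0 \<le> n x"
    using assms by (simp add: seminorm_on_def)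
  show add: "x \<in> V \<Longrightarrow> y \<in> V \<Longrightarrow> n (x + y) \<le> n x + n y" for x y
    using assms by (simp add: seminorm_on_def)
  show scale: "x \<in> V \<Longrightarrow> n (c *\<^sub>R x) = \<bar>c\<bar> * n x" for x c
    using assms by (simp add: seminorm_on_def)
  show "n 0 = 0"
    using scale[of 0 0] subspace_0[OF assms(2)] by simp
  show neg: "x \<in> V \<Longrightarrow> n (- x) = n x" for x
    using scale[of x "-1"] by simp
  show "x \<in> V \<Longrightarrow> y \<in> V \<Longrightarrow> n (x - y) \<le> n x + n y"
    using add[of x "- y"] neg[of y] subspace_neg[OF assms(2)] by simp
qed

text \<open>Induction on the number of functionals, with \<open>V\<close> and \<open>f\<close>
  varying: on the kernel of \<open>g j\<close> the other functionals suffice, and a functional that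
  vanishes on that kernel is a multiple of \<open>g j\<close>.\<close>

lemma functional_combination_of_annihilators:
  assumes "finite I" "subspace V" "linear_functional_on V f"
    and "\<And>i. i \<in> I \<Longrightarrow> linear_functional_on V (g i)"
    and "\<And>y. y \<in> V \<Longrightarrow> (\<And>i. i \<in> I \<Longrightarrow> g i y = 0) \<Longrightarrow> f y = 0"
  shows "\<exists>a. \<forall>y\<in>V. f y = (\<Sum>i\<in>I. a i * g i y)"
  using assms
proof (induction I arbitrary: V f rule: finite_induct)
  case empty
  then show ?case by auto
next
  case (insert j I)
  define W where "W = {y \<in> V. g j y = 0}"
  have lin_j: "linear_functional_on V (g j)" using insert.prems by simp
  note gj = linear_functional_onD[OF lin_j insert.prems(1)]
  have W: "subspace W" "W \<subseteq> V"
    unfolding W_def subspace_def using gj insert.prems(1)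
    by (auto simp: subspace_0 subspace_add subspace_scale)
  have "\<exists>a. \<forall>y\<in>W. f y = (\<Sum>i\<in>I. a i * g i y)"
  proof (rule insert.IH)
    show "linear_functional_on W f"
      using insert.prems(2) W(2) by (rule linear_functional_on_subset)
    show "linear_functional_on W (g i)" if "i \<in> I" for i
      using insert.prems(3) W(2) that by (blast intro: linear_functional_on_subset)
    show "f y = 0" if "y \<in> W" "\<And>i. i \<in> I \<Longrightarrow> g i y = 0" for y
      using insert.prems(4)[of y] that by (auto simp: W_def)
  qed (use W in auto)
  then obtain a where a: "\<And>y. y \<in> W \<Longrightarrow> f y = (\<Sum>i\<in>I. a i * g i y)" by blast
  define f' where "f' = (\<lambda>y. f y - (\<Sum>i\<in>I. a i * g i y))"
  have lin_f': "linear_functional_on V f'"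
    unfolding f'_def using insert.prems(2,3)
    by (intro linear_functional_on_diff linear_functional_on_combination) auto
  note f' = linear_functional_onD[OF lin_f' insert.prems(1)]
  obtain k where k: "\<And>y. y \<in> V \<Longrightarrow> f' y = k * g j y"
  proof (cases "\<exists>y0\<in>V. g j y0 \<noteq> 0")
    case True
    then obtain y0 where y0: "y0 \<in> V" "g j y0 \<noteq> 0" by blast
    have "f' y = f' y0 / g j y0 * g j y" if "y \<in> V" for y
    proof -
      \<comment> \<open>Removing this multiple of \<open>y0\<close> moves \<open>y\<close> into the
        kernel of \<open>g j\<close>, where \<open>f'\<close> is zero; this produces the factor
        \<open>f' y0 / g j y0\<close>.\<close>
      have "y - (g j y / g j y0) *\<^sub>R y0 \<in> W"
        using that y0 insert.prems(1) by (auto simp: W_def gj subspace_diff subspace_scale)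
      then have "f' (y - (g j y / g j y0) *\<^sub>R y0) = 0"
        by (simp add: f'_def a)
      then show ?thesis
        using that y0 insert.prems(1) by (simp add: f' subspace_scale field_simps)
    qed
    then show thesis by (rule that)
  next
    case False
    then have "f' y = 0 * g j y" if "y \<in> V" for y
      using that a[of y] by (auto simp: f'_def W_def)
    then show thesis by (rule that)
  qed
  have "f y = (\<Sum>i\<in>insert j I. (a(j := k)) i * g i y)" if "y \<in> V" for y
  proof -
    have "(\<Sum>i\<in>I. (a(j := k)) i * g i y) = (\<Sum>i\<in>I. a i * g i y)"
      using insert.hyps by (intro sum.cong) auto
    then show ?thesis
      using k[OF that] insert.hyps by (simp add: f'_def)
  qed
  then show ?case by blast
qed

text \<open>\<open>q'\<close> is the infimum of \<open>q (y + t *\<^sub>R x) - t * q x\<close> over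
  nonnegative \<open>t\<close>. Taking t = 0 keeps it below \<open>q\<close>, and t = 1 at
  \<open>- x\<close> gives the last inequality. A sublinear p below \<open>q'\<close> then satisfies
  p x \<ge> - p (- x) \<ge> q x, so it agrees with \<open>q\<close> at \<open>x\<close> and is
  linear along \<open>x\<close>.\<close>

lemma sublinear_on_linear_in_direction:
  assumes V: "subspace V" and q: "sublinear_on V q" and x: "x \<in> V"
  shows "\<exists>q'. sublinear_on V q' \<and> (\<forall>y\<in>V. q' y \<le> q y) \<and> q' (- x) \<le> - q x"
proof -
  define Q where "Q y t = q (y + t *\<^sub>R x) - t * q x" for y t
  define q' where "q' y = (INF t\<in>{0..}. Q y t)" for y
  have add: "q (y + z) \<le> q y + q z" if "y \<in> V" "z \<in> V" for y z
    using q that by (simp add: sublinear_on_def)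
  have scale: "q (c *\<^sub>R y) = c * q y" if "y \<in> V" "c \<ge> 0" for y c
    using q that by (simp add: sublinear_on_def)
  have q0: "q 0 = 0" using scale[of 0 0] V by (simp add: subspace_0)
  note [simp] = subspace_add[OF V] subspace_scale[OF V] subspace_neg[OF V] subspace_diff[OF V] x
  \<comment> \<open>Subadditivity bounds every candidate from below by a number that does not
    involve \<open>t\<close>, so the infimum is a genuine one.\<close>
  have lower: "- q (- y) \<le> Q y t" if "y \<in> V" "t \<ge> 0" for y t
  proof -
    have "t * q x = q ((y + t *\<^sub>R x) + (- y))" using scale[of x t] that by simp
    also have "\<dots> \<le> q (y + t *\<^sub>R x) + q (- y)" using that by (intro add) auto
    finally show ?thesis by (simp add: Q_def)
  qed
  have bdd: "bdd_below (Q y ` {0..})" if "y \<in> V" for y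
    using lower[OF that] by (intro bdd_belowI2[where m = "- q (- y)"]) auto
  have q'_le: "q' y \<le> Q y t" if "y \<in> V" "t \<ge> 0" for y t
    unfolding q'_def using that by (intro cINF_lower bdd) auto
  have q'_ge: "m \<le> q' y" if "\<And>t. t \<ge> 0 \<Longrightarrow> m \<le> Q y t" for m y
    unfolding q'_def using that by (intro cINF_greatest) auto
  have q'_0: "q' 0 = 0"
  proof (rule antisym)
    show "q' 0 \<le> 0" using q'_le[of 0 0] V by (simp add: Q_def q0 subspace_0)
    show "0 \<le> q' 0" using lower[of 0] V by (intro q'_ge) (simp add: q0 subspace_0)
  qed
  have q'_scale_le: "q' (c *\<^sub>R y) \<le> c * q' y" if "y \<in> V" "c > 0" for y c
  proof -
    have "q' (c *\<^sub>R y) / c \<le> q' y"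
    proof (rule q'_ge)
      fix t :: real assume t: "t \<ge> 0"
      have "q' (c *\<^sub>R y) \<le> Q (c *\<^sub>R y) (c * t)" using that t by (intro q'_le) auto
      also have "\<dots> = c * Q y t"
        using that t scale[of "y + t *\<^sub>R x" c] by (simp add: Q_def algebra_simps)
      finally show "q' (c *\<^sub>R y) / c \<le> Q y t" using that by (simp add: field_simps)
    qed
    then show ?thesis using that by (simp add: field_simps)
  qed
  have "sublinear_on V q'"
    unfolding sublinear_on_def
  proof (intro conjI ballI allI impI)
    fix y z assume yz: "y \<in> V" "z \<in> V"
    have *: "q' (y + z) \<le> Q y s + Q z t" if "s \<ge> 0" "t \<ge> 0" for s t
    proof -
      have "q' (y + z) \<le> Q (y + z) (s + t)" using yz that by (intro q'_le) auto
      also have "\<dots> \<le> Q y s + Q z t"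
        using add[of "y + s *\<^sub>R x" "z + t *\<^sub>R x"] yz by (simp add: Q_def algebra_simps)
      finally show ?thesis .
    qed
    have "q' (y + z) - q' z \<le> q' y"
    proof (rule q'_ge)
      fix s :: real assume "s \<ge> 0"
      then have "q' (y + z) - Q y s \<le> q' z" using *[of s] by (intro q'_ge) (simp add: algebra_simps)
      then show "q' (y + z) - q' z \<le> Q y s" by simp
    qed
    then show "q' (y + z) \<le> q' y + q' z" by simp
  next
    fix y and c :: real assume y: "y \<in> V" and "0 \<le> c"
    then consider "c = 0" | "c > 0" by linarith
    then show "q' (c *\<^sub>R y) = c * q' y"
    proof cases
      case 2
      then have "q' ((1 / c) *\<^sub>R (c *\<^sub>R y)) \<le> (1 / c) * q' (c *\<^sub>R y)"
        using y by (intro q'_scale_le) auto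
      then have "c * q' y \<le> q' (c *\<^sub>R y)" using 2 by (simp add: field_simps)
      then show ?thesis using q'_scale_le[OF y 2] by simp
    qed (simp add: q'_0)
  qed
  moreover have "q' y \<le> q y" if "y \<in> V" for y
    using q'_le[OF that, of 0] by (simp add: Q_def)
  moreover have "q' (- x) \<le> - q x"
    using q'_le[of "- x" 1] by (simp add: Q_def q0)
  ultimately show ?thesis by blast
qed

text \<open>Lowering a functional cannot spoil \<open>q' b + q' (- b) \<le> 0\<close>, so the
  directions can be treated one after the other.\<close>

lemma sublinear_on_linear_in_directions:
  assumes V: "subspace V" and q: "sublinear_on V q" and "finite B" "B \<subseteq> V"
  shows "\<exists>q'. sublinear_on V q' \<and> (\<forall>y\<in>V. q' y \<le> q y) \<and> (\<forall>b\<in>B. q' b + q' (- b) \<le> 0)"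
  using assms(3,4)
proof (induction B rule: finite_induct)
  case empty
  then show ?case using q by auto
next
  case (insert b B)
  then obtain q1 where q1: "sublinear_on V q1" "\<And>y. y \<in> V \<Longrightarrow> q1 y \<le> q y"
    "\<And>b. b \<in> B \<Longrightarrow> q1 b + q1 (- b) \<le> 0" by auto
  obtain q2 where q2: "sublinear_on V q2" "\<And>y. y \<in> V \<Longrightarrow> q2 y \<le> q1 y" "q2 (- b) \<le> - q1 b"
    using sublinear_on_linear_in_direction[OF V q1(1), of b] insert.prems by blast
  have "q2 c + q2 (- c) \<le> 0" if "c \<in> insert b B" for c
  proof -
    have "c \<in> V" "- c \<in> V" using that insert.prems V by (auto simp: subspace_neg)
    then show ?thesis
      using that q2(2)[of c] q2(2)[of "- c"] q2(3) q1(3)[of c] by force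
  qed
  then show ?case using q1(2) q2(1,2) by (meson order_trans)
qed

text \<open>A minorant that is linear along the generators is linear along their span, and any other
  \<open>y\<close> differs from the span by an element on which \<open>q\<close> is nonpositive with
  either sign. So finitely many steps replace a maximality argument.\<close>

lemma hahn_banach_finitely_generated:
  assumes V: "subspace V" and q: "sublinear_on V q" and x: "x \<in> V"
    and B: "finite B" "B \<subseteq> V"
    and gen: "\<And>y. y \<in> V \<Longrightarrow> \<exists>c. q (y - (\<Sum>b\<in>B. c b *\<^sub>R b)) \<le> 0 \<and> q ((\<Sum>b\<in>B. c b *\<^sub>R b) - y) \<le> 0"
  shows "\<exists>f. linear_functional_on V f \<and> (\<forall>y\<in>V. f y \<le> q y) \<and> f x = q x"
proof -
  note [simp] = subspace_add[OF V] subspace_scale[OF V] subspace_neg[OF V] subspace_diff[OF V] x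
  \<comment> \<open>Treating \<open>x\<close> first fixes the value there: every later minorant has
    \<open>p (- x) \<le> - q x\<close>, hence \<open>q x \<le> p x\<close> once \<open>p\<close> is
    known to be odd.\<close>
  obtain q1 where q1: "sublinear_on V q1" "\<And>y. y \<in> V \<Longrightarrow> q1 y \<le> q y" "q1 (- x) \<le> - q x"
    using sublinear_on_linear_in_direction[OF V q x] by blast
  obtain p where p: "sublinear_on V p" "\<And>y. y \<in> V \<Longrightarrow> p y \<le> q1 y"
    "\<And>b. b \<in> B \<Longrightarrow> p b + p (- b) \<le> 0"
    using sublinear_on_linear_in_directions[OF V q1(1) B] by blast
  have add: "p (y + z) \<le> p y + p z" if "y \<in> V" "z \<in> V" for y z
    using p that by (simp add: sublinear_on_def)
  have scale: "p (c *\<^sub>R y) = c * p y" if "y \<in> V" "c \<ge> 0" for y c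
    using p that by (simp add: sublinear_on_def)
  have p0: "p 0 = 0" using scale[of 0 0] V by (simp add: subspace_0)
  have pq: "p y \<le> q y" if "y \<in> V" for y
    using p(2) q1(2) that by (meson order_trans)
  \<comment> \<open>\<open>W\<close> collects the directions along which \<open>p\<close> is already
    odd; sublinearity makes it a subspace.\<close>
  define W where "W = {y \<in> V. p y + p (- y) \<le> 0}"
  have "subspace W"
    unfolding subspace_def
  proof (intro conjI ballI allI)
    show "0 \<in> W" using V by (simp add: W_def p0 subspace_0)
    fix y assume y: "y \<in> W"
    show "y + z \<in> W" if "z \<in> W" for z
      using add[of y z] add[of "- y" "- z"] y that by (auto simp: W_def algebra_simps)
    show "c *\<^sub>R y \<in> W" for c
    proof (cases "c \<ge> 0")
      case True
      have "p (c *\<^sub>R y) + p (- (c *\<^sub>R y)) = c * (p y + p (- y))"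
        using scale[of y c] scale[of "- y" c] y True by (simp add: W_def distrib_left)
      then show ?thesis using y True by (simp add: W_def mult_nonneg_nonpos)
    next
      case False
      have "p (c *\<^sub>R y) + p (- (c *\<^sub>R y)) = - c * (p y + p (- y))"
        using scale[of y "- c"] scale[of "- y" "- c"] y False
        by (simp add: W_def algebra_simps)
      then show ?thesis using y False by (simp add: W_def mult_nonpos_nonpos mult_nonneg_nonpos)
    qed
  qed
  moreover have "B \<subseteq> W" using B p(3) by (auto simp: W_def)
  ultimately have comb: "(\<Sum>b\<in>B. c b *\<^sub>R b) \<in> W" for c
    by (intro subspace_sum subspace_scale) auto
  have odd: "p (- y) = - p y" if y: "y \<in> V" for y
  proof -
    obtain c where c: "q (y - (\<Sum>b\<in>B. c b *\<^sub>R b)) \<le> 0" "q ((\<Sum>b\<in>B. c b *\<^sub>R b) - y) \<le> 0"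
      using gen[OF y] by blast
    define w where "w = (\<Sum>b\<in>B. c b *\<^sub>R b)"
    have w: "w \<in> V" "- w \<in> V" "p w + p (- w) \<le> 0" using comb[of c] by (auto simp: w_def W_def)
    have "p y \<le> p (y - w) + p w" using add[of "y - w" w] y w by simp
    moreover have "p (- y) \<le> p (w - y) + p (- w)" using add[of "w - y" "- w"] y w by simp
    moreover have "p (y - w) \<le> 0" "p (w - y) \<le> 0"
      using pq[of "y - w"] pq[of "w - y"] c y w by (auto simp: w_def)
    moreover have "0 \<le> p y + p (- y)" using add[of y "- y"] y by (simp add: p0)
    ultimately show ?thesis using w by linarith
  qed
  have "linear_functional_on V p"
    unfolding linear_functional_on_def
  proof (intro conjI ballI allI)
    fix y assume y: "y \<in> V"
    show "p (y + z) = p y + p z" if "z \<in> V" for z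
      using add[of y z] add[of "y + z" "- z"] odd[of z] y that by simp
    show "p (c *\<^sub>R y) = c * p y" for c
      using scale[of y c] scale[of y "- c"] odd[of "c *\<^sub>R y"] y by (cases "c \<ge> 0") auto
  qed
  moreover have "p x = q x"
    using pq[of x] odd[of x] p(2)[of "- x"] q1(3) by simp
  ultimately show ?thesis using pq by blast
qed


section \<open>The abstract Galerkin estimate\<close>

text \<open>Inf-sup stability in the second argument of \<open>b\<close> makes the constraint
  operator boundedly invertible modulo its kernel; \<open>M\<close> bounds the residual of
  \<open>x\<close>. The distance itself is at most \<open>M / \<beta>\<close>, and the factor 2 buys
  an actual element \<open>z\<close>.\<close>

lemma distance_to_kernel:
  assumes V: "subspace V" and n: "seminorm_on V n"
    and B: "finite B" "B \<subseteq> V" "\<And>y. y \<in> V \<Longrightarrow> \<exists>w\<in>span B. n (y - w) = 0"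
    and W: "subspace W" and s: "\<And>S. S \<in> W \<Longrightarrow> 0 \<le> s S"
    and b1: "\<And>S. S \<in> W \<Longrightarrow> linear_functional_on V (\<lambda>y. b y S)"
    and b2: "\<And>y. y \<in> V \<Longrightarrow> linear_functional_on W (b y)"
    and D: "finite D" "D \<subseteq> W"
      "\<And>S. S \<in> W \<Longrightarrow> \<exists>c. \<forall>y\<in>V. b y S = (\<Sum>d\<in>D. c d * b y d)"
    and beta: "\<beta> > 0"
    and infsup: "\<And>S m. S \<in> W \<Longrightarrow> (\<And>y. y \<in> V \<Longrightarrow> b y S \<le> m * n y) \<Longrightarrow> \<beta> * s S \<le> m"
    and x: "x \<in> V" and M: "0 \<le> M" "\<And>S. S \<in> W \<Longrightarrow> b x S \<le> M * s S"
  shows "\<exists>z\<in>V. (\<forall>S\<in>W. b z S = 0) \<and> n (x - z) \<le> 2 * M / \<beta>"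
proof -
  define Z where "Z = {z \<in> V. \<forall>S\<in>W. b z S = 0}"
  note lin1 = linear_functional_onD[OF b1 V]
  note lin2 = linear_functional_onD[OF b2 W]
  note nD = seminorm_onD[OF n V]
  note [simp] = subspace_add[OF V] subspace_scale[OF V] subspace_neg[OF V] subspace_diff[OF V] x
  have Z: "subspace Z" "Z \<subseteq> V"
    unfolding Z_def subspace_def using V lin1 by (auto simp: subspace_0)
  have ZV: "z \<in> V" if "z \<in> Z" for z using Z(2) that by blast
  define q where "q y = (INF z\<in>Z. n (y - z))" for y
  have Zne: "Z \<noteq> {}" using subspace_0[OF Z(1)] by blast
  have bdd: "bdd_below ((\<lambda>z. n (y - z)) ` Z)" if "y \<in> V" for y
    using that nD(1) ZV by (intro bdd_belowI2[where m = 0]) auto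
  have q_le: "q y \<le> n (y - z)" if "y \<in> V" "z \<in> Z" for y z
    unfolding q_def using that by (intro cINF_lower bdd)
  have q_ge: "m \<le> q y" if "\<And>z. z \<in> Z \<Longrightarrow> m \<le> n (y - z)" for m y
    unfolding q_def using that Zne by (intro cINF_greatest)
  have q_le_n: "q y \<le> n y" if "y \<in> V" for y
    using q_le[OF that subspace_0[OF Z(1)]] by simp
  have q_nonneg: "0 \<le> q y" if "y \<in> V" for y
    using that ZV by (intro q_ge nD(1)) auto
  have q_Z: "q z \<le> 0" if "z \<in> Z" for z
    using q_le[OF ZV that, OF that] nD(4) by simp
  have q_scale_le: "q (c *\<^sub>R y) \<le> c * q y" if "y \<in> V" "c > 0" for y c
  proof -
    have "q (c *\<^sub>R y) / c \<le> q y"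
    proof (rule q_ge)
      fix z assume z: "z \<in> Z"
      have "q (c *\<^sub>R y) \<le> n (c *\<^sub>R y - c *\<^sub>R z)"
        using that z Z(1) by (intro q_le) (auto simp: subspace_scale)
      also have "\<dots> = c * n (y - z)"
        using nD(3)[of "y - z" c] ZV[OF z] that by (simp add: scaleR_right_diff_distrib)
      finally show "q (c *\<^sub>R y) / c \<le> n (y - z)" using that by (simp add: field_simps)
    qed
    then show ?thesis using that by (simp add: field_simps)
  qed
  have "sublinear_on V q"
    unfolding sublinear_on_def
  proof (intro conjI ballI allI impI)
    fix y z assume yz: "y \<in> V" "z \<in> V"
    have *: "q (y + z) \<le> n (y - u) + n (z - v)" if "u \<in> Z" "v \<in> Z" for u v
    proof -
      have "q (y + z) \<le> n (y + z - (u + v))"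
        using that yz Z(1) by (intro q_le) (auto simp: subspace_add)
      also have "\<dots> \<le> n (y - u) + n (z - v)"
        using nD(2)[of "y - u" "z - v"] yz ZV[OF that(1)] ZV[OF that(2)] by (simp add: algebra_simps)
      finally show ?thesis .
    qed
    have "q (y + z) - q z \<le> q y"
    proof (rule q_ge)
      fix u assume "u \<in> Z"
      then have "q (y + z) - n (y - u) \<le> q z" using *[of u] by (intro q_ge) (simp add: algebra_simps)
      then show "q (y + z) - q z \<le> n (y - u)" by simp
    qed
    then show "q (y + z) \<le> q y + q z" by simp
  next
    fix y and c :: real assume y: "y \<in> V" and "0 \<le> c"
    then consider "c = 0" | "c > 0" by linarith
    then show "q (c *\<^sub>R y) = c * q y"
    proof cases
      case 1
      then show ?thesis using q_Z[OF subspace_0[OF Z(1)]] q_nonneg[of 0] V by (simp add: subspace_0)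
    next
      case 2
      then have "q ((1 / c) *\<^sub>R (c *\<^sub>R y)) \<le> (1 / c) * q (c *\<^sub>R y)"
        using y by (intro q_scale_le) auto
      then have "c * q y \<le> q (c *\<^sub>R y)" using 2 by (simp add: field_simps)
      then show ?thesis using q_scale_le[OF y 2] by simp
    qed
  qed
  moreover have "\<exists>c. q (y - (\<Sum>b\<in>B. c b *\<^sub>R b)) \<le> 0 \<and> q ((\<Sum>b\<in>B. c b *\<^sub>R b) - y) \<le> 0"
    if y: "y \<in> V" for y
  proof -
    obtain c where c: "n (y - (\<Sum>i\<in>B. c i *\<^sub>R i)) = 0"
      using B(3)[OF y] unfolding span_finite[OF B(1)] by blast
    have sV: "(\<Sum>i\<in>B. c i *\<^sub>R i) \<in> V" using B(2) V by (intro subspace_sum) auto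
    have "n ((\<Sum>i\<in>B. c i *\<^sub>R i) - y) = 0"
      using nD(5)[of "y - (\<Sum>i\<in>B. c i *\<^sub>R i)"] c y sV by simp
    then show ?thesis
      using c q_le_n[of "y - (\<Sum>i\<in>B. c i *\<^sub>R i)"] q_le_n[of "(\<Sum>i\<in>B. c i *\<^sub>R i) - y"] y sV
      by (intro exI[of _ c]) auto
  qed
  ultimately obtain f where f: "linear_functional_on V f" "\<And>y. y \<in> V \<Longrightarrow> f y \<le> q y" "f x = q x"
    using hahn_banach_finitely_generated[OF V _ x B(1,2)] by blast
  \<comment> \<open>A common zero \<open>z\<close> of the functionals for \<open>D\<close> lies in
    \<open>Z\<close>, and so does \<open>- z\<close>. There \<open>q\<close> is nonpositive, which
    bounds \<open>f z\<close> and \<open>- f z\<close> by 0.\<close>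
  have "f z = 0" if "z \<in> V" "\<And>d. d \<in> D \<Longrightarrow> b z d = 0" for z
  proof -
    have "b z S = 0" if S: "S \<in> W" for S
      using D(3)[OF S] \<open>z \<in> V\<close> \<open>\<And>d. d \<in> D \<Longrightarrow> b z d = 0\<close> by force
    then have "z \<in> Z" using that by (simp add: Z_def)
    moreover have "- z \<in> Z" using \<open>z \<in> Z\<close> Z(1) by (rule subspace_neg[rotated])
    ultimately show ?thesis
      using f(2)[of z] f(2)[of "- z"] q_Z[of z] q_Z[of "- z"] linear_functional_onD(4)[OF f(1) V, of z] that
      by auto
  qed
  then obtain a where a: "\<And>y. y \<in> V \<Longrightarrow> f y = (\<Sum>d\<in>D. a d * b y d)"
    using functional_combination_of_annihilators[OF D(1) V f(1), of "\<lambda>d y. b y d"] b1 D(2) by blast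
  define S where "S = (\<Sum>d\<in>D. a d *\<^sub>R d)"
  have S: "S \<in> W" unfolding S_def using D(2) W by (intro subspace_sum subspace_scale) auto
  have fS: "f y = b y S" if "y \<in> V" for y
    using linear_functional_on_sum[OF b2[OF that] W D(1), of "\<lambda>d. d" a] D(2) a[OF that]
    by (simp add: S_def subset_iff)
  \<comment> \<open>\<open>f\<close> is below \<open>q\<close> and hence below \<open>n\<close>;
    read as a bound on \<open>b y S\<close>, this is the inf-sup premise with
    \<open>m = 1\<close>.\<close>
  have "\<beta> * s S \<le> 1"
    using infsup[OF S, of 1] fS f(2) q_le_n by (metis mult_1 order_trans)
  then have "s S \<le> 1 / \<beta>" using beta by (simp add: field_simps)
  then have "M * s S \<le> M * (1 / \<beta>)" using M(1) by (rule mult_left_mono)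
  then have qx: "q x \<le> M / \<beta>" using f(3) fS[of x] M(2)[OF S] by simp
  \<comment> \<open>For positive \<open>M\<close> the value \<open>2 * M / \<beta>\<close> lies
    strictly above the infimum, so some \<open>z\<close> comes below it. For \<open>M = 0\<close>
    there is no slack, but then the bound at \<open>S\<close> and at \<open>- S\<close> puts
    \<open>x\<close> itself into the kernel.\<close>
  show ?thesis
  proof (cases "M = 0")
    case True
    have "b x S = 0" if "S \<in> W" for S
      using M(2)[OF that] M(2)[of "- S"] lin2(4)[of x S] that W True by (simp add: subspace_neg)
    then show ?thesis using True nD(4) by (intro bexI[of _ x]) auto
  next
    case False
    then have "q x < 2 * M / \<beta>"
      using qx M(1) beta by (smt (verit) divide_pos_pos mult_2 add_divide_distrib)
    then obtain z where "z \<in> Z" "n (x - z) < 2 * M / \<beta>"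
      unfolding q_def using cINF_less_iff[OF Zne bdd] x by blast
    then show ?thesis by (auto simp: Z_def intro!: bexI[of _ z])
  qed
qed

text \<open>Origin of the constants: \<open>k\<close> is the price of moving an approximation into
  the discrete kernel; \<open>K\<close> collects continuity of \<open>a\<close> and both convective
  terms, with \<open>n xh\<close> replaced by \<open>\<alpha> / 2\<close>; \<open>P\<close> is the
  factor for the error of the pair. The rest, \<open>1 + (K * P + 1) / \<beta>\<close>, comes from
  splitting \<open>S - Sh\<close> at \<open>T\<close> and bounding \<open>Sh - T\<close> by the
  inf-sup condition.\<close>

lemma galerkin_error_bound:
  fixes n :: "'x::real_vector \<Rightarrow> real" and s :: "'y::real_vector \<Rightarrow> real"
  assumes X: "subspace X" "seminorm_on X n" and Y: "subspace Y" "seminorm_on Y s"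
    and Xh: "subspace Xh" "Xh \<subseteq> X" and Yh: "subspace Yh" "Yh \<subseteq> Y"
    and a: "\<And>y. y \<in> X \<Longrightarrow> linear_functional_on X (\<lambda>x. a x y)"
      "\<And>y z. y \<in> X \<Longrightarrow> z \<in> X \<Longrightarrow> a y z \<le> A * n y * n z"
    and c: "\<And>y z. y \<in> X \<Longrightarrow> z \<in> X \<Longrightarrow> linear_functional_on X (\<lambda>w. c w y z)"
      "\<And>w z. w \<in> X \<Longrightarrow> z \<in> X \<Longrightarrow> linear_functional_on X (\<lambda>y. c w y z)"
      "\<And>w y z. w \<in> X \<Longrightarrow> y \<in> X \<Longrightarrow> z \<in> X \<Longrightarrow> c w y z \<le> n w * n y * n z"
      "\<And>w y z. w \<in> X \<Longrightarrow> y \<in> X \<Longrightarrow> z \<in> X \<Longrightarrow> c w y z = - c w z y"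
    and b: "\<And>S. S \<in> Y \<Longrightarrow> linear_functional_on X (\<lambda>y. b y S)"
      "\<And>y. y \<in> X \<Longrightarrow> linear_functional_on Y (b y)"
      "\<And>y S. y \<in> X \<Longrightarrow> S \<in> Y \<Longrightarrow> b y S \<le> n y * s S"
    and beta: "\<beta> > 0"
    and infsup: "\<And>S m. S \<in> Yh \<Longrightarrow> (\<And>y. y \<in> Xh \<Longrightarrow> b y S \<le> m * n y) \<Longrightarrow> \<beta> * s S \<le> m"
    and kernel_approx: "\<And>y M. y \<in> Xh \<Longrightarrow> 0 \<le> M \<Longrightarrow> (\<And>S. S \<in> Yh \<Longrightarrow> b y S \<le> M * s S) \<Longrightarrow>
        \<exists>z\<in>Xh. (\<forall>S\<in>Yh. b z S = 0) \<and> n (y - z) \<le> 2 * M / \<beta>"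
    and alpha: "\<alpha> > 0"
    and coercive: "\<And>z. z \<in> Xh \<Longrightarrow> (\<And>S. S \<in> Yh \<Longrightarrow> b z S = 0) \<Longrightarrow> \<alpha> * (n z)\<^sup>2 \<le> a z z"
    and A: "A \<ge> 0"
    and F: "\<And>y. y \<in> X \<Longrightarrow> F y \<le> \<alpha>\<^sup>2 / 2 * n y"
    and x: "x \<in> X" "S \<in> Y" "\<And>R. R \<in> Yh \<Longrightarrow> b x R = 0"
      "\<And>y. y \<in> Xh \<Longrightarrow> a x y + c x x y - b y S = F y"
    and xh: "xh \<in> Xh" "Sh \<in> Yh" "\<And>R. R \<in> Yh \<Longrightarrow> b xh R = 0"
      "\<And>y. y \<in> Xh \<Longrightarrow> a xh y + c xh xh y - b y Sh = F y"
    and y: "y \<in> Xh" and T: "T \<in> Yh"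
    and k: "k = 1 + 2 / \<beta>" and K: "K = A + \<alpha> / 2 + n x" and P: "P = k + 2 / \<alpha> * (K * k + 1)"
  shows "n (x - xh) + s (S - Sh) \<le> (P + 1 + (K * P + 1) / \<beta>) * (n (x - y) + s (S - T))"
proof -
  have XhX: "v \<in> X" if "v \<in> Xh" for v using Xh(2) that by blast
  have YhY: "R \<in> Y" if "R \<in> Yh" for R using Yh(2) that by blast
  note nD = seminorm_onD[OF X(2,1)]
  note sD = seminorm_onD[OF Y(2,1)]
  note aD = linear_functional_onD[OF a(1) X(1)]
  note c1 = linear_functional_onD[OF c(1) X(1)]
  note c2 = linear_functional_onD[OF c(2) X(1)]
  note b1 = linear_functional_onD[OF b(1) X(1)]
  note b2 = linear_functional_onD[OF b(2) Y(1)]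
  note [simp] = subspace_diff[OF X(1)] subspace_neg[OF X(1)] subspace_diff[OF Y(1)]
    subspace_diff[OF Xh(1)] subspace_diff[OF Yh(1)] XhX YhY x(1,2) xh(1,2) y T
  define M where "M = n (x - y)"
  define r where "r = s (S - T)"
  have M: "M \<ge> 0" "r \<ge> 0" by (auto simp: M_def r_def nD(1) sD(1))
  have nx: "n x \<ge> 0" by (simp add: nD(1))
  have k1: "k \<ge> 1" using beta by (simp add: k)
  have K0: "K \<ge> 0" using A alpha nx by (simp add: K)

  have c_diag: "c w v v = 0" if "w \<in> X" "v \<in> X" for w v
    using c(4)[of w v v] that by simp
  \<comment> \<open>Test with \<open>xh\<close>: it lies in the discrete kernel and
    \<open>c xh xh xh = 0\<close>, so only \<open>a\<close> and the load remain. The target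
    \<open>\<alpha> / 2\<close> is what the absorption of the quadratic term needs.\<close>
  have nxh: "n xh \<le> \<alpha> / 2"
  proof (cases "n xh = 0")
    case False
    have "\<alpha> * (n xh)\<^sup>2 \<le> a xh xh" using xh by (intro coercive) auto
    also have "\<dots> = F xh" using xh(4)[OF xh(1)] xh(3)[OF xh(2)] c_diag[of xh xh] by simp
    also have "\<dots> \<le> \<alpha>\<^sup>2 / 2 * n xh" using F[of xh] by simp
    finally have "(\<alpha> * n xh) * n xh \<le> (\<alpha> * (\<alpha> / 2)) * n xh"
      by (simp add: power2_eq_square algebra_simps)
    then show ?thesis using False nD(1)[of xh] alpha by auto
  qed (use alpha in simp)

  have "b y R \<le> M * s R" if R: "R \<in> Yh" for R
  proof -
    have "b y R = b (y - x) R" using x(3)[OF R] R by (simp add: b1)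
    also have "\<dots> \<le> n (y - x) * s R" using R by (intro b(3)) auto
    also have "n (y - x) = M" using nD(5)[of "x - y"] by (simp add: M_def)
    finally show ?thesis .
  qed
  then obtain z where z: "z \<in> Xh" "\<And>R. R \<in> Yh \<Longrightarrow> b z R = 0" "n (y - z) \<le> 2 * M / \<beta>"
    using kernel_approx[OF y M(1)] by blast
  note [simp] = z(1)
  define \<eta> where "\<eta> = x - z"
  define e where "e = xh - z"
  have \<eta>: "\<eta> \<in> X" by (simp add: \<eta>_def)
  have e: "e \<in> Xh" "e \<in> X" by (simp_all add: e_def)
  have e_ker: "b e R = 0" if "R \<in> Yh" for R
    using that xh(3) z(2) by (simp add: e_def b1)
  have n_eta: "n \<eta> \<le> k * M"
    using nD(2)[of "x - y" "y - z"] z(3) by (simp add: \<eta>_def M_def k algebra_simps)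
  have diff: "x - xh = \<eta> - e" by (simp add: \<eta>_def e_def)

  have conv: "c x x v - c xh xh v = c (x - xh) xh v + c x (x - xh) v" if "v \<in> X" for v
    using that by (simp add: c1 c2)
  have n_e: "n e \<le> 2 / \<alpha> * (K * n \<eta> + r)"
  proof (cases "n e = 0")
    case True
    then show ?thesis using K0 M(2) nD(1)[OF \<eta>] alpha by simp
  next
    case False
    have "\<alpha> * (n e)\<^sup>2 \<le> a e e" using e e_ker by (intro coercive) auto
    \<comment> \<open>Subtract the two equations tested with \<open>e\<close>. Since
      \<open>b e\<close> vanishes on \<open>Yh\<close>, the term with \<open>Sh\<close> disappears
      and \<open>T\<close> may be inserted, which leaves only the approximation error
      \<open>S - T\<close>.\<close>
    also have "\<dots> = a \<eta> e + c (x - xh) xh e + c x (x - xh) e - b e (S - T)"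
      using x(4)[OF e(1)] xh(4)[OF e(1)] conv[OF e(2)] e_ker[OF T] e_ker[OF xh(2)] e(2)
      by (simp add: e_def[symmetric] \<eta>_def aD b2) (simp add: e_def aD)
    also have "\<dots> = a \<eta> e + c \<eta> xh e - c e xh e + c x \<eta> e - b e (S - T)"
      unfolding diff using e(2) \<eta> by (simp add: c1 c2 c_diag)
    \<comment> \<open>The bounds on \<open>c\<close> and \<open>b\<close> are one-sided.
      Antisymmetry, and moving the sign into \<open>- e\<close>, bring every term into a shape to
      which they apply.\<close>
    also have "- c e xh e = c e e xh" using c(4)[of e xh e] e(2) by simp
    then have "a \<eta> e + c \<eta> xh e - c e xh e + c x \<eta> e - b e (S - T)
        = a \<eta> e + c \<eta> xh e + c e e xh + c x \<eta> e + b (- e) (S - T)"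
      using e(2) by (simp add: b1)
    also have "\<dots> \<le> A * n \<eta> * n e + n \<eta> * n xh * n e + n e * n e * n xh + n x * n \<eta> * n e + n (- e) * s (S - T)"
      using e(2) \<eta> by (intro add_mono a(2) c(3) b(3)) auto
    also have "\<dots> = n e * ((A + n xh + n x) * n \<eta> + n xh * n e + r)"
      using nD(5)[OF e(2)] by (simp add: r_def algebra_simps)
    finally have "n e * (\<alpha> * n e) \<le> n e * ((A + n xh + n x) * n \<eta> + n xh * n e + r)"
      by (simp add: power2_eq_square algebra_simps)
    then have "\<alpha> * n e \<le> (A + n xh + n x) * n \<eta> + n xh * n e + r"
      using False nD(1)[OF e(2)] by simp
    also have "\<dots> \<le> K * n \<eta> + \<alpha> / 2 * n e + r"
      using nxh nD(1)[OF e(2)] nD(1)[OF \<eta>] by (intro add_mono mult_right_mono) (auto simp: K)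
    finally show ?thesis using alpha by (simp add: field_simps)
  qed
  have E: "n (x - xh) \<le> P * (M + r)"
  proof -
    have "n (x - xh) \<le> n \<eta> + n e" unfolding diff using \<eta> e(2) by (rule nD(6))
    also have "\<dots> \<le> k * M + 2 / \<alpha> * (K * (k * M) + r)"
      using n_eta n_e K0 alpha
      by (smt (verit) divide_nonneg_nonneg mult_left_mono)
    also have "\<dots> \<le> k * (M + r) + 2 / \<alpha> * (K * (k * (M + r)) + (M + r))"
      using M k1 K0 alpha by (intro add_mono mult_left_mono) auto
    also have "\<dots> = P * (M + r)" by (simp add: P algebra_simps add_divide_distrib)
    finally show ?thesis .
  qed
  \<comment> \<open>The error equation for arbitrary \<open>v\<close> expresses
    \<open>b v (Sh - T)\<close> by the error of the pair, already bounded, and by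
    \<open>S - T\<close>; the inf-sup condition turns this into a norm bound.\<close>
  have "\<beta> * s (Sh - T) \<le> K * n (x - xh) + r"
  proof (rule infsup)
    fix v assume v: "v \<in> Xh"
    have "b v (Sh - T) = a (xh - x) v - c x x v + c xh xh v + b v (S - T)"
      using x(4)[OF v] xh(4)[OF v] v by (simp add: aD b2)
    also have "\<dots> = a (xh - x) v + (c (xh - x) xh v + c x (xh - x) v) + b v (S - T)"
      using conv[of v] v by (simp add: c1 c2)
    also have "\<dots> \<le> A * n (xh - x) * n v + (n (xh - x) * n xh * n v + n x * n (xh - x) * n v)
        + n v * s (S - T)"
      using v by (intro add_mono a(2) c(3) b(3)) auto
    also have "\<dots> = ((A + n xh + n x) * n (x - xh) + r) * n v"
      using nD(5)[of "x - xh"] by (simp add: r_def algebra_simps)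
    also have "\<dots> \<le> (K * n (x - xh) + r) * n v"
      using nxh nD(1)[of v] nD(1)[of "x - xh"] v
      by (intro mult_right_mono add_mono) (auto simp: K)
    finally show "b v (Sh - T) \<le> (K * n (x - xh) + r) * n v" .
  qed simp
  also have "\<dots> \<le> K * (P * (M + r)) + (M + r)"
    using E K0 M by (intro add_mono mult_left_mono) auto
  finally have "s (Sh - T) \<le> (K * P + 1) / \<beta> * (M + r)"
    using beta by (simp add: field_simps)
  moreover have "s (S - Sh) \<le> s (S - T) + s (Sh - T)"
    using sD(6)[of "S - T" "Sh - T"] by simp
  ultimately have "n (x - xh) + s (S - Sh) \<le> P * (M + r) + ((M + r) + (K * P + 1) / \<beta> * (M + r))"
    using E M by (simp add: r_def)
  then show ?thesis by (simp add: M_def r_def algebra_simps)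
qed


section \<open>Lebesgue spaces\<close>

text \<open>For positive \<open>a\<close> and \<open>b\<close> this is convexity of the power. If
  one of them is 0, it reduces to \<open>w powr p \<le> w\<close> for a weight \<open>w\<close> in
  the unit interval.\<close>

lemma powr_convex_combination:
  fixes a b :: real
  assumes p: "p \<ge> 1" and ab: "a \<ge> 0" "b \<ge> 0" and uv: "u \<ge> 0" "v \<ge> 0" "u + v = 1"
  shows "(u * a + v * b) powr p \<le> u * a powr p + v * b powr p"
proof -
  have *: "(w * c) powr p \<le> w * c powr p" if "0 \<le> w" "w \<le> 1" "0 \<le> c" for w c :: real
  proof -
    have "w powr p \<le> w"
      using powr_mono'[of 1 p w] that p by (cases "w = 0") auto
    then show ?thesis using that by (simp add: powr_mult mult_right_mono)
  qed
  consider "a = 0" | "b = 0" | "a > 0" "b > 0" using ab by linarith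
  then show ?thesis
  proof cases
    case 1
    then show ?thesis using *[of v b] ab uv p by simp
  next
    case 2
    then show ?thesis using *[of u a] ab uv p by simp
  next
    case 3
    then show ?thesis
      using powr_convex[OF p] uv unfolding convex_on_def by auto
  qed
qed

lemma powr_add_le:
  fixes a b :: real
  assumes "p \<ge> 1" "a \<ge> 0" "b \<ge> 0"
  shows "(a + b) powr p \<le> 2 powr p * (a powr p + b powr p)"
proof -
  have "(a + b) powr p = 2 powr p * (1 / 2 * a + 1 / 2 * b) powr p"
    using assms by (simp add: powr_mult[symmetric])
  also have "\<dots> \<le> 2 powr p * (1 / 2 * a powr p + 1 / 2 * b powr p)"
    using assms by (intro mult_left_mono powr_convex_combination) auto
  also have "\<dots> \<le> 2 powr p * (a powr p + b powr p)"
    by (intro mult_left_mono add_mono) auto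
  finally show ?thesis .
qed

section \<open>The vector space L^p, with the inequalities of Minkowski and Hoelder\<close>

lemma Lp_spaceD:
  assumes "f \<in> Lp_space p \<Omega>"
  shows "f \<in> borel_measurable (lebesgue_on \<Omega>)"
    and "integrable (lebesgue_on \<Omega>) (\<lambda>x. norm (f x) powr p)"
  using assms by (auto simp: Lp_space_def)

lemma Lp_norm_nonneg: "0 \<le> Lp_norm p \<Omega> f"
  by (simp add: Lp_norm_def)

lemma Lp_norm_powr:
  assumes "p > 0"
  shows "Lp_norm p \<Omega> f powr p = (LINT x|lebesgue_on \<Omega>. norm (f x) powr p)"
  using assms by (simp add: Lp_norm_def powr_powr)

lemma Lp_norm_cong_AE:
  assumes "f \<in> borel_measurable (lebesgue_on \<Omega>)" "g \<in> borel_measurable (lebesgue_on \<Omega>)"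
    and "AE x in lebesgue_on \<Omega>. f x = g x"
  shows "Lp_norm p \<Omega> f = Lp_norm p \<Omega> g"
  unfolding Lp_norm_def using assms
  by (intro arg_cong[where f = "\<lambda>t. t powr (1 / p)"] integral_cong_AE) auto

lemma Lp_norm_eq_0:
  assumes "f \<in> Lp_space p \<Omega>" "p > 0"
  shows "Lp_norm p \<Omega> f = 0 \<longleftrightarrow> (AE x in lebesgue_on \<Omega>. f x = 0)"
  using assms
  by (simp add: Lp_norm_def Lp_space_def integral_nonneg_eq_0_iff_AE)

lemma Lp_space_subspace:
  assumes p: "p \<ge> 1"
  shows "subspace (Lp_space p \<Omega> :: ('a::euclidean_space \<Rightarrow> 'b::euclidean_space) set)"
  unfolding subspace_def
proof (intro conjI ballI allI)
  show "0 \<in> (Lp_space p \<Omega> :: ('a \<Rightarrow> 'b) set)"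
    using p by (simp add: Lp_space_def zero_fun_def)
  fix f :: "'a \<Rightarrow> 'b" assume f: "f \<in> Lp_space p \<Omega>"
  note [measurable] = Lp_spaceD(1)[OF f]
  show "c *\<^sub>R f \<in> Lp_space p \<Omega>" for c
    using Lp_spaceD[OF f] by (simp add: Lp_space_def scaleR_fun_def powr_mult)
  fix g :: "'a \<Rightarrow> 'b" assume g: "g \<in> Lp_space p \<Omega>"
  note [measurable] = Lp_spaceD(1)[OF g]
  have "integrable (lebesgue_on \<Omega>) (\<lambda>x. 2 powr p * (norm (f x) powr p + norm (g x) powr p))"
    using Lp_spaceD(2)[OF f] Lp_spaceD(2)[OF g] by simp
  then have "integrable (lebesgue_on \<Omega>) (\<lambda>x. norm (f x + g x) powr p)"
  proof (rule Bochner_Integration.integrable_bound)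
    have "norm (f x + g x) powr p \<le> 2 powr p * (norm (f x) powr p + norm (g x) powr p)" for x
      using powr_mono2[OF _ _ norm_triangle_ineq[of "f x" "g x"], of p]
        powr_add_le[OF p, of "norm (f x)" "norm (g x)"] p by simp
    then show "AE x in lebesgue_on \<Omega>. norm (norm (f x + g x) powr p)
        \<le> norm (2 powr p * (norm (f x) powr p + norm (g x) powr p))"
      by simp
  qed simp
  then show "f + g \<in> Lp_space p \<Omega>"
    by (simp add: Lp_space_def plus_fun_def)
qed

lemma Lp_norm_scaleR:
  assumes "p > 0"
  shows "Lp_norm p \<Omega> (c *\<^sub>R f) = \<bar>c\<bar> * Lp_norm p \<Omega> f"
  using assms by (simp add: Lp_norm_def scaleR_fun_def powr_mult powr_powr)

text \<open>Minkowski's inequality by convexity: \<open>norm (f x) + norm (g x)\<close> is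
  \<open>a + b\<close> times the convex combination of \<open>norm (f x) / a\<close> and
  \<open>norm (g x) / b\<close> with weights \<open>a / (a + b)\<close> and
  \<open>b / (a + b)\<close>. Taking \<open>a\<close> and \<open>b\<close> slightly above the two
  norms keeps them positive and makes both normalised integrals at most 1.\<close>

lemma Lp_norm_add:
  assumes p: "p \<ge> 1" and f: "f \<in> Lp_space p \<Omega>" and g: "g \<in> Lp_space p \<Omega>"
  shows "Lp_norm p \<Omega> (f + g) \<le> Lp_norm p \<Omega> f + Lp_norm p \<Omega> g"
proof (rule field_le_epsilon)
  fix \<epsilon> :: real assume "\<epsilon> > 0"
  define a where "a = Lp_norm p \<Omega> f + \<epsilon> / 2"
  define b where "b = Lp_norm p \<Omega> g + \<epsilon> / 2"
  have ab: "a > 0" "b > 0"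
    using \<open>\<epsilon> > 0\<close> Lp_norm_nonneg[of p \<Omega> f] Lp_norm_nonneg[of p \<Omega> g] by (auto simp: a_def b_def)
  have le: "(LINT x|lebesgue_on \<Omega>. norm (f x) powr p) \<le> a powr p"
    "(LINT x|lebesgue_on \<Omega>. norm (g x) powr p) \<le> b powr p"
    using p \<open>\<epsilon> > 0\<close> by (simp_all flip: Lp_norm_powr add: a_def b_def Lp_norm_nonneg powr_mono2)
  have fg: "f + g \<in> Lp_space p \<Omega>"
    using subspace_add[OF Lp_space_subspace[OF p]] f g .
  define u where "u = (a + b) powr p * (a / (a + b)) / a powr p"
  define v where "v = (a + b) powr p * (b / (a + b)) / b powr p"
  have "norm (f x + g x) powr p \<le> u * norm (f x) powr p + v * norm (g x) powr p" for x
  proof -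
    have "norm (f x + g x) powr p \<le> (norm (f x) + norm (g x)) powr p"
      using p by (intro powr_mono2 norm_triangle_ineq) auto
    also have "\<dots> = ((a + b) * (a / (a + b) * (norm (f x) / a) + b / (a + b) * (norm (g x) / b))) powr p"
      using ab by (simp flip: add_divide_distrib)
    also have "\<dots> = (a + b) powr p * (a / (a + b) * (norm (f x) / a) + b / (a + b) * (norm (g x) / b)) powr p"
      by (rule powr_mult)
    also have "\<dots> \<le> (a + b) powr p * (a / (a + b) * (norm (f x) / a) powr p + b / (a + b) * (norm (g x) / b) powr p)"
      using ab p by (intro mult_left_mono powr_convex_combination) (auto simp flip: add_divide_distrib)
    also have "\<dots> = u * norm (f x) powr p + v * norm (g x) powr p"
      using ab by (simp add: u_def v_def powr_divide algebra_simps)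
    finally show ?thesis .
  qed
  then have "(LINT x|lebesgue_on \<Omega>. norm ((f + g) x) powr p)
      \<le> (LINT x|lebesgue_on \<Omega>. u * norm (f x) powr p + v * norm (g x) powr p)"
    using Lp_spaceD[OF f] Lp_spaceD[OF g] Lp_spaceD[OF fg]
    by (intro integral_mono) (auto simp: plus_fun_def)
  also have "\<dots> = u * (LINT x|lebesgue_on \<Omega>. norm (f x) powr p) + v * (LINT x|lebesgue_on \<Omega>. norm (g x) powr p)"
    using Lp_spaceD[OF f] Lp_spaceD[OF g] by simp
  also have "\<dots> \<le> u * a powr p + v * b powr p"
    using ab le by (intro add_mono mult_left_mono) (auto simp: u_def v_def)
  also have "\<dots> = (a + b) powr p"
    using ab by (simp add: u_def v_def flip: distrib_left add_divide_distrib)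
  finally have "Lp_norm p \<Omega> (f + g) powr p \<le> (a + b) powr p"
    using p by (simp add: Lp_norm_powr)
  then have "Lp_norm p \<Omega> (f + g) \<le> a + b"
    using powr_mono2[of "1 / p" "Lp_norm p \<Omega> (f + g) powr p" "(a + b) powr p"] p ab
    by (simp add: powr_powr Lp_norm_nonneg)
  then show "Lp_norm p \<Omega> (f + g) \<le> Lp_norm p \<Omega> f + Lp_norm p \<Omega> g + \<epsilon>"
    by (simp add: a_def b_def)
qed

lemma Holder_integrable:
  assumes pq: "p > 1" "q > 1" "1 / p + 1 / q = 1"
    and f: "f \<in> Lp_space p \<Omega>" and g: "g \<in> Lp_space q \<Omega>"
  shows "integrable (lebesgue_on \<Omega>) (\<lambda>x. norm (f x) * norm (g x))"
proof -
  note [measurable] = Lp_spaceD(1)[OF f] Lp_spaceD(1)[OF g]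
  have "integrable (lebesgue_on \<Omega>) (\<lambda>x. norm (f x) powr p / p + norm (g x) powr q / q)"
    using Lp_spaceD(2)[OF f] Lp_spaceD(2)[OF g] by simp
  then show ?thesis
  proof (rule Bochner_Integration.integrable_bound)
    have "norm (f x) * norm (g x) \<le> norm (f x) powr p / p + norm (g x) powr q / q" for x
      using pq by (intro Youngs_inequality) auto
    then show "AE x in lebesgue_on \<Omega>. norm (norm (f x) * norm (g x))
        \<le> norm (norm (f x) powr p / p + norm (g x) powr q / q)"
      using pq by auto
  qed simp
qed

text \<open>Young's inequality for the normalised \<open>f\<close> and \<open>g\<close>. Normalising
  by slightly more than the norms avoids division by 0, and the padding tends to 0 at the
  end.\<close>

lemma Holder_inequality:
  assumes pq: "p > 1" "q > 1" "1 / p + 1 / q = 1"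
    and f: "f \<in> Lp_space p \<Omega>" and g: "g \<in> Lp_space q \<Omega>"
  shows "(LINT x|lebesgue_on \<Omega>. norm (f x) * norm (g x)) \<le> Lp_norm p \<Omega> f * Lp_norm q \<Omega> g"
    (is "?I \<le> _")
proof -
  have le: "?I \<le> (Lp_norm p \<Omega> f + \<epsilon>) * (Lp_norm q \<Omega> g + \<epsilon>)" if "\<epsilon> > 0" for \<epsilon>
  proof -
    define a where "a = Lp_norm p \<Omega> f + \<epsilon>"
    define b where "b = Lp_norm q \<Omega> g + \<epsilon>"
    have ab: "a > 0" "b > 0"
      using that Lp_norm_nonneg[of p \<Omega> f] Lp_norm_nonneg[of q \<Omega> g] by (auto simp: a_def b_def)
    have I: "(LINT x|lebesgue_on \<Omega>. norm (f x) powr p) \<le> a powr p"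
      "(LINT x|lebesgue_on \<Omega>. norm (g x) powr q) \<le> b powr q"
      using pq that by (simp_all flip: Lp_norm_powr add: a_def b_def Lp_norm_nonneg powr_mono2)
    have "norm (f x) * norm (g x) \<le>
        a * b / (p * a powr p) * norm (f x) powr p + a * b / (q * b powr q) * norm (g x) powr q" for x
    proof -
      have "norm (f x) / a * (norm (g x) / b) \<le> (norm (f x) / a) powr p / p + (norm (g x) / b) powr q / q"
        using pq ab by (intro Youngs_inequality) auto
      then have "a * b * (norm (f x) / a * (norm (g x) / b))
          \<le> a * b * ((norm (f x) / a) powr p / p + (norm (g x) / b) powr q / q)"
        using ab by (intro mult_left_mono) auto
      then show ?thesis using ab by (simp add: powr_divide algebra_simps)
    qed
    then have "?I \<le> (LINT x|lebesgue_on \<Omega>.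
        a * b / (p * a powr p) * norm (f x) powr p + a * b / (q * b powr q) * norm (g x) powr q)"
      using Lp_spaceD[OF f] Lp_spaceD[OF g] Holder_integrable[OF pq f g]
      by (intro integral_mono) auto
    also have "\<dots> = a * b / (p * a powr p) * (LINT x|lebesgue_on \<Omega>. norm (f x) powr p)
        + a * b / (q * b powr q) * (LINT x|lebesgue_on \<Omega>. norm (g x) powr q)"
      using Lp_spaceD[OF f] Lp_spaceD[OF g] by simp
    also have "\<dots> \<le> a * b / (p * a powr p) * a powr p + a * b / (q * b powr q) * b powr q"
      using ab I pq by (intro add_mono mult_left_mono) auto
    also have "\<dots> = a * b * (1 / p + 1 / q)"
      using ab pq(1,2) by (simp add: field_simps)
    finally show ?thesis using pq by (simp add: a_def b_def)
  qed
  have "((\<lambda>\<epsilon>. (Lp_norm p \<Omega> f + \<epsilon>) * (Lp_norm q \<Omega> g + \<epsilon>)) \<longlongrightarrow>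
      (Lp_norm p \<Omega> f + 0) * (Lp_norm q \<Omega> g + 0)) (at_right 0)"
    by (intro tendsto_intros)
  then have "?I \<le> (Lp_norm p \<Omega> f + 0) * (Lp_norm q \<Omega> g + 0)"
    by (rule tendsto_lowerbound) (auto simp: eventually_at_right_less intro!: eventually_at_rightI[of 0 1] le)
  then show ?thesis by simp
qed

section \<open>The integral pairing between dual Lebesgue spaces\<close>

lemma pairing_integrable:
  assumes pq: "p > 1" "q > 1" "1 / p + 1 / q = 1"
    and f: "f \<in> Lp_space p \<Omega>" and g: "g \<in> Lp_space q \<Omega>"
  shows "integrable (lebesgue_on \<Omega>) (\<lambda>x. f x \<bullet> g x)"
proof -
  note [measurable] = Lp_spaceD(1)[OF f] Lp_spaceD(1)[OF g]
  show ?thesis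
    by (rule Bochner_Integration.integrable_bound[OF Holder_integrable[OF assms]])
      (auto simp: Cauchy_Schwarz_ineq2)
qed

lemma pairing_le:
  assumes pq: "p > 1" "q > 1" "1 / p + 1 / q = 1"
    and f: "f \<in> Lp_space p \<Omega>" and g: "g \<in> Lp_space q \<Omega>"
  shows "pairing \<Omega> f g \<le> Lp_norm p \<Omega> f * Lp_norm q \<Omega> g"
proof -
  have "pairing \<Omega> f g \<le> (LINT x|lebesgue_on \<Omega>. norm (f x) * norm (g x))"
    unfolding pairing_def
    by (intro integral_mono pairing_integrable[OF assms] Holder_integrable[OF assms] norm_cauchy_schwarz)
  also have "\<dots> \<le> Lp_norm p \<Omega> f * Lp_norm q \<Omega> g" by (rule Holder_inequality[OF assms])
  finally show ?thesis .
qed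

lemma pairing_commute: "pairing \<Omega> f g = pairing \<Omega> g f"
  by (simp add: pairing_def inner_commute)

lemma linear_functional_on_pairing:
  assumes pq: "p > 1" "q > 1" "1 / p + 1 / q = 1" and f: "f \<in> Lp_space p \<Omega>"
  shows "linear_functional_on (Lp_space q \<Omega>) (pairing \<Omega> f)"
  unfolding linear_functional_on_def pairing_def plus_fun_def scaleR_fun_def
  using pairing_integrable[OF pq f] by (simp add: inner_add_right)

lemma linear_functional_on_pairing_left:
  assumes pq: "p > 1" "q > 1" "1 / p + 1 / q = 1" and f: "f \<in> Lp_space p \<Omega>"
  shows "linear_functional_on (Lp_space q \<Omega>) (\<lambda>g. pairing \<Omega> g f)"
  using linear_functional_on_pairing[OF assms] by (subst pairing_commute)

lemma pairing_cong_AE: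
  assumes "f \<in> borel_measurable (lebesgue_on \<Omega>)" "f' \<in> borel_measurable (lebesgue_on \<Omega>)"
    "g \<in> borel_measurable (lebesgue_on \<Omega>)" "AE x in lebesgue_on \<Omega>. f x = f' x"
  shows "pairing \<Omega> g f = pairing \<Omega> g f'"
  unfolding pairing_def using assms by (intro integral_cong_AE) auto

lemma Lp_space_linear_comp:
  fixes L :: "'b::euclidean_space \<Rightarrow> 'c::euclidean_space"
  assumes L: "linear L" and f: "f \<in> Lp_space p \<Omega>" and p: "p > 0"
  shows "(\<lambda>x. L (f x)) \<in> Lp_space p \<Omega>"
proof -
  note [measurable] = Lp_spaceD(1)[OF f]
  have [measurable]: "L \<in> borel_measurable borel"
    using L by (intro borel_measurable_continuous_onI linear_continuous_on) (simp add: linear_conv_bounded_linear)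
  obtain B where B: "\<And>x. norm (L x) \<le> B * norm x" "B > 0"
    using linear_bounded_pos[OF L] by blast
  have "integrable (lebesgue_on \<Omega>) (\<lambda>x. B powr p * norm (f x) powr p)"
    using Lp_spaceD(2)[OF f] by simp
  then have "integrable (lebesgue_on \<Omega>) (\<lambda>x. norm (L (f x)) powr p)"
  proof (rule Bochner_Integration.integrable_bound)
    have "norm (L (f x)) powr p \<le> B powr p * norm (f x) powr p" for x
      using powr_mono2[OF _ _ B(1)[of "f x"], of p] p B(2) by (simp add: powr_mult)
    then show "AE x in lebesgue_on \<Omega>. norm (norm (L (f x)) powr p) \<le> norm (B powr p * norm (f x) powr p)"
      by simp
  qed simp
  then show ?thesis by (simp add: Lp_space_def)
qed

lemma norm_outer: "norm (outer a b) = norm a * norm b"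
proof -
  have "outer a b \<bullet> outer a b = (a \<bullet> a) * (b \<bullet> b)"
    by (simp add: outer_def inner_vec_def sum_product algebra_simps)
  then show ?thesis by (simp add: norm_eq_sqrt_inner real_sqrt_mult)
qed

lemma inner_outer: "M \<bullet> outer a b = (M *v b) \<bullet> a"
  by (simp add: outer_def inner_vec_def matrix_vector_mult_def sum_distrib_right mult.assoc
      mult.commute[of "b $ _"])

lemma measurable_outer:
  fixes u v :: "real^'n \<Rightarrow> real^'n"
  assumes "u \<in> borel_measurable M" "v \<in> borel_measurable M"
  shows "(\<lambda>x. outer (u x) (v x)) \<in> borel_measurable M"
proof (rule borel_measurable_continuous_Pair[OF assms])
  show "continuous_on UNIV (\<lambda>x. outer (fst x) (snd x))"
    unfolding outer_def by (intro continuous_intros)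
qed

text \<open>The Frobenius norm of a tensor product is the product of the two lengths, so this is
  Cauchy-Schwarz for |u|^2 and |v|^2, which lie in L^2.\<close>

lemma outer_Lp_space:
  fixes u v :: "real^'n \<Rightarrow> real^'n"
  assumes u: "u \<in> Lp_space 4 \<Omega>" and v: "v \<in> Lp_space 4 \<Omega>"
  shows "(\<lambda>x. outer (u x) (v x)) \<in> Lp_space 2 \<Omega>"
    and "Lp_norm 2 \<Omega> (\<lambda>x. outer (u x) (v x)) \<le> Lp_norm 4 \<Omega> u * Lp_norm 4 \<Omega> v"
proof -
  have sq: "(t powr 2) powr 2 = t powr 4" for t :: real by (simp add: powr_powr)
  have square: "(\<lambda>x. norm (w x) powr 2) \<in> Lp_space 2 \<Omega>"
    "Lp_norm 2 \<Omega> (\<lambda>x. norm (w x) powr 2) = (Lp_norm 4 \<Omega> w)\<^sup>2"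
    if "w \<in> Lp_space 4 \<Omega>" for w :: "real^'n \<Rightarrow> real^'n"
  proof -
    show "(\<lambda>x. norm (w x) powr 2) \<in> Lp_space 2 \<Omega>"
      using Lp_spaceD[OF that] by (auto simp: Lp_space_def sq)
    show "Lp_norm 2 \<Omega> (\<lambda>x. norm (w x) powr 2) = (Lp_norm 4 \<Omega> w)\<^sup>2"
      by (simp add: Lp_norm_def sq powr_powr flip: powr_numeral)
  qed
  have pq: "(2::real) > 1" "1 / 2 + 1 / 2 = (1::real)" by auto
  show "(\<lambda>x. outer (u x) (v x)) \<in> Lp_space 2 \<Omega>"
    using measurable_outer[OF Lp_spaceD(1)[OF u] Lp_spaceD(1)[OF v]]
      Holder_integrable[OF pq(1) pq square(1)[OF u] square(1)[OF v]]
    by (simp add: Lp_space_def norm_outer power_mult_distrib)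
  have "(Lp_norm 2 \<Omega> (\<lambda>x. outer (u x) (v x)))\<^sup>2 = Lp_norm 2 \<Omega> (\<lambda>x. outer (u x) (v x)) powr 2"
    by (simp add: Lp_norm_nonneg)
  also have "\<dots> \<le> (Lp_norm 4 \<Omega> u)\<^sup>2 * (Lp_norm 4 \<Omega> v)\<^sup>2"
    using Holder_inequality[OF pq(1) pq square(1)[OF u] square(1)[OF v],
        unfolded square(2)[OF u] square(2)[OF v]]
    by (simp add: Lp_norm_powr norm_outer power_mult_distrib)
  finally have "(Lp_norm 2 \<Omega> (\<lambda>x. outer (u x) (v x)))\<^sup>2 \<le> (Lp_norm 4 \<Omega> u * Lp_norm 4 \<Omega> v)\<^sup>2"
    by (simp add: power_mult_distrib)
  then show "Lp_norm 2 \<Omega> (\<lambda>x. outer (u x) (v x)) \<le> Lp_norm 4 \<Omega> u * Lp_norm 4 \<Omega> v"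
    by (rule power2_le_imp_le) (simp add: Lp_norm_nonneg)
qed


section \<open>Test functions approximating boxes\<close>

text \<open>The factor \<open>inverse t ^ j\<close> closes the family under differentiation: the
  derivative of \<open>bump j\<close> combines \<open>bump (j + 2)\<close> and
  \<open>bump (j + 1)\<close>.\<close>

definition bump :: "nat \<Rightarrow> real \<Rightarrow> real" where
  "bump j t = (if t > 0 then inverse t ^ j * exp (- inverse t) else 0)"

lemma bump_tendsto_0: "(bump j \<longlongrightarrow> 0) (at 0)"
proof (rule filterlim_split_at)
  show "(bump j \<longlongrightarrow> 0) (at_left 0)"
    by (rule tendsto_eventually) (auto simp: bump_def eventually_at_filter)
  have "((\<lambda>t::real. inverse t ^ j / exp (inverse t)) \<longlongrightarrow> 0) (at_right 0)"
    using tendsto_power_div_exp_0 filterlim_inverse_at_top_right by (rule filterlim_compose)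
  moreover have "\<forall>\<^sub>F t in at_right 0. inverse t ^ j / exp (inverse t) = bump j t"
    by (auto simp: bump_def eventually_at_filter exp_minus field_simps)
  ultimately show "(bump j \<longlongrightarrow> 0) (at_right 0)"
    by (rule Lim_transform_eventually)
qed

lemma DERIV_bump:
  "(bump j has_real_derivative bump (j + 2) t - real j * bump (j + 1) t) (at t)"
proof -
  consider "t > 0" | "t < 0" | "t = 0" by linarith
  then show ?thesis
  proof cases
    case 1
    \<comment> \<open>For \<open>j = 0\<close> the truncated exponent \<open>j - 1\<close> is
      harmless because its coefficient is 0.\<close>
    have "((\<lambda>s. s ^ j * exp (- s)) has_real_derivative (real j * s ^ (j - 1) - s ^ j) * exp (- s)) (at s)"
      for s :: real
      by (auto intro!: derivative_eq_intros simp: algebra_simps)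
    from DERIV_chain2[OF this DERIV_inverse]
    have "((\<lambda>t. inverse t ^ j * exp (- inverse t)) has_real_derivative
        (real j * inverse t ^ (j - 1) - inverse t ^ j) * exp (- inverse t) * - (inverse t ^ 2)) (at t)"
      using 1 by (simp add: numeral_2_eq_2)
    also have "(real j * inverse t ^ (j - 1) - inverse t ^ j) * exp (- inverse t) * - (inverse t ^ 2)
        = bump (j + 2) t - real j * bump (j + 1) t"
      using 1 by (cases j) (simp_all add: bump_def algebra_simps power2_eq_square)
    finally have "((\<lambda>t. inverse t ^ j * exp (- inverse t)) has_real_derivative
        bump (j + 2) t - real j * bump (j + 1) t) (at t)" .
    then show ?thesis
      by (rule has_field_derivative_transform_within_open[where S = "{0<..}"])
        (use 1 in \<open>auto simp: bump_def\<close>)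
  next
    case 2
    have "((\<lambda>_. 0) has_real_derivative bump (j + 2) t - real j * bump (j + 1) t) (at t)"
      using 2 by (simp add: bump_def)
    then show ?thesis
      by (rule has_field_derivative_transform_within_open[where S = "{..<0}"])
        (use 2 in \<open>auto simp: bump_def\<close>)
  next
    case 3
    \<comment> \<open>At 0 the difference quotient of \<open>bump j\<close> is
      \<open>bump (Suc j)\<close>, which tends to 0.\<close>
    have "((\<lambda>h. (bump j h - bump j 0) / (h - 0)) \<longlongrightarrow> 0) (at 0)"
      by (rule Lim_transform_eventually[OF bump_tendsto_0[of "Suc j"]])
        (auto simp: bump_def eventually_at_filter field_simps)
    then show ?thesis
      using 3 by (simp add: has_field_derivative_iff bump_def)
  qed
qed

lemma bump_0_bounds: "0 \<le> bump 0 t" "bump 0 t \<le> 1" "bump 0 t \<noteq> 0 \<longleftrightarrow> t > 0"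
  by (auto simp: bump_def)

text \<open>A class of functions closed under partial differentiation, hence a class of smooth
  functions.\<close>

inductive bump_polynomial :: "('a::euclidean_space \<Rightarrow> real) \<Rightarrow> bool" where
  const: "bump_polynomial (\<lambda>x. c)"
| bump: "bump_polynomial (\<lambda>x. bump j (x \<bullet> w + c))"
| add: "bump_polynomial f \<Longrightarrow> bump_polynomial g \<Longrightarrow> bump_polynomial (\<lambda>x. f x + g x)"
| mult: "bump_polynomial f \<Longrightarrow> bump_polynomial g \<Longrightarrow> bump_polynomial (\<lambda>x. f x * g x)"

lemma bump_polynomial_has_derivative:
  "bump_polynomial f \<Longrightarrow>
    \<exists>f'. (\<forall>x. (f has_derivative f' x) (at x)) \<and> (\<forall>b. bump_polynomial (\<lambda>x. f' x b))"
proof (induction rule: bump_polynomial.induct)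
  case (const c)
  show ?case by (rule exI[of _ "\<lambda>x b. 0"]) (auto intro: bump_polynomial.const)
next
  case (bump j w c)
  \<comment> \<open>The minus sign is kept as a constant factor, since the closure rules know only
    sums and products.\<close>
  let ?f' = "\<lambda>x b. (b \<bullet> w) * (bump (j + 2) (x \<bullet> w + c) + (- real j) * bump (j + 1) (x \<bullet> w + c))"
  have "((\<lambda>x. bump j (x \<bullet> w + c)) has_derivative ?f' x) (at x)" for x
  proof -
    have "((\<lambda>x. x \<bullet> w + c) has_derivative (\<lambda>b. b \<bullet> w)) (at x)"
      by (auto intro!: derivative_eq_intros)
    from DERIV_compose_FDERIV[OF DERIV_bump this] show ?thesis by simp
  qed
  moreover have "bump_polynomial (\<lambda>x. ?f' x b)" for b
    by (intro bump_polynomial.intros)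
  ultimately show ?case by (intro exI[of _ ?f']) auto
next
  case (add f g)
  then obtain f' g' where
    "\<forall>x. (f has_derivative f' x) (at x)" "\<forall>b. bump_polynomial (\<lambda>x. f' x b)"
    "\<forall>x. (g has_derivative g' x) (at x)" "\<forall>b. bump_polynomial (\<lambda>x. g' x b)" by blast
  then show ?case
    by (intro exI[of _ "\<lambda>x b. f' x b + g' x b"])
      (auto intro!: derivative_intros bump_polynomial.intros)
next
  case (mult f g)
  then obtain f' g' where
    "\<forall>x. (f has_derivative f' x) (at x)" "\<forall>b. bump_polynomial (\<lambda>x. f' x b)"
    "\<forall>x. (g has_derivative g' x) (at x)" "\<forall>b. bump_polynomial (\<lambda>x. g' x b)" by blast
  with mult.hyps show ?case
    by (intro exI[of _ "\<lambda>x b. f x * g' x b + f' x b * g x"])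
      (auto intro!: has_derivative_mult bump_polynomial.intros)
qed

lemma Ck_imp_continuous: "Ck k f \<Longrightarrow> continuous_on UNIV f"
  by (cases k) (auto intro!: continuous_at_imp_continuous_on differentiable_imp_continuous_within)

lemma bump_polynomial_Ck: "bump_polynomial f \<Longrightarrow> Ck k f"
proof (induction k arbitrary: f)
  case 0
  then show ?case
    using bump_polynomial_has_derivative[OF 0]
    by (auto intro: continuous_at_imp_continuous_on dest: has_derivative_continuous)
next
  case (Suc k)
  obtain f' where f': "\<And>x. (f has_derivative f' x) (at x)" "\<And>b. bump_polynomial (\<lambda>x. f' x b)"
    using bump_polynomial_has_derivative[OF Suc.prems] by blast
  have "frechet_derivative f (at x) = f' x" for x
    using frechet_derivative_at[OF f'(1)[of x]] by simp
  then show ?case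
    using f' by (auto intro!: Suc.IH simp: differentiable_def)
qed

lemma bump_polynomial_prod:
  "finite I \<Longrightarrow> (\<And>i. i \<in> I \<Longrightarrow> bump_polynomial (f i)) \<Longrightarrow> bump_polynomial (\<lambda>x. \<Prod>i\<in>I. f i x)"
  by (induction I rule: finite_induct) (auto intro: bump_polynomial.intros)

lemma bump_polynomial_power: "bump_polynomial f \<Longrightarrow> bump_polynomial (\<lambda>x. f x ^ k)"
  by (induction k) (auto intro: bump_polynomial.intros)

text \<open>In each coordinate one factor is positive to the right of \<open>a\<close> and one to
  the left of \<open>b\<close>. Both arguments have the shape \<open>x \<bullet> w + c\<close> that
  the closure rule \<open>bump\<close> expects.\<close>

definition box_bump :: "'a::euclidean_space \<Rightarrow> 'a \<Rightarrow> 'a \<Rightarrow> real" where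
  "box_bump a b x = (\<Prod>i\<in>Basis. bump 0 (x \<bullet> i + - (a \<bullet> i)) * bump 0 (x \<bullet> - i + b \<bullet> i))"

lemma box_bump_bounds: "0 \<le> box_bump a b x" "box_bump a b x \<le> 1"
  unfolding box_bump_def
  by (auto intro!: prod_nonneg prod_le_1 mult_le_one simp: bump_0_bounds)

lemma box_bump_nonzero_iff: "box_bump a b x \<noteq> 0 \<longleftrightarrow> x \<in> box a b"
  by (auto simp: box_bump_def bump_0_bounds mem_box)

lemma bump_polynomial_box_bump: "bump_polynomial (box_bump a b)"
  unfolding box_bump_def by (intro bump_polynomial_prod bump_polynomial.intros) auto

text \<open>As \<open>k\<close> grows, these test functions tend to the indicator function of the box. The sums
  and products are arranged so that the rules of \<^const>\<open>bump_polynomial\<close> apply literally.\<close>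

definition box_test :: "'a::euclidean_space \<Rightarrow> 'a \<Rightarrow> nat \<Rightarrow> 'a \<Rightarrow> real" where
  "box_test a b k x = 1 + (-1) * (1 + (-1) * box_bump a b x) ^ k"

lemma box_test_bounds: "0 \<le> box_test a b k x" "box_test a b k x \<le> 1"
  using box_bump_bounds[of a b x] by (auto simp: box_test_def intro: power_le_one)

lemma box_test_outside: "x \<notin> box a b \<Longrightarrow> box_test a b k x = 0"
  using box_bump_nonzero_iff[of a b x] by (simp add: box_test_def)

lemma box_test_tendsto: "(\<lambda>k. box_test a b k x) \<longlonglongrightarrow> indicator (box a b) x"
proof (cases "x \<in> box a b")
  case True
  then have "\<bar>1 - box_bump a b x\<bar> < 1"
    using box_bump_bounds[of a b x] box_bump_nonzero_iff[of a b x] by force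
  then have "(\<lambda>k. 1 - (1 - box_bump a b x) ^ k) \<longlonglongrightarrow> 1 - 0"
    by (intro tendsto_diff tendsto_const LIMSEQ_power_zero) simp
  then show ?thesis using True by (simp add: box_test_def)
qed (simp add: box_test_outside)

lemma test_function_box_test:
  assumes "cbox a b \<subseteq> \<Omega>"
  shows "test_function \<Omega> (box_test a b k)"
proof -
  have "bump_polynomial (box_test a b k)"
    unfolding box_test_def
    by (intro bump_polynomial.add bump_polynomial.mult bump_polynomial.const
        bump_polynomial_power bump_polynomial_box_bump)
  moreover have "closure {x. box_test a b k x \<noteq> 0} \<subseteq> cbox a b"
    by (intro closure_minimal) (use box_test_outside[of _ a b k] box_subset_cbox in auto)
  ultimately show ?thesis
    using assms bounded_subset[OF bounded_cbox order_trans[OF closure_subset], of "{x. box_test a b k x \<noteq> 0}" a b]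
    by (auto simp: test_function_def bump_polynomial_Ck)
qed

lemma continuous_box_test: "continuous_on UNIV (box_test a b k)"
  using test_function_box_test[OF subset_UNIV] Ck_imp_continuous unfolding test_function_def by blast


section \<open>The fundamental lemma of the calculus of variations\<close>

lemma test_functionD:
  assumes "test_function \<Omega> \<phi>"
  shows "continuous_on UNIV \<phi>" "compact (closure {x. \<phi> x \<noteq> 0})" "closure {x. \<phi> x \<noteq> 0} \<subseteq> \<Omega>"
  using assms Ck_imp_continuous unfolding test_function_def by blast+

text \<open>\<open>g\<close> is only locally integrable; the product is integrable because the test
  function is bounded and vanishes outside a compact subset of the domain.\<close>

lemma integrable_times_test_function:
  fixes g :: "'a::euclidean_space \<Rightarrow> real"
  assumes \<Omega>: "open \<Omega>" and \<phi>: "test_function \<Omega> \<phi>"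
    and g: "\<And>K. compact K \<Longrightarrow> K \<subseteq> \<Omega> \<Longrightarrow> g absolutely_integrable_on K"
  shows "integrable (lebesgue_on \<Omega>) (\<lambda>x. g x * \<phi> x)"
proof -
  define K where "K = closure {x. \<phi> x \<noteq> 0}"
  have K: "compact K" "K \<subseteq> \<Omega>" using test_functionD[OF \<phi>] by (auto simp: K_def)
  have out: "\<phi> x = 0" if "x \<notin> K" for x
    using that closure_subset[of "{x. \<phi> x \<noteq> 0}"] by (auto simp: K_def)
  have "compact (\<phi> ` K)"
    using K(1) test_functionD(1)[OF \<phi>] by (intro compact_continuous_image) (auto intro: continuous_on_subset)
  then obtain B where B: "\<And>x. x \<in> K \<Longrightarrow> norm (\<phi> x) \<le> B"
    using compact_imp_bounded bounded_iff by (metis imageI)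
  have gK: "integrable lebesgue (\<lambda>x. indicator K x *\<^sub>R g x)"
    using g[OF K] by (simp add: set_integrable_def)
  have \<phi>m: "\<phi> \<in> borel_measurable lebesgue"
    using test_functionD(1)[OF \<phi>] by (simp add: borel_measurable_continuous_onI measurable_completion)
  have "integrable lebesgue (\<lambda>x. B * norm (indicator K x *\<^sub>R g x))"
    using gK by (intro integrable_mult_right integrable_norm)
  then have "integrable lebesgue (\<lambda>x. indicator K x *\<^sub>R g x * \<phi> x)"
  proof (rule Bochner_Integration.integrable_bound)
    show "(\<lambda>x. indicator K x *\<^sub>R g x * \<phi> x) \<in> borel_measurable lebesgue"
      using gK \<phi>m by (intro borel_measurable_times) auto
    have "norm (indicator K x *\<^sub>R g x * \<phi> x) \<le> norm (B * norm (indicator K x *\<^sub>R g x))" for x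
    proof (cases "x \<in> K")
      case True
      have "\<bar>g x\<bar> * \<bar>\<phi> x\<bar> \<le> \<bar>g x\<bar> * \<bar>B\<bar>"
        using B[OF True] by (intro mult_left_mono) auto
      then show ?thesis using True by (simp add: abs_mult mult.commute)
    qed simp
    then show "AE x in lebesgue. norm (indicator K x *\<^sub>R g x * \<phi> x) \<le> norm (B * norm (indicator K x *\<^sub>R g x))"
      by simp
  qed
  also have "(\<lambda>x. indicator K x *\<^sub>R g x * \<phi> x) = (\<lambda>x. indicator \<Omega> x *\<^sub>R (g x * \<phi> x))"
    using K(2) out by (auto simp: indicator_def fun_eq_iff)
  finally show ?thesis
    using \<Omega> by (simp add: integrable_restrict_space)
qed

text \<open>Dynkin's argument: boxes are stable under intersection and generate the Borel sets. The
  whole space is not a box, so its integral is a separate premise, which the step to complements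
  uses.\<close>

lemma AE_zero_if_box_integrals_zero:
  fixes f :: "'a::euclidean_space \<Rightarrow> real"
  assumes f: "integrable lebesgue f"
    and zero: "\<And>a b. (LINT x:box a b|lebesgue. f x) = 0"
    and total: "(LINT x|lebesgue. f x) = 0"
  shows "AE x in lebesgue. f x = 0"
proof -
  \<comment> \<open>The argument runs over Borel sets, so \<open>f\<close> is traded for a Borel
    function equal to it almost everywhere.\<close>
  obtain g where g[measurable]: "g \<in> borel_measurable lborel" and fg: "AE x in lborel. f x = g x"
    using completion_ex_borel_measurable_real f by blast
  have fg': "AE x in lebesgue. f x = g x" using fg by (rule AE_completion)
  have gm: "g \<in> borel_measurable lebesgue" using g by (rule measurable_completion)
  have gi: "integrable lborel g"
    using integrable_cong_AE_imp[OF f gm fg'] integrable_completion[OF g] by simp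
  have eq: "(LINT x:A|lborel. g x) = (LINT x:A|lebesgue. f x)" if [measurable]: "A \<in> sets borel" for A
  proof -
    have A: "A \<in> sets lebesgue" using that by simp
    have "(LINT x:A|lborel. g x) = (LINT x:A|lebesgue. g x)"
      unfolding set_lebesgue_integral_def by (intro integral_completion[symmetric]) simp
    also have "\<dots> = (LINT x:A|lebesgue. f x)"
      using fg' f gm A by (intro set_lebesgue_integral_cong_AE) auto
    finally show ?thesis .
  qed
  have "(LINT x:A|lborel. g x) = 0" if "A \<in> sets borel" for A
  proof -
    have "Int_stable (range (\<lambda>(a, b). box a b :: 'a set))"
      by (auto simp: Int_stable_def box_Int_box)
    moreover have "range (\<lambda>(a, b). box a b :: 'a set) \<subseteq> Pow UNIV" by simp
    moreover have "A \<in> sigma_sets UNIV (range (\<lambda>(a, b). box a b))"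
      using that by (simp add: borel_eq_box)
    ultimately show ?thesis
    proof (induction A rule: sigma_sets_induct_disjoint)
      case (basic A)
      then show ?case using eq zero by auto
    next
      case empty
      then show ?case by (simp add: set_lebesgue_integral_def)
    next
      case (compl A)
      then have A: "A \<in> sets lborel" by (simp add: borel_eq_box)
      have "(LINT x:UNIV|lborel. g x) = 0"
        using eq[of UNIV] total by (simp add: set_lebesgue_integral_def)
      moreover have "(LINT x:UNIV|lborel. g x) = (LINT x:A|lborel. g x) + (LINT x:UNIV - A|lborel. g x)"
        using set_integral_Un[of A "UNIV - A" lborel g] A
          integrable_mult_indicator[OF _ gi, of A] integrable_mult_indicator[OF _ gi, of "UNIV - A"]
        by (simp add: set_integrable_def)
      ultimately show ?case using compl by simp
    next
      case (union A)
      have A: "A i \<in> sets lborel" for i using union.hyps(2) by (auto simp: borel_eq_box)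
      have "set_integrable lborel (\<Union>i. A i) g"
        unfolding set_integrable_def using A by (intro integrable_mult_indicator gi) blast
      then have "(LINT x:(\<Union>i. A i)|lborel. g x) = (\<Sum>i. (LINT x:(A i)|lborel. g x))"
        using A union.hyps(1)
        by (intro lebesgue_integral_countable_add) (auto simp: disjoint_family_on_def)
      then show ?case using union by simp
    qed
  qed
  then have "AE x in lborel. g x = 0"
    using gi by (intro sigma_finite_measure.density_zero[OF lborel.sigma_finite_measure_axioms]) auto
  then have "AE x in lebesgue. g x = 0" by (rule AE_completion)
  with fg' show ?thesis by eventually_elim simp
qed

text \<open>Dominated convergence: \<open>box_test a b k\<close> tends to the indicator of the open
  box, and its products with \<open>g\<close> are dominated by the cut-off of \<open>g\<close> to
  the closed box.\<close>

lemma box_integral_zero: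
  fixes g :: "'a::euclidean_space \<Rightarrow> real"
  assumes \<Omega>: "open \<Omega>" and sub: "cbox a b \<subseteq> \<Omega>"
    and g: "g absolutely_integrable_on (cbox a b)"
    and zero: "\<And>\<phi>. test_function \<Omega> \<phi> \<Longrightarrow> (LINT x|lebesgue_on \<Omega>. g x * \<phi> x) = 0"
  shows "(LINT x:box a b|lebesgue. g x) = 0"
proof -
  define G where "G x = indicator (cbox a b) x *\<^sub>R g x" for x
  have G: "integrable lebesgue G"
    using g unfolding G_def set_integrable_def .
  have "(\<lambda>k. LINT x|lebesgue. G x * box_test a b k x) \<longlonglongrightarrow> (LINT x|lebesgue. G x * indicator (box a b) x)"
  proof (rule integral_dominated_convergence[where w = "\<lambda>x. norm (G x)"])
    have "box_test a b k \<in> borel_measurable lebesgue" for k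
      by (intro measurable_completion)
        (simp add: borel_measurable_continuous_onI continuous_box_test)
    then show "(\<lambda>x. G x * box_test a b k x) \<in> borel_measurable lebesgue" for k
      using G by (intro borel_measurable_times) auto
    show "(\<lambda>x. G x * indicator (box a b) x) \<in> borel_measurable lebesgue"
      using G by (intro borel_measurable_times borel_measurable_indicator) auto
    show "integrable lebesgue (\<lambda>x. norm (G x))" using G by simp
    show "AE x in lebesgue. (\<lambda>k. G x * box_test a b k x) \<longlonglongrightarrow> G x * indicator (box a b) x"
      by (intro AE_I2 tendsto_mult_left box_test_tendsto)
    show "AE x in lebesgue. norm (G x * box_test a b k x) \<le> norm (G x)" for k
      using box_test_bounds[of a b k] by (auto simp: abs_mult intro!: mult_left_le)
  qed
  moreover have "(LINT x|lebesgue. G x * box_test a b k x) = 0" for k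
  proof -
    have "(\<lambda>x. G x * box_test a b k x) = (\<lambda>x. indicator \<Omega> x *\<^sub>R (g x * box_test a b k x))"
      using sub box_test_outside[of _ a b k] box_subset_cbox[of a b]
      by (auto simp: G_def indicator_def fun_eq_iff)
    then show ?thesis
      using zero[OF test_function_box_test[OF sub, of k]] \<Omega> by (simp add: integral_restrict_space)
  qed
  ultimately have "(LINT x|lebesgue. G x * indicator (box a b) x) = 0"
    by (simp add: LIMSEQ_const_iff)
  also have "(\<lambda>x. G x * indicator (box a b) x) = (\<lambda>x. indicator (box a b) x *\<^sub>R g x)"
    using box_subset_cbox[of a b] by (auto simp: G_def indicator_def fun_eq_iff)
  finally show ?thesis by (simp add: set_lebesgue_integral_def)
qed

text \<open>An open set is a countable union of closed boxes, so one box suffices. There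
  \<open>g\<close>, cut off to the open box, is integrable on the whole space and has vanishing
  integral over every box.\<close>

lemma fundamental_lemma_calculus_of_variations:
  fixes g :: "'a::euclidean_space \<Rightarrow> real"
  assumes \<Omega>: "open \<Omega>"
    and g: "\<And>K. compact K \<Longrightarrow> K \<subseteq> \<Omega> \<Longrightarrow> g absolutely_integrable_on K"
    and zero: "\<And>\<phi>. test_function \<Omega> \<phi> \<Longrightarrow> (LINT x|lebesgue_on \<Omega>. g x * \<phi> x) = 0"
  shows "AE x in lebesgue_on \<Omega>. g x = 0"
proof -
  have cbox: "AE x in lebesgue. x \<in> cbox a b \<longrightarrow> g x = 0" if sub: "cbox a b \<subseteq> \<Omega>" for a b
  proof -
    have gi: "set_integrable lebesgue (box a b) g"
      using g[OF compact_cbox sub] by (rule set_integrable_subset) (auto simp: box_subset_cbox)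
    \<comment> \<open>An empty open box can belong to a nonempty closed box that leaves the domain,
      so test functions are used for nonempty boxes only.\<close>
    have int0: "(LINT x:box c d|lebesgue. g x) = 0" if "box c d \<subseteq> box a b" for c d
    proof (cases "box c d = {}")
      case False
      then have "cbox c d \<subseteq> cbox a b"
        using that by (metis closure_box closure_mono box_subset_cbox closure_minimal closed_cbox order_trans)
      then have "cbox c d \<subseteq> \<Omega>" using sub by simp
      then show ?thesis
        using \<Omega> g zero by (intro box_integral_zero[where \<Omega> = \<Omega>]) auto
    qed (simp add: set_lebesgue_integral_def)
    have "AE x in lebesgue. indicator (box a b) x *\<^sub>R g x = 0"
    proof (rule AE_zero_if_box_integrals_zero)
      show "integrable lebesgue (\<lambda>x. indicator (box a b) x *\<^sub>R g x)"
        using gi by (simp add: set_integrable_def)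
      show "(LINT x|lebesgue. indicator (box a b) x *\<^sub>R g x) = 0"
        using int0[of a b] by (simp add: set_lebesgue_integral_def)
      fix c d
      have "(LINT x:box c d|lebesgue. indicator (box a b) x *\<^sub>R g x) = (LINT x:box c d \<inter> box a b|lebesgue. g x)"
        by (simp add: set_lebesgue_integral_def indicator_inter_arith mult.assoc)
      also have "\<dots> = 0"
        unfolding box_Int_box by (rule int0) (auto simp flip: box_Int_box)
      finally show "(LINT x:box c d|lebesgue. indicator (box a b) x *\<^sub>R g x) = 0" .
    qed
    \<comment> \<open>Cutting off to the open box loses only its boundary, a null set.\<close>
    moreover have "AE x in lebesgue. x \<notin> cbox a b - box a b"
      using negligible_frontier_interval by (intro AE_not_in) (simp flip: negligible_iff_null_sets)
    ultimately show ?thesis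
      by eventually_elim (auto simp: indicator_def split: if_splits)
  qed
  obtain \<D> where \<D>: "countable \<D>" "\<D> \<subseteq> Pow \<Omega>" "\<And>X. X \<in> \<D> \<Longrightarrow> \<exists>a b. X = cbox a b" "\<Union>\<D> = \<Omega>"
    using open_countable_Union_open_cbox[OF \<Omega>] by blast
  have "AE x in lebesgue. \<forall>X\<in>\<D>. x \<in> X \<longrightarrow> g x = 0"
  proof (rule AE_ball_countable'[OF _ \<D>(1)])
    fix X assume "X \<in> \<D>"
    then obtain a b where "X = cbox a b" "cbox a b \<subseteq> \<Omega>" using \<D> by blast
    then show "AE x in lebesgue. x \<in> X \<longrightarrow> g x = 0" using cbox by simp
  qed
  then have "AE x in lebesgue. x \<in> \<Omega> \<longrightarrow> g x = 0"
    by eventually_elim (use \<D>(4) in blast)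
  then show ?thesis using \<Omega> by (simp add: AE_restrict_space_iff)
qed


section \<open>Weak divergence\<close>

lemma continuous_in_Lp_space:
  fixes f :: "'a::euclidean_space \<Rightarrow> 'b::euclidean_space"
  assumes \<Omega>: "open \<Omega>" "bounded \<Omega>" and f: "continuous_on UNIV f" and p: "p > 0"
  shows "f \<in> Lp_space p \<Omega>"
proof -
  have fm: "f \<in> borel_measurable (lebesgue_on \<Omega>)"
    using f by (intro measurable_restrict_space1 measurable_completion)
      (simp add: borel_measurable_continuous_onI)
  have "compact (f ` closure \<Omega>)"
    using f \<Omega>(2) by (intro compact_continuous_image) (auto intro: continuous_on_subset)
  then have "bounded (f ` \<Omega>)"
    using closure_subset by (meson bounded_subset compact_imp_bounded image_mono)
  then obtain B where B: "\<And>x. x \<in> \<Omega> \<Longrightarrow> norm (f x) \<le> B"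
    by (auto simp: bounded_iff)
  interpret finite_measure "lebesgue_on \<Omega>"
    using \<Omega> by (intro finite_measure_lebesgue_on) (simp add: lmeasurable_open)
  have "integrable (lebesgue_on \<Omega>) (\<lambda>x. norm (f x) powr p)"
    using B p fm
    by (intro integrable_const_bound[where B = "B powr p"]) (auto intro!: powr_mono2 AE_I2)
  then show ?thesis using fm by (simp add: Lp_space_def)
qed

lemma continuous_grad:
  assumes "test_function \<Omega> \<phi>"
  shows "continuous_on UNIV (grad \<phi>)"
proof -
  have "Ck (Suc 0) \<phi>" using assms unfolding test_function_def by blast
  then have "continuous_on UNIV (\<lambda>x. frechet_derivative \<phi> (at x) (axis j 1))" for j
    by (simp add: axis_in_Basis_iff)
  then show ?thesis unfolding grad_def[abs_def] by (intro continuous_on_vec_lambda)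
qed

lemma test_function_integrable:
  fixes S :: "real^'n \<Rightarrow> real^'n^'n"
  assumes \<Omega>: "open \<Omega>" "bounded \<Omega>" and S: "S \<in> Lp_space 2 \<Omega>" and \<phi>: "test_function \<Omega> \<phi>"
  shows "integrable (lebesgue_on \<Omega>) (\<lambda>x. (S x $ i) \<bullet> grad \<phi> x)"
proof (rule pairing_integrable)
  show "(\<lambda>x. S x $ i) \<in> Lp_space 2 \<Omega>"
    using S by (intro Lp_space_linear_comp[where L = "\<lambda>M. M $ i"]) (auto intro: linearI)
  show "grad \<phi> \<in> Lp_space 2 \<Omega>"
    using \<Omega> continuous_grad[OF \<phi>] by (intro continuous_in_Lp_space) auto
qed auto

lemma absolutely_integrable_on_nth:
  fixes g :: "real^'n \<Rightarrow> real^'n"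
  assumes "g absolutely_integrable_on K"
  shows "(\<lambda>x. g x $ i) absolutely_integrable_on K"
  using absolutely_integrable_linear[OF assms bounded_linear_vec_nth[of i]] by (simp add: o_def)

lemma has_weak_div_integrable:
  fixes g :: "real^'n \<Rightarrow> real^'n"
  assumes "open \<Omega>" "has_weak_div \<Omega> S g" "test_function \<Omega> \<phi>"
  shows "integrable (lebesgue_on \<Omega>) (\<lambda>x. (g x $ i) * \<phi> x)"
  using assms
  by (intro integrable_times_test_function absolutely_integrable_on_nth) (auto simp: has_weak_div_def)

text \<open>One combined form serves for sums (\<open>c = 1\<close>) and for multiples
  (\<open>S = 0\<close>).\<close>

lemma has_weak_div_add_scaleR:
  assumes \<Omega>: "open \<Omega>" "bounded \<Omega>" and S: "S \<in> Lp_space 2 \<Omega>" and T: "T \<in> Lp_space 2 \<Omega>"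
    and g: "has_weak_div \<Omega> S g" and h: "has_weak_div \<Omega> T h"
  shows "has_weak_div \<Omega> (S + c *\<^sub>R T) (g + c *\<^sub>R h)"
  unfolding has_weak_div_def
proof (intro conjI allI impI)
  fix K assume "compact K \<and> K \<subseteq> \<Omega>"
  then have "g absolutely_integrable_on K" "h absolutely_integrable_on K"
    using g h by (auto simp: has_weak_div_def)
  then show "(g + c *\<^sub>R h) absolutely_integrable_on K"
    unfolding plus_fun_def scaleR_fun_def by (intro set_integral_add(1) set_integrable_scaleR_right)
next
  fix \<phi> i assume \<phi>: "test_function \<Omega> \<phi>"
  note int = test_function_integrable[OF \<Omega> S \<phi>] test_function_integrable[OF \<Omega> T \<phi>]
    has_weak_div_integrable[OF \<Omega>(1) g \<phi>] has_weak_div_integrable[OF \<Omega>(1) h \<phi>]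
  have "(LINT x|lebesgue_on \<Omega>. ((S + c *\<^sub>R T) x $ i) \<bullet> grad \<phi> x)
      = (LINT x|lebesgue_on \<Omega>. (S x $ i) \<bullet> grad \<phi> x) + c * (LINT x|lebesgue_on \<Omega>. (T x $ i) \<bullet> grad \<phi> x)"
    using int by (simp add: plus_fun_def scaleR_fun_def inner_add_left)
  also have "\<dots> = - ((LINT x|lebesgue_on \<Omega>. (g x $ i) * \<phi> x) + c * (LINT x|lebesgue_on \<Omega>. (h x $ i) * \<phi> x))"
    using g h \<phi> by (simp add: has_weak_div_def)
  also have "\<dots> = - (LINT x|lebesgue_on \<Omega>. ((g + c *\<^sub>R h) x $ i) * \<phi> x)"
    using int by (simp add: plus_fun_def scaleR_fun_def distrib_right mult.assoc)
  finally show "(LINT x|lebesgue_on \<Omega>. ((S + c *\<^sub>R T) x $ i) \<bullet> grad \<phi> x)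
      = - (LINT x|lebesgue_on \<Omega>. ((g + c *\<^sub>R h) x $ i) * \<phi> x)" .
qed

text \<open>Componentwise, the difference of two weak divergences integrates to zero against all
  test functions, so the fundamental lemma applies.\<close>

lemma has_weak_div_unique:
  assumes \<Omega>: "open \<Omega>" and g: "has_weak_div \<Omega> S g" and h: "has_weak_div \<Omega> S h"
  shows "AE x in lebesgue_on \<Omega>. g x = h x"
proof -
  have "AE x in lebesgue_on \<Omega>. g x $ i - h x $ i = 0" for i
  proof (rule fundamental_lemma_calculus_of_variations[OF \<Omega>])
    show "(\<lambda>x. g x $ i - h x $ i) absolutely_integrable_on K" if "compact K" "K \<subseteq> \<Omega>" for K
      using g h that
      by (intro set_integral_diff(1) absolutely_integrable_on_nth) (auto simp: has_weak_div_def)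
    fix \<phi> assume \<phi>: "test_function \<Omega> \<phi>"
    then have "(LINT x|lebesgue_on \<Omega>. (S x $ i) \<bullet> grad \<phi> x) = - (LINT x|lebesgue_on \<Omega>. (g x $ i) * \<phi> x)"
      "(LINT x|lebesgue_on \<Omega>. (S x $ i) \<bullet> grad \<phi> x) = - (LINT x|lebesgue_on \<Omega>. (h x $ i) * \<phi> x)"
      using g h by (simp_all add: has_weak_div_def)
    then show "(LINT x|lebesgue_on \<Omega>. (g x $ i - h x $ i) * \<phi> x) = 0"
      using has_weak_div_integrable[OF \<Omega> g \<phi>] has_weak_div_integrable[OF \<Omega> h \<phi>]
      by (simp add: left_diff_distrib)
  qed
  then have "AE x in lebesgue_on \<Omega>. \<forall>i\<in>UNIV. g x $ i - h x $ i = 0"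
    by (intro AE_finite_allI) auto
  then show ?thesis by eventually_elim (simp add: vec_eq_iff)
qed

text \<open>\<open>S_space\<close> without the condition on the mean trace: the common ambient space
  of the exact and the discrete stresses, on which \<open>S_norm\<close> is a seminorm and
  \<open>b_form\<close> is linear.\<close>

definition Hdiv_space :: "(real^'n) set \<Rightarrow> (real^'n \<Rightarrow> real^'n^'n) set" where
  "Hdiv_space \<Omega> = {S \<in> Lp_space 2 \<Omega>. \<exists>g \<in> Lp_space (4/3) \<Omega>. has_weak_div \<Omega> S g}"

text \<open>Lebesgue measure is complete, so measurability passes to any function that agrees almost
  everywhere. This serves the representative that \<open>weak_div\<close> happens to choose.\<close>

lemma measurable_lebesgue_on_cong_AE:
  fixes f g :: "'a::euclidean_space \<Rightarrow> 'b::euclidean_space"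
  assumes \<Omega>: "\<Omega> \<in> sets lebesgue" and f: "f \<in> borel_measurable (lebesgue_on \<Omega>)"
    and fg: "AE x in lebesgue_on \<Omega>. f x = g x"
  shows "g \<in> borel_measurable (lebesgue_on \<Omega>)"
proof -
  have "(\<lambda>x. indicator \<Omega> x *\<^sub>R f x) \<in> borel_measurable lebesgue"
    using f \<Omega> by (simp add: borel_measurable_restrict_space_iff)
  moreover have "AE x in lebesgue. indicator \<Omega> x *\<^sub>R f x = indicator \<Omega> x *\<^sub>R g x"
    using fg \<Omega> by (simp add: AE_restrict_space_iff) (auto elim: eventually_mono simp: indicator_def)
  ultimately have "(\<lambda>x. indicator \<Omega> x *\<^sub>R g x) \<in> borel_measurable lebesgue"
    by (rule borel_measurable_AE)
  then show ?thesis using \<Omega> by (simp add: borel_measurable_restrict_space_iff)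
qed

text \<open>By uniqueness the chosen representative agrees almost everywhere with one in L^(4/3),
  and so inherits membership.\<close>

lemma weak_div_Hdiv:
  assumes \<Omega>: "open \<Omega>" and S: "S \<in> Hdiv_space \<Omega>"
  shows "has_weak_div \<Omega> S (weak_div \<Omega> S)" "weak_div \<Omega> S \<in> Lp_space (4/3) \<Omega>"
proof -
  obtain g where g: "g \<in> Lp_space (4/3) \<Omega>" "has_weak_div \<Omega> S g"
    using S by (auto simp: Hdiv_space_def)
  show d: "has_weak_div \<Omega> S (weak_div \<Omega> S)"
    unfolding weak_div_def using g(2) by (rule someI[of "has_weak_div \<Omega> S"])
  have ae: "AE x in lebesgue_on \<Omega>. g x = weak_div \<Omega> S x"
    using has_weak_div_unique[OF \<Omega> g(2) d] .
  have gm: "weak_div \<Omega> S \<in> borel_measurable (lebesgue_on \<Omega>)"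
    by (rule measurable_lebesgue_on_cong_AE[OF _ Lp_spaceD(1)[OF g(1)] ae]) (use \<Omega> in simp)
  have "integrable (lebesgue_on \<Omega>) (\<lambda>x. norm (weak_div \<Omega> S x) powr (4/3))"
  proof (rule integrable_cong_AE_imp[OF Lp_spaceD(2)[OF g(1)]])
    show "AE x in lebesgue_on \<Omega>. norm (g x) powr (4/3) = norm (weak_div \<Omega> S x) powr (4/3)"
      using ae by eventually_elim simp
  qed (use gm in simp)
  then show "weak_div \<Omega> S \<in> Lp_space (4/3) \<Omega>" using gm by (simp add: Lp_space_def)
qed

section \<open>Linearity of the weak divergence up to null sets, and the stress norm\<close>

lemma has_weak_div_0: "has_weak_div \<Omega> 0 0"
  by (simp add: has_weak_div_def zero_fun_def)

lemma Hdiv_add_scaleR: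
  fixes \<Omega> :: "(real^'n) set"
  assumes \<Omega>: "open \<Omega>" "bounded \<Omega>" and S: "S \<in> Hdiv_space \<Omega>" and T: "T \<in> Hdiv_space \<Omega>"
  shows "S + c *\<^sub>R T \<in> Hdiv_space \<Omega>"
    and "AE x in lebesgue_on \<Omega>. weak_div \<Omega> (S + c *\<^sub>R T) x = (weak_div \<Omega> S + c *\<^sub>R weak_div \<Omega> T) x"
proof -
  have L: "subspace (Lp_space 2 \<Omega> :: (real^'n \<Rightarrow> real^'n^'n) set)"
    "subspace (Lp_space (4/3) \<Omega> :: (real^'n \<Rightarrow> real^'n) set)"
    by (auto intro: Lp_space_subspace)
  have ST: "S \<in> Lp_space 2 \<Omega>" "T \<in> Lp_space 2 \<Omega>" using S T by (auto simp: Hdiv_space_def)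
  note d = weak_div_Hdiv[OF \<Omega>(1) S] weak_div_Hdiv[OF \<Omega>(1) T]
  have w: "has_weak_div \<Omega> (S + c *\<^sub>R T) (weak_div \<Omega> S + c *\<^sub>R weak_div \<Omega> T)"
    using has_weak_div_add_scaleR[OF \<Omega> ST d(1,3)] .
  show *: "S + c *\<^sub>R T \<in> Hdiv_space \<Omega>"
    unfolding Hdiv_space_def
    using w subspace_add[OF L(1) ST(1) subspace_scale[OF L(1) ST(2)]]
      subspace_add[OF L(2) d(2) subspace_scale[OF L(2) d(4)]] by blast
  show "AE x in lebesgue_on \<Omega>. weak_div \<Omega> (S + c *\<^sub>R T) x = (weak_div \<Omega> S + c *\<^sub>R weak_div \<Omega> T) x"
    using has_weak_div_unique[OF \<Omega>(1) weak_div_Hdiv(1)[OF \<Omega>(1) *] w] .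
qed

lemma zero_in_Hdiv:
  fixes \<Omega> :: "(real^'n) set"
  shows "0 \<in> Hdiv_space \<Omega>"
proof -
  have "(0 :: real^'n \<Rightarrow> real^'n) \<in> Lp_space (4/3) \<Omega>" "(0 :: real^'n \<Rightarrow> real^'n^'n) \<in> Lp_space 2 \<Omega>"
    by (auto intro!: subspace_0[OF Lp_space_subspace])
  then show ?thesis using has_weak_div_0 by (auto simp: Hdiv_space_def)
qed

lemma subspace_Hdiv:
  assumes \<Omega>: "open \<Omega>" "bounded \<Omega>"
  shows "subspace (Hdiv_space \<Omega>)"
  unfolding subspace_def
  using Hdiv_add_scaleR(1)[OF \<Omega>, of _ _ 1] Hdiv_add_scaleR(1)[OF \<Omega> zero_in_Hdiv] zero_in_Hdiv
  by auto

lemma weak_div_add_AE: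
  assumes "open \<Omega>" "bounded \<Omega>" "S \<in> Hdiv_space \<Omega>" "T \<in> Hdiv_space \<Omega>"
  shows "AE x in lebesgue_on \<Omega>. weak_div \<Omega> (S + T) x = (weak_div \<Omega> S + weak_div \<Omega> T) x"
  using Hdiv_add_scaleR(2)[OF assms, of 1] by simp

lemma weak_div_scaleR_AE:
  fixes \<Omega> :: "(real^'n) set"
  assumes \<Omega>: "open \<Omega>" "bounded \<Omega>" and T: "T \<in> Hdiv_space \<Omega>"
  shows "AE x in lebesgue_on \<Omega>. weak_div \<Omega> (c *\<^sub>R T) x = (c *\<^sub>R weak_div \<Omega> T) x"
proof -
  have "AE x in lebesgue_on \<Omega>. weak_div \<Omega> 0 x = (0 :: real^'n \<Rightarrow> real^'n) x"
    using has_weak_div_unique[OF \<Omega>(1) weak_div_Hdiv(1)[OF \<Omega>(1) zero_in_Hdiv] has_weak_div_0] .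
  with Hdiv_add_scaleR(2)[OF \<Omega> zero_in_Hdiv T, of c] show ?thesis
    by eventually_elim simp
qed

text \<open>The integral does not see the null set on which linearity of \<open>weak_div\<close> may
  fail.\<close>

lemma linear_functional_on_pairing_weak_div:
  fixes \<Omega> :: "(real^'n) set"
  assumes \<Omega>: "open \<Omega>" "bounded \<Omega>" and u: "u \<in> Lp_space 4 \<Omega>"
  shows "linear_functional_on (Hdiv_space \<Omega>) (\<lambda>S. pairing \<Omega> u (weak_div \<Omega> S))"
proof -
  have L: "subspace (Lp_space (4/3) \<Omega> :: (real^'n \<Rightarrow> real^'n) set)" by (auto intro: Lp_space_subspace)
  note H = subspace_Hdiv[OF \<Omega>]
  note d = weak_div_Hdiv(2)[OF \<Omega>(1)]
  note m = Lp_spaceD(1)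
  have lin: "linear_functional_on (Lp_space (4/3) \<Omega>) (pairing \<Omega> u)"
    using u by (intro linear_functional_on_pairing[where p = 4]) auto
  note l = linear_functional_onD[OF lin L]
  show ?thesis
    unfolding linear_functional_on_def
  proof (intro conjI ballI allI)
    fix S assume S: "S \<in> Hdiv_space \<Omega>"
    show "pairing \<Omega> u (weak_div \<Omega> (S + T)) = pairing \<Omega> u (weak_div \<Omega> S) + pairing \<Omega> u (weak_div \<Omega> T)"
      if T: "T \<in> Hdiv_space \<Omega>" for T
      using pairing_cong_AE[OF m[OF d[OF subspace_add[OF H S T]]] m[OF subspace_add[OF L d[OF S] d[OF T]]] m[OF u]
          weak_div_add_AE[OF \<Omega> S T]] l(1)[OF d[OF S] d[OF T]] by (simp add: plus_fun_def)
    show "pairing \<Omega> u (weak_div \<Omega> (c *\<^sub>R S)) = c * pairing \<Omega> u (weak_div \<Omega> S)" for c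
      using pairing_cong_AE[OF m[OF d[OF subspace_scale[OF H S]]] m[OF subspace_scale[OF L d[OF S]]] m[OF u]
          weak_div_scaleR_AE[OF \<Omega> S]] l(2)[OF d[OF S]] by (simp add: scaleR_fun_def)
  qed
qed

lemma seminorm_on_S_norm:
  fixes \<Omega> :: "(real^'n) set"
  assumes \<Omega>: "open \<Omega>" "bounded \<Omega>"
  shows "seminorm_on (Hdiv_space \<Omega>) (S_norm \<Omega>)"
proof -
  have L: "subspace (Lp_space (4/3) \<Omega> :: (real^'n \<Rightarrow> real^'n) set)" by (auto intro: Lp_space_subspace)
  note H = subspace_Hdiv[OF \<Omega>]
  note d = weak_div_Hdiv(2)[OF \<Omega>(1)]
  note m = Lp_spaceD(1)
  have S2: "S \<in> Lp_space 2 \<Omega>" if "S \<in> Hdiv_space \<Omega>" for S :: "real^'n \<Rightarrow> real^'n^'n"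
    using that by (simp add: Hdiv_space_def)
  show ?thesis
    unfolding seminorm_on_def
  proof (intro conjI ballI allI)
    fix S assume S: "S \<in> Hdiv_space \<Omega>"
    show "0 \<le> S_norm \<Omega> S" by (simp add: S_norm_def)
    show "S_norm \<Omega> (c *\<^sub>R S) = \<bar>c\<bar> * S_norm \<Omega> S" for c
    proof -
      have "Lp_norm (4/3) \<Omega> (weak_div \<Omega> (c *\<^sub>R S)) = Lp_norm (4/3) \<Omega> (c *\<^sub>R weak_div \<Omega> S)"
        using Lp_norm_cong_AE[OF m[OF d[OF subspace_scale[OF H S]]] m[OF subspace_scale[OF L d[OF S]]]
            weak_div_scaleR_AE[OF \<Omega> S]] .
      then show ?thesis
        by (simp add: S_norm_def Lp_norm_scaleR power_mult_distrib real_sqrt_mult flip: distrib_left)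
    qed
    show "S_norm \<Omega> (S + T) \<le> S_norm \<Omega> S + S_norm \<Omega> T" if T: "T \<in> Hdiv_space \<Omega>" for T
    proof -
      have "Lp_norm (4/3) \<Omega> (weak_div \<Omega> (S + T)) = Lp_norm (4/3) \<Omega> (weak_div \<Omega> S + weak_div \<Omega> T)"
        using Lp_norm_cong_AE[OF m[OF d[OF subspace_add[OF H S T]]] m[OF subspace_add[OF L d[OF S] d[OF T]]]
            weak_div_add_AE[OF \<Omega> S T]] .
      also have "\<dots> \<le> Lp_norm (4/3) \<Omega> (weak_div \<Omega> S) + Lp_norm (4/3) \<Omega> (weak_div \<Omega> T)"
        using d[OF S] d[OF T] by (intro Lp_norm_add) auto
      finally have "S_norm \<Omega> (S + T) \<le> sqrt ((Lp_norm 2 \<Omega> S + Lp_norm 2 \<Omega> T)\<^sup>2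
          + (Lp_norm (4/3) \<Omega> (weak_div \<Omega> S) + Lp_norm (4/3) \<Omega> (weak_div \<Omega> T))\<^sup>2)"
        unfolding S_norm_def using S2[OF S] S2[OF T]
        by (intro real_sqrt_le_mono add_mono power_mono Lp_norm_add Lp_norm_nonneg) auto
      also have "\<dots> \<le> S_norm \<Omega> S + S_norm \<Omega> T"
        unfolding S_norm_def by (rule real_sqrt_sum_squares_triangle_ineq)
      finally show ?thesis .
    qed
  qed
qed


section \<open>The forms of the dual-mixed formulation\<close>

lemma sum_fun_apply: "finite I \<Longrightarrow> (\<Sum>i\<in>I. f i) x = (\<Sum>i\<in>I. f i x)"
  by (induction I rule: finite_induct) auto

lemma fe_subspaceD:
  assumes V: "fe_subspace \<Omega> \<T> X V"
  shows "subspace V" "V \<subseteq> X"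
    and "\<exists>B. finite B \<and> B \<subseteq> V \<and> (\<forall>v\<in>V. \<exists>w\<in>span B. AE x in lebesgue_on \<Omega>. v x = w x)"
proof -
  show "subspace V" "V \<subseteq> X"
    using V by (auto simp: fe_subspace_def subspace_def zero_fun_def plus_fun_def scaleR_fun_def)
  have "\<exists>B. finite B \<and> B \<subseteq> V \<and>
      (\<forall>v\<in>V. \<exists>c. AE x in lebesgue_on \<Omega>. v x = (\<Sum>b\<in>B. c b *\<^sub>R b x))"
    using V unfolding fe_subspace_def by (elim conjE)
  then obtain B where B: "finite B" "B \<subseteq> V"
    "\<forall>v\<in>V. \<exists>c. AE x in lebesgue_on \<Omega>. v x = (\<Sum>b\<in>B. c b *\<^sub>R b x)"
    by (elim exE conjE)
  have gen: "\<exists>w\<in>span B. AE x in lebesgue_on \<Omega>. v x = w x" if v: "v \<in> V" for v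
  proof -
    obtain c where c: "AE x in lebesgue_on \<Omega>. v x = (\<Sum>b\<in>B. c b *\<^sub>R b x)"
      using bspec[OF B(3) v] by (elim exE)
    have "(\<Sum>b\<in>B. c b *\<^sub>R b) \<in> span B"
      by (intro span_sum span_scale span_base)
    then show ?thesis
      using c by (intro bexI[of _ "\<Sum>b\<in>B. c b *\<^sub>R b"]) (simp_all add: sum_fun_apply[OF B(1)] scaleR_fun_def)
  qed
  show "\<exists>B. finite B \<and> B \<subseteq> V \<and> (\<forall>v\<in>V. \<exists>w\<in>span B. AE x in lebesgue_on \<Omega>. v x = w x)"
    by (intro exI[of _ B] conjI ballI B(1,2) gen)
qed

lemma Lp_norm_diff_AE_0:
  assumes "p \<ge> 1" "f \<in> Lp_space p \<Omega>" "g \<in> Lp_space p \<Omega>" "AE x in lebesgue_on \<Omega>. f x = g x"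
  shows "Lp_norm p \<Omega> (f - g) = 0"
proof -
  have "f - g \<in> Lp_space p \<Omega>"
    using subspace_diff[OF Lp_space_subspace] assms by blast
  then show ?thesis
    using assms(1,4) by (subst Lp_norm_eq_0) (auto elim: eventually_mono)
qed

text \<open>\<open>S_norm\<close> sees the divergence through a choice of representative, so almost
  everywhere equal fields need an argument: their difference has 0 as a weak divergence, and the
  chosen representative agrees with it almost everywhere.\<close>

lemma S_norm_diff_AE_0:
  assumes \<Omega>: "open \<Omega>" "bounded \<Omega>" and S: "S \<in> Hdiv_space \<Omega>" and T: "T \<in> Hdiv_space \<Omega>"
    and ae: "AE x in lebesgue_on \<Omega>. S x = T x"
  shows "S_norm \<Omega> (S - T) = 0"
proof -
  define R where "R = S - T"
  have R: "R \<in> Hdiv_space \<Omega>"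
    unfolding R_def using subspace_diff[OF subspace_Hdiv[OF \<Omega>] S T] .
  then have Rm: "R \<in> borel_measurable (lebesgue_on \<Omega>)"
    by (simp add: Hdiv_space_def Lp_space_def)
  have R0: "AE x in lebesgue_on \<Omega>. R x = 0" using ae by (simp add: R_def)
  have "has_weak_div \<Omega> R 0"
    unfolding has_weak_div_def
  proof (intro conjI allI impI)
    fix \<phi> i assume \<phi>: "test_function \<Omega> \<phi>"
    have "(LINT x|lebesgue_on \<Omega>. (R x $ i) \<bullet> grad \<phi> x) = (LINT x|lebesgue_on \<Omega>. 0)"
    proof (rule integral_cong_AE)
      show "(\<lambda>x. (R x $ i) \<bullet> grad \<phi> x) \<in> borel_measurable (lebesgue_on \<Omega>)"
        using test_function_integrable[OF \<Omega> _ \<phi>] R by (auto simp: Hdiv_space_def)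
      show "AE x in lebesgue_on \<Omega>. (R x $ i) \<bullet> grad \<phi> x = 0"
        using R0 by eventually_elim simp
    qed simp
    then show "(LINT x|lebesgue_on \<Omega>. (R x $ i) \<bullet> grad \<phi> x) = - (LINT x|lebesgue_on \<Omega>. (0 x $ i) * \<phi> x)"
      by simp
  qed (simp add: zero_fun_def)
  from has_weak_div_unique[OF \<Omega>(1) weak_div_Hdiv(1)[OF \<Omega>(1) R] this]
  have "Lp_norm (4/3) \<Omega> (weak_div \<Omega> R) = 0"
    using weak_div_Hdiv(2)[OF \<Omega>(1) R] by (simp add: Lp_norm_eq_0)
  moreover have "Lp_norm 2 \<Omega> R = 0"
    using R R0 by (simp add: Lp_norm_eq_0 Hdiv_space_def)
  ultimately show ?thesis by (simp add: S_norm_def R_def)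
qed

section \<open>The norm and the forms on pairs (G, u)\<close>

lemma product_sum_le_sqrt:
  fixes a b c d :: real
  shows "a * c + b * d \<le> sqrt (a\<^sup>2 + b\<^sup>2) * sqrt (c\<^sup>2 + d\<^sup>2)"
  using norm_cauchy_schwarz[of "(a, b)" "(c, d)"] by (simp add: norm_Pair)

text \<open>The ambient space of the abstract estimate, containing the exact and all discrete
  pairs.\<close>

definition GU_fields :: "(real^'n) set \<Rightarrow> ((real^'n \<Rightarrow> real^'n^'n) \<times> (real^'n \<Rightarrow> real^'n)) set" where
  "GU_fields \<Omega> = Lp_space 2 \<Omega> \<times> Lp_space 4 \<Omega>"

definition GU_pair_norm :: "(real^'n) set \<Rightarrow> (real^'n \<Rightarrow> real^'n^'n) \<times> (real^'n \<Rightarrow> real^'n) \<Rightarrow> real" where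
  "GU_pair_norm \<Omega> x = GU_norm \<Omega> (fst x) (snd x)"

lemma subspace_GU: "subspace (GU_fields \<Omega>)"
  unfolding GU_fields_def by (intro subspace_Times Lp_space_subspace) auto

lemma GU_pair_norm_ge:
  "Lp_norm 2 \<Omega> (fst x) \<le> GU_pair_norm \<Omega> x" "Lp_norm 4 \<Omega> (snd x) \<le> GU_pair_norm \<Omega> x"
  by (auto simp: GU_pair_norm_def GU_norm_def Lp_norm_nonneg intro!: real_le_rsqrt)

lemma GU_pair_norm_le: "GU_pair_norm \<Omega> x \<le> Lp_norm 2 \<Omega> (fst x) + Lp_norm 4 \<Omega> (snd x)"
  by (auto simp: GU_pair_norm_def GU_norm_def Lp_norm_nonneg intro!: sqrt_sum_squares_le_sum)

lemma seminorm_on_GU_pair_norm: "seminorm_on (GU_fields \<Omega>) (GU_pair_norm \<Omega>)"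
  unfolding seminorm_on_def
proof (intro conjI ballI allI)
  fix x assume x: "x \<in> GU_fields \<Omega>"
  show "0 \<le> GU_pair_norm \<Omega> x" by (simp add: GU_pair_norm_def GU_norm_def)
  show "GU_pair_norm \<Omega> (c *\<^sub>R x) = \<bar>c\<bar> * GU_pair_norm \<Omega> x" for c
    by (simp add: GU_pair_norm_def GU_norm_def Lp_norm_scaleR power_mult_distrib real_sqrt_mult
        flip: distrib_left)
  fix y assume y: "y \<in> GU_fields \<Omega>"
  have "GU_pair_norm \<Omega> (x + y) \<le> sqrt ((Lp_norm 2 \<Omega> (fst x) + Lp_norm 2 \<Omega> (fst y))\<^sup>2
      + (Lp_norm 4 \<Omega> (snd x) + Lp_norm 4 \<Omega> (snd y))\<^sup>2)"
    unfolding GU_pair_norm_def GU_norm_def fst_add snd_add using x y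
    by (intro real_sqrt_le_mono add_mono power_mono Lp_norm_add Lp_norm_nonneg)
      (auto simp: GU_fields_def)
  also have "\<dots> \<le> GU_pair_norm \<Omega> x + GU_pair_norm \<Omega> y"
    unfolding GU_pair_norm_def GU_norm_def by (rule real_sqrt_sum_squares_triangle_ineq)
  finally show "GU_pair_norm \<Omega> (x + y) \<le> GU_pair_norm \<Omega> x + GU_pair_norm \<Omega> y" .
qed

text \<open>The convective term, with \<open>(G w) \<cdot> v\<close> written as \<open>G \<cdot> (v \<otimes> w)\<close> so that only
  \<open>L\<^sup>2\<close> pairings occur and antisymmetry in the last two arguments is visible.\<close>

definition conv_form ::
  "(real^'n) set \<Rightarrow> (real^'n \<Rightarrow> real^'n^'n) \<times> (real^'n \<Rightarrow> real^'n) \<Rightarrow>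
   (real^'n \<Rightarrow> real^'n^'n) \<times> (real^'n \<Rightarrow> real^'n) \<Rightarrow>
   (real^'n \<Rightarrow> real^'n^'n) \<times> (real^'n \<Rightarrow> real^'n) \<Rightarrow> real" where
  "conv_form \<Omega> w x y = 1/2 * (pairing \<Omega> (fst x) (\<lambda>t. outer (snd y t) (snd w t))
     - pairing \<Omega> (\<lambda>t. outer (snd x t) (snd w t)) (fst y))"

lemma conv_form_antisym: "conv_form \<Omega> w x y = - conv_form \<Omega> w y x"
  by (simp add: conv_form_def pairing_commute[of \<Omega> "fst x"] pairing_commute[of \<Omega> "fst y"]
      field_simps)

lemma conv_form_linear:
  assumes "x \<in> GU_fields \<Omega>" "y \<in> GU_fields \<Omega>"
  shows "linear_functional_on (GU_fields \<Omega>) (\<lambda>w. conv_form \<Omega> w x y)"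
    and "linear_functional_on (GU_fields \<Omega>) (\<lambda>z. conv_form \<Omega> y z x)"
proof -
  have L2: "subspace (Lp_space 2 \<Omega> :: (real^'a \<Rightarrow> real^'a^'a) set)" by (rule Lp_space_subspace) simp
  have lin: "linear_functional_on (Lp_space 2 \<Omega>) (pairing \<Omega> G)"
    "linear_functional_on (Lp_space 2 \<Omega>) (\<lambda>H. pairing \<Omega> H G)"
    if "G \<in> Lp_space 2 \<Omega>" for G :: "real^'a \<Rightarrow> real^'a^'a"
    using that linear_functional_on_pairing[of 2 2 G \<Omega>] linear_functional_on_pairing_left[of 2 2 G \<Omega>]
    by auto
  note l1 = linear_functional_onD(1,2)[OF lin(1) L2]
  note l2 = linear_functional_onD(1,2)[OF lin(2) L2]
  have out: "(\<lambda>t. outer (u t) ((w + w') t)) = (\<lambda>t. outer (u t) (w t)) + (\<lambda>t. outer (u t) (w' t))"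
    "(\<lambda>t. outer (u t) ((r *\<^sub>R w) t)) = r *\<^sub>R (\<lambda>t. outer (u t) (w t))"
    "(\<lambda>t. outer ((w + w') t) (u t)) = (\<lambda>t. outer (w t) (u t)) + (\<lambda>t. outer (w' t) (u t))"
    "(\<lambda>t. outer ((r *\<^sub>R w) t) (u t)) = r *\<^sub>R (\<lambda>t. outer (w t) (u t))"
    for u w w' :: "real^'a \<Rightarrow> real^'a" and r
    by (auto simp: fun_eq_iff outer_def scaleR_fun_def vec_eq_iff algebra_simps)
  note fields = GU_fields_def mem_Times_iff
  show "linear_functional_on (GU_fields \<Omega>) (\<lambda>w. conv_form \<Omega> w x y)"
    using assms unfolding linear_functional_on_def conv_form_def fst_add snd_add fst_scaleR snd_scaleR out
    by (auto simp: fields l1 l2 outer_Lp_space algebra_simps)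
  show "linear_functional_on (GU_fields \<Omega>) (\<lambda>z. conv_form \<Omega> y z x)"
    using assms unfolding linear_functional_on_def conv_form_def fst_add snd_add fst_scaleR snd_scaleR out
    by (auto simp: fields l1 l2 outer_Lp_space algebra_simps)
qed

text \<open>Each of the two pairings is at most the product of the three norms, by the L^2 bound for
  tensor products of L^4 fields. The factor 1/2 makes the constant 1, the value assumed in
  \<open>galerkin_error_bound\<close>.\<close>

lemma conv_form_le:
  assumes "w \<in> GU_fields \<Omega>" "x \<in> GU_fields \<Omega>" "y \<in> GU_fields \<Omega>"
  shows "conv_form \<Omega> w x y \<le> GU_pair_norm \<Omega> w * GU_pair_norm \<Omega> x * GU_pair_norm \<Omega> y"
proof -
  let ?n = "GU_pair_norm \<Omega>"
  have n: "0 \<le> ?n z" for z by (simp add: GU_pair_norm_def GU_norm_def)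
  have *: "pairing \<Omega> (fst x) (\<lambda>t. outer (snd y t) (snd w t)) \<le> ?n w * ?n x * ?n y"
    if "x \<in> GU_fields \<Omega>" "y \<in> GU_fields \<Omega>" for x y
  proof -
    have m: "fst x \<in> Lp_space 2 \<Omega>" "snd y \<in> Lp_space 4 \<Omega>" "snd w \<in> Lp_space 4 \<Omega>"
      using that assms(1) by (auto simp: GU_fields_def)
    have "pairing \<Omega> (fst x) (\<lambda>t. outer (snd y t) (snd w t))
        \<le> Lp_norm 2 \<Omega> (fst x) * Lp_norm 2 \<Omega> (\<lambda>t. outer (snd y t) (snd w t))"
      using m by (intro pairing_le outer_Lp_space) auto
    also have "\<dots> \<le> Lp_norm 2 \<Omega> (fst x) * (Lp_norm 4 \<Omega> (snd y) * Lp_norm 4 \<Omega> (snd w))"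
      using m by (intro mult_left_mono outer_Lp_space Lp_norm_nonneg)
    also have "\<dots> \<le> ?n x * (?n y * ?n w)"
      by (intro mult_mono GU_pair_norm_ge n mult_nonneg_nonneg Lp_norm_nonneg)
    finally show ?thesis by (simp add: mult_ac)
  qed
  have xm: "- x \<in> GU_fields \<Omega>" and nm: "?n (- x) = ?n x"
    using assms(2) by (simp_all only: seminorm_onD(5)[OF seminorm_on_GU_pair_norm subspace_GU]
        subspace_neg[OF subspace_GU])
  \<comment> \<open>With its sign, the second pairing is the first one with \<open>y\<close> and
    \<open>- x\<close> in place of \<open>x\<close> and \<open>y\<close>, so a single one-sided
    estimate covers both.\<close>
  have "- pairing \<Omega> (\<lambda>t. outer (snd x t) (snd w t)) (fst y)
      = pairing \<Omega> (fst y) (\<lambda>t. outer (snd (- x) t) (snd w t))"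
    unfolding pairing_def by (simp add: outer_def inner_vec_def sum_negf mult_ac)
  then show ?thesis
    using *[OF assms(2,3)] *[OF assms(3) xm] nm by (simp add: conv_form_def mult_ac)
qed

lemma b_form_le:
  assumes \<Omega>: "open \<Omega>" and x: "x \<in> GU_fields \<Omega>" and S: "S \<in> Hdiv_space \<Omega>"
  shows "b_form \<Omega> (fst x) (snd x) S \<le> GU_pair_norm \<Omega> x * S_norm \<Omega> S"
proof -
  have m: "fst x \<in> Lp_space 2 \<Omega>" "snd x \<in> Lp_space 4 \<Omega>" "S \<in> Lp_space 2 \<Omega>"
    using x S by (auto simp: GU_fields_def Hdiv_space_def)
  have "b_form \<Omega> (fst x) (snd x) S \<le> Lp_norm 2 \<Omega> (fst x) * Lp_norm 2 \<Omega> S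
      + Lp_norm 4 \<Omega> (snd x) * Lp_norm (4/3) \<Omega> (weak_div \<Omega> S)"
    unfolding b_form_def using m weak_div_Hdiv(2)[OF \<Omega> S] by (intro add_mono pairing_le) auto
  also have "\<dots> \<le> GU_pair_norm \<Omega> x * S_norm \<Omega> S"
    unfolding GU_pair_norm_def GU_norm_def S_norm_def by (rule product_sum_le_sqrt)
  finally show ?thesis .
qed

lemma b_form_linear:
  assumes \<Omega>: "open \<Omega>" "bounded \<Omega>"
  shows "S \<in> Hdiv_space \<Omega> \<Longrightarrow> linear_functional_on (GU_fields \<Omega>) (\<lambda>x. b_form \<Omega> (fst x) (snd x) S)"
    and "x \<in> GU_fields \<Omega> \<Longrightarrow> linear_functional_on (Hdiv_space \<Omega>) (b_form \<Omega> (fst x) (snd x))"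
proof -
  assume S: "S \<in> Hdiv_space \<Omega>"
  then have "S \<in> Lp_space 2 \<Omega>" by (simp add: Hdiv_space_def)
  then have "linear_functional_on (Lp_space 2 \<Omega>) (\<lambda>G. pairing \<Omega> G S)"
    by (intro linear_functional_on_pairing_left[where p = 2]) auto
  moreover have "linear_functional_on (Lp_space 4 \<Omega>) (\<lambda>u. pairing \<Omega> u (weak_div \<Omega> S))"
    using weak_div_Hdiv(2)[OF \<Omega>(1) S] by (intro linear_functional_on_pairing_left[where p = "4/3"]) auto
  ultimately show "linear_functional_on (GU_fields \<Omega>) (\<lambda>x. b_form \<Omega> (fst x) (snd x) S)"
    by (auto simp: linear_functional_on_def GU_fields_def b_form_def algebra_simps)
next
  assume x: "x \<in> GU_fields \<Omega>"
  then have "linear_functional_on (Lp_space 2 \<Omega>) (pairing \<Omega> (fst x))"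
    by (intro linear_functional_on_pairing[where p = 2]) (auto simp: GU_fields_def)
  then have "linear_functional_on (Hdiv_space \<Omega>) (pairing \<Omega> (fst x))"
    by (rule linear_functional_on_subset) (auto simp: Hdiv_space_def)
  moreover have "linear_functional_on (Hdiv_space \<Omega>) (\<lambda>S. pairing \<Omega> (snd x) (weak_div \<Omega> S))"
    using \<Omega> x by (intro linear_functional_on_pairing_weak_div) (auto simp: GU_fields_def)
  ultimately show "linear_functional_on (Hdiv_space \<Omega>) (b_form \<Omega> (fst x) (snd x))"
    by (auto simp: linear_functional_on_def b_form_def algebra_simps)
qed

text \<open>Adding the first two equations, tested with the components of \<open>y\<close>, merges
  them into the single equation of the abstract estimate. The identity \<open>inner_outer\<close>
  turns the term with \<open>G t *v u t\<close> into the first half of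
  \<open>conv_form\<close>.\<close>

lemma solves_equations:
  assumes "solves \<Omega> \<A> f VG VU VS G u S"
  shows "\<And>y. y \<in> VG \<times> VU \<Longrightarrow> pairing \<Omega> (\<lambda>t. \<A> (fst (G, u) t)) (fst y) + conv_form \<Omega> (G, u) (G, u) y
      - b_form \<Omega> (fst y) (snd y) S = pairing \<Omega> f (snd y)"
    and "\<And>T. T \<in> VS \<Longrightarrow> b_form \<Omega> (fst (G, u)) (snd (G, u)) T = 0"
proof -
  fix y assume y: "y \<in> VG \<times> VU"
  have "pairing \<Omega> (\<lambda>t. G t *v u t) (snd y) = pairing \<Omega> G (\<lambda>t. outer (snd y t) (u t))"
    by (simp add: pairing_def inner_outer)
  moreover have "pairing \<Omega> (\<lambda>t. \<A> (G t)) (fst y) - 1/2 * pairing \<Omega> (\<lambda>t. outer (u t) (u t)) (fst y)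
        - pairing \<Omega> S (fst y) = 0"
    "1/2 * pairing \<Omega> (\<lambda>t. G t *v u t) (snd y) - pairing \<Omega> (weak_div \<Omega> S) (snd y) = pairing \<Omega> f (snd y)"
    using assms y by (auto simp: solves_def mem_Times_iff)
  ultimately show "pairing \<Omega> (\<lambda>t. \<A> (fst (G, u) t)) (fst y) + conv_form \<Omega> (G, u) (G, u) y
      - b_form \<Omega> (fst y) (snd y) S = pairing \<Omega> f (snd y)"
    by (simp add: conv_form_def b_form_def pairing_commute[of \<Omega> S] pairing_commute[of \<Omega> "weak_div \<Omega> S"]
      diff_divide_distrib)
next
  show "\<And>T. T \<in> VS \<Longrightarrow> b_form \<Omega> (fst (G, u)) (snd (G, u)) T = 0"
    using assms by (simp add: solves_def b_form_def)
qed

text \<open>The supremum is at most \<open>m\<close> as soon as every quotient is, and the quotients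
  range over pairs of positive norm, where one may multiply by the denominator.\<close>

lemma inf_supD:
  assumes "inf_sup \<Omega> \<beta> VG VU VS" "S \<in> VS"
    and le: "\<And>y. y \<in> VG \<times> VU \<Longrightarrow> b_form \<Omega> (fst y) (snd y) S \<le> m * GU_pair_norm \<Omega> y"
  shows "\<beta> * S_norm \<Omega> S \<le> m"
proof -
  have "ereal (\<beta> * S_norm \<Omega> S) \<le> (SUP (G, u) \<in> {(G, u). G \<in> VG \<and> u \<in> VU \<and> GU_norm \<Omega> G u \<noteq> 0}.
        ereal (b_form \<Omega> G u S / GU_norm \<Omega> G u))"
    using assms(1,2) unfolding inf_sup_def by blast
  also have "\<dots> \<le> ereal m"
  proof (rule SUP_least, clarify)
    fix G u assume "G \<in> VG" "u \<in> VU" "GU_norm \<Omega> G u \<noteq> 0"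
    moreover have "0 \<le> GU_norm \<Omega> G u" by (simp add: GU_norm_def)
    ultimately show "ereal (b_form \<Omega> G u S / GU_norm \<Omega> G u) \<le> ereal m"
      using le[of "(G, u)"] by (simp add: GU_pair_norm_def divide_le_eq)
  qed
  finally show ?thesis by simp
qed

text \<open>On the kernel, \<open>C\<^sub>0\<close> times the norm of the symmetric part bounds the
  skew part and also \<open>u\<close>. So \<open>G\<close> contributes the factor
  \<open>1 + C\<^sub>0\<close> and \<open>u\<close> the factor \<open>C\<^sub>0\<close>; the square
  of their sum divides \<open>\<nu>\<close>.\<close>

lemma kernel_coercive:
  assumes A: "constitutive \<Omega> C\<^sub>A \<nu> \<A>" and \<nu>: "\<nu> > 0"
    and K: "kernel_bound \<Omega> C\<^sub>0 VG VU VS" and C\<^sub>0: "C\<^sub>0 > 0"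
    and VG: "VG \<subseteq> Lp_space 2 \<Omega>" and z: "z \<in> VG \<times> VU"
    and ker: "\<And>S. S \<in> VS \<Longrightarrow> b_form \<Omega> (fst z) (snd z) S = 0"
  shows "\<nu> / (1 + 2 * C\<^sub>0)\<^sup>2 * (GU_pair_norm \<Omega> z)\<^sup>2 \<le> pairing \<Omega> (\<lambda>t. \<A> (fst z t)) (fst z)"
proof -
  define G where "G = fst z"
  define u where "u = snd z"
  define sy where "sy = (\<lambda>t. sym_part (G t))"
  define sk where "sk = (\<lambda>t. skw_part (G t))"
  have G: "G \<in> Lp_space 2 \<Omega>" using VG z by (auto simp: G_def)
  have lin: "linear (sym_part :: real^'a^'a \<Rightarrow> _)" "linear (skw_part :: real^'a^'a \<Rightarrow> _)"
    by (auto intro!: linearI simp: sym_part_def skw_part_def transpose_def vec_eq_iff algebra_simps)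
  have parts: "sy \<in> Lp_space 2 \<Omega>" "sk \<in> Lp_space 2 \<Omega>"
    unfolding sy_def sk_def using G lin by (auto intro: Lp_space_linear_comp)
  have "(G, u) \<in> Z_space \<Omega> VG VU VS"
    using z ker by (auto simp: Z_space_def G_def u_def)
  then have "GU_norm \<Omega> sk u \<le> C\<^sub>0 * Lp_norm 2 \<Omega> sy"
    using K unfolding kernel_bound_def sy_def sk_def by blast
  then have b: "Lp_norm 2 \<Omega> sk \<le> C\<^sub>0 * Lp_norm 2 \<Omega> sy" "Lp_norm 4 \<Omega> u \<le> C\<^sub>0 * Lp_norm 2 \<Omega> sy"
    using GU_pair_norm_ge[of \<Omega> "(sk, u)"] by (auto simp: GU_pair_norm_def)
  have "G = sy + sk"
    by (simp add: fun_eq_iff sy_def sk_def sym_part_def skw_part_def vec_eq_iff algebra_simps)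
  then have "Lp_norm 2 \<Omega> G \<le> Lp_norm 2 \<Omega> sy + Lp_norm 2 \<Omega> sk"
    using Lp_norm_add[OF _ parts] by simp
  then have "GU_pair_norm \<Omega> z \<le> (1 + 2 * C\<^sub>0) * Lp_norm 2 \<Omega> sy"
    using GU_pair_norm_le[of \<Omega> z] b by (simp add: G_def u_def algebra_simps)
  moreover have "0 \<le> GU_pair_norm \<Omega> z" by (simp add: GU_pair_norm_def GU_norm_def)
  ultimately have "(GU_pair_norm \<Omega> z)\<^sup>2 \<le> ((1 + 2 * C\<^sub>0) * Lp_norm 2 \<Omega> sy)\<^sup>2"
    by (rule power_mono)
  then have "\<nu> / (1 + 2 * C\<^sub>0)\<^sup>2 * (GU_pair_norm \<Omega> z)\<^sup>2
      \<le> \<nu> / (1 + 2 * C\<^sub>0)\<^sup>2 * ((1 + 2 * C\<^sub>0)\<^sup>2 * (Lp_norm 2 \<Omega> sy)\<^sup>2)"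
    using \<nu> by (intro mult_left_mono) (auto simp: power_mult_distrib)
  also have "\<dots> = \<nu> * (Lp_norm 2 \<Omega> sy)\<^sup>2" using C\<^sub>0 by simp
  also have "\<dots> \<le> pairing \<Omega> (\<lambda>t. \<A> (G t)) G"
    using A G unfolding constitutive_def sy_def by blast
  finally show ?thesis by (simp add: G_def)
qed

text \<open>After division by \<open>C\<close> the infima are taken one at a time, each as a
  greatest lower bound with the other terms held fixed.\<close>

lemma le_mult_sum_INF:
  fixes g :: "'a \<Rightarrow> real" and w :: "'b \<Rightarrow> real" and t :: "'c \<Rightarrow> real"
  assumes C: "C > 0" and ne: "A \<noteq> {}" "B \<noteq> {}" "D \<noteq> {}"
    and le: "\<And>a b d. a \<in> A \<Longrightarrow> b \<in> B \<Longrightarrow> d \<in> D \<Longrightarrow> L \<le> C * (g a + w b + t d)"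
  shows "L \<le> C * ((INF a\<in>A. g a) + (INF b\<in>B. w b) + (INF d\<in>D. t d))"
proof -
  have le': "L / C \<le> g a + w b + t d" if "a \<in> A" "b \<in> B" "d \<in> D" for a b d
    using le[OF that] C by (simp add: field_simps)
  have "L / C - g a - w b \<le> (INF d\<in>D. t d)" if "a \<in> A" "b \<in> B" for a b
    using le'[OF that] ne by (intro cINF_greatest) (auto simp: algebra_simps)
  then have "L / C - g a - (INF d\<in>D. t d) \<le> (INF b\<in>B. w b)" if "a \<in> A" for a
    using that ne by (intro cINF_greatest) (auto simp: algebra_simps)
  then have "L / C - (INF b\<in>B. w b) - (INF d\<in>D. t d) \<le> (INF a\<in>A. g a)"
    using ne by (intro cINF_greatest) (auto simp: algebra_simps)
  then show ?thesis using C by (simp add: field_simps)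
qed


section \<open>The discrete kernel\<close>

text \<open>Generators of the factors are embedded as \<open>(g, 0)\<close> and
  \<open>(0, u)\<close>. They represent fields only almost everywhere, hence the generation up to
  norm zero that \<open>distance_to_kernel\<close> works with.\<close>

lemma fe_pair_generated:
  fixes \<Omega> :: "(real^'n) set"
  assumes VG: "fe_subspace \<Omega> \<T> (G_space \<Omega>) VG" and VU: "fe_subspace \<Omega> \<T>' (U_space \<Omega>) VU"
  shows "\<exists>B. finite B \<and> B \<subseteq> VG \<times> VU \<and> (\<forall>y\<in>VG \<times> VU. \<exists>w\<in>span B. GU_pair_norm \<Omega> (y - w) = 0)"
proof -
  note G = fe_subspaceD(1,2)[OF VG] and U = fe_subspaceD(1,2)[OF VU]
  have sub: "VG \<subseteq> Lp_space 2 \<Omega>" "VU \<subseteq> Lp_space 4 \<Omega>"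
    using G(2) U(2) by (auto simp: G_space_def U_space_def)
  obtain BG where BG: "finite BG" "BG \<subseteq> VG"
    "\<And>v. v \<in> VG \<Longrightarrow> \<exists>w\<in>span BG. AE x in lebesgue_on \<Omega>. v x = w x"
    using fe_subspaceD(3)[OF VG] by (elim exE conjE) simp
  obtain BU where BU: "finite BU" "BU \<subseteq> VU"
    "\<And>v. v \<in> VU \<Longrightarrow> \<exists>w\<in>span BU. AE x in lebesgue_on \<Omega>. v x = w x"
    using fe_subspaceD(3)[OF VU] by (elim exE conjE) simp
  define B where "B = (\<lambda>g. (g, 0)) ` BG \<union> (\<lambda>u. (0, u)) ` BU"
  have "\<exists>w\<in>span B. GU_pair_norm \<Omega> (y - w) = 0" if y: "y \<in> VG \<times> VU" for y
  proof -
    obtain g where g: "g \<in> span BG" "AE x in lebesgue_on \<Omega>. fst y x = g x"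
      using BG(3)[of "fst y"] y by auto
    obtain u where u: "u \<in> span BU" "AE x in lebesgue_on \<Omega>. snd y x = u x"
      using BU(3)[of "snd y"] y by auto
    have "g \<in> Lp_space 2 \<Omega>" "u \<in> Lp_space 4 \<Omega>"
      using g(1) u(1) span_minimal[OF BG(2) G(1)] span_minimal[OF BU(2) U(1)] sub by auto
    then have "GU_pair_norm \<Omega> (y - (g, u)) = 0"
      using Lp_norm_diff_AE_0[OF _ _ _ g(2), of 2] Lp_norm_diff_AE_0[OF _ _ _ u(2), of 4] sub y
      by (auto simp: GU_pair_norm_def GU_norm_def)
    moreover have "(g, 0) \<in> span B"
    proof -
      have "linear (\<lambda>g :: real^'n \<Rightarrow> real^'n^'n. (g, 0 :: real^'n \<Rightarrow> real^'n))"
        by (rule linearI) auto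
      from linear_span_image[OF this, of BG] have "(g, 0 :: real^'n \<Rightarrow> real^'n) \<in> span ((\<lambda>g. (g, 0)) ` BG)"
        using g(1) by auto
      then show ?thesis using span_mono[of _ B] by (auto simp: B_def)
    qed
    moreover have "(0, u) \<in> span B"
    proof -
      have "linear (\<lambda>u :: real^'n \<Rightarrow> real^'n. (0 :: real^'n \<Rightarrow> real^'n^'n, u))"
        by (rule linearI) auto
      from linear_span_image[OF this, of BU] have "(0 :: real^'n \<Rightarrow> real^'n^'n, u) \<in> span ((\<lambda>u. (0, u)) ` BU)"
        using u(1) by auto
      then show ?thesis using span_mono[of _ B] by (auto simp: B_def)
    qed
    ultimately show ?thesis
      using span_add[of "(g, 0)" B "(0, u)"] by (intro bexI[of _ "(g, u)"]) auto
  qed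
  moreover have "finite B" "B \<subseteq> VG \<times> VU"
    using BG BU subspace_0[OF G(1)] subspace_0[OF U(1)] by (auto simp: B_def)
  ultimately show ?thesis by blast
qed

text \<open>\<open>S\<close> and its combination of generators agree almost everywhere, so their
  difference has \<open>S_norm\<close> 0 and \<open>b_form\<close> cannot tell them apart. The
  coefficients therefore depend on \<open>S\<close> alone and not on \<open>y\<close>.\<close>

lemma fe_b_form_generated:
  fixes \<Omega> :: "(real^'n) set"
  assumes \<Omega>: "open \<Omega>" "bounded \<Omega>" and VS: "fe_subspace \<Omega> \<T> (S_space \<Omega>) VS"
  shows "\<exists>D. finite D \<and> D \<subseteq> VS \<and> (\<forall>S\<in>VS. \<exists>c. \<forall>y\<in>GU_fields \<Omega>.
           b_form \<Omega> (fst y) (snd y) S = (\<Sum>d\<in>D. c d * b_form \<Omega> (fst y) (snd y) d))"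
proof -
  note H = subspace_Hdiv[OF \<Omega>]
  have sub: "VS \<subseteq> Hdiv_space \<Omega>"
    using fe_subspaceD(2)[OF VS] by (auto simp: S_space_def Hdiv_space_def)
  obtain D where D: "finite D" "D \<subseteq> VS"
    "\<And>v. v \<in> VS \<Longrightarrow> \<exists>w\<in>span D. AE x in lebesgue_on \<Omega>. v x = w x"
    using fe_subspaceD(3)[OF VS] by (elim exE conjE) simp
  have "\<exists>c. \<forall>y\<in>GU_fields \<Omega>. b_form \<Omega> (fst y) (snd y) S = (\<Sum>d\<in>D. c d * b_form \<Omega> (fst y) (snd y) d)"
    if S: "S \<in> VS" for S
  proof -
    obtain w where w: "w \<in> span D" "AE x in lebesgue_on \<Omega>. S x = w x"
      using D(3)[OF S] by blast
    obtain c where c: "w = (\<Sum>d\<in>D. c d *\<^sub>R d)"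
      using w(1) unfolding span_finite[OF D(1)] by blast
    have SH: "S \<in> Hdiv_space \<Omega>" using S sub by blast
    have wH: "w \<in> Hdiv_space \<Omega>"
      using w(1) span_minimal[OF _ H, of D] D(2) sub by blast
    have "b_form \<Omega> (fst y) (snd y) S = (\<Sum>d\<in>D. c d * b_form \<Omega> (fst y) (snd y) d)"
      if y: "y \<in> GU_fields \<Omega>" for y
    proof -
      note lin = b_form_linear(2)[OF \<Omega> y]
      note l = linear_functional_onD[OF lin H]
      \<comment> \<open>The bound on \<open>b_form\<close> is one-sided, so both differences are
        needed to obtain equality.\<close>
      have "S_norm \<Omega> (S - w) = 0" "S_norm \<Omega> (w - S) = 0"
        using S_norm_diff_AE_0[OF \<Omega> SH wH w(2)]
          seminorm_onD(5)[OF seminorm_on_S_norm[OF \<Omega>] H subspace_diff[OF H SH wH]] by simp_all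
      then have "b_form \<Omega> (fst y) (snd y) S = b_form \<Omega> (fst y) (snd y) w"
        using b_form_le[OF \<Omega>(1) y subspace_diff[OF H SH wH]] b_form_le[OF \<Omega>(1) y subspace_diff[OF H wH SH]]
        by (simp add: l(5)[OF SH wH] l(5)[OF wH SH])
      also have "\<dots> = (\<Sum>d\<in>D. c d * b_form \<Omega> (fst y) (snd y) d)"
        unfolding c using D(2) sub by (intro linear_functional_on_sum[OF lin H D(1)]) auto
      finally show ?thesis .
    qed
    then show ?thesis by blast
  qed
  with D(1,2) show ?thesis by blast
qed

lemma discrete_kernel_approximation:
  fixes \<Omega> :: "(real^'n) set"
  assumes \<Omega>: "open \<Omega>" "bounded \<Omega>"
    and VG: "fe_subspace \<Omega> \<T> (G_space \<Omega>) VG" and VU: "fe_subspace \<Omega> \<T> (U_space \<Omega>) VU"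
    and VS: "fe_subspace \<Omega> \<T> (S_space \<Omega>) VS"
    and beta: "\<beta> > 0" and infsup: "inf_sup \<Omega> \<beta> VG VU VS"
    and y: "y \<in> VG \<times> VU" and M: "0 \<le> M"
    and le: "\<And>S. S \<in> VS \<Longrightarrow> b_form \<Omega> (fst y) (snd y) S \<le> M * S_norm \<Omega> S"
  shows "\<exists>z\<in>VG \<times> VU. (\<forall>S\<in>VS. b_form \<Omega> (fst z) (snd z) S = 0) \<and> GU_pair_norm \<Omega> (y - z) \<le> 2 * M / \<beta>"
proof -
  have sub: "VG \<times> VU \<subseteq> GU_fields \<Omega>"
    using fe_subspaceD(2)[OF VG] fe_subspaceD(2)[OF VU]
    by (auto simp: G_space_def U_space_def GU_fields_def)
  have subS: "VS \<subseteq> Hdiv_space \<Omega>"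
    using fe_subspaceD(2)[OF VS] by (auto simp: S_space_def Hdiv_space_def)
  obtain B where B: "finite B" "B \<subseteq> VG \<times> VU" "\<forall>y\<in>VG \<times> VU. \<exists>w\<in>span B. GU_pair_norm \<Omega> (y - w) = 0"
    using fe_pair_generated[OF VG VU] by (elim exE conjE)
  obtain D where D: "finite D" "D \<subseteq> VS" "\<forall>S\<in>VS. \<exists>c. \<forall>y\<in>GU_fields \<Omega>.
           b_form \<Omega> (fst y) (snd y) S = (\<Sum>d\<in>D. c d * b_form \<Omega> (fst y) (snd y) d)"
    using fe_b_form_generated[OF \<Omega> VS] by (elim exE conjE)
  show ?thesis
  proof (rule distance_to_kernel[where s = "S_norm \<Omega>" and B = B and D = D])
    show "subspace (VG \<times> VU)" "subspace VS"
      using fe_subspaceD(1)[OF VG] fe_subspaceD(1)[OF VU] fe_subspaceD(1)[OF VS]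
      by (auto intro: subspace_Times)
    show "seminorm_on (VG \<times> VU) (GU_pair_norm \<Omega>)"
      using seminorm_on_GU_pair_norm sub unfolding seminorm_on_def by blast
    show "linear_functional_on (VG \<times> VU) (\<lambda>y. b_form \<Omega> (fst y) (snd y) S)" if "S \<in> VS" for S
      using b_form_linear(1)[OF \<Omega>] sub subS that by (blast intro: linear_functional_on_subset)
    show "linear_functional_on VS (b_form \<Omega> (fst y) (snd y))" if "y \<in> VG \<times> VU" for y
      using b_form_linear(2)[OF \<Omega>] sub subS that by (blast intro: linear_functional_on_subset)
    show "\<exists>c. \<forall>y\<in>VG \<times> VU. b_form \<Omega> (fst y) (snd y) S = (\<Sum>d\<in>D. c d * b_form \<Omega> (fst y) (snd y) d)"
      if "S \<in> VS" for S
      using bspec[OF D(3) that] sub by blast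
    show "\<exists>w\<in>span B. GU_pair_norm \<Omega> (y - w) = 0" if "y \<in> VG \<times> VU" for y
      using bspec[OF B(3) that] .
    show "\<beta> * S_norm \<Omega> S \<le> m"
      if "S \<in> VS" "\<And>y. y \<in> VG \<times> VU \<Longrightarrow> b_form \<Omega> (fst y) (snd y) S \<le> m * GU_pair_norm \<Omega> y" for S m
      using inf_supD[OF infsup that] .
  qed (use B(1,2) D(1,2) beta y M le in \<open>auto simp: S_norm_def\<close>)
qed

section \<open>The constitutive form, and passage from the abstract estimate to the three
  infima\<close>

lemma constitutive_form_linear:
  fixes \<Omega> :: "(real^'n) set"
  assumes A: "constitutive \<Omega> C\<^sub>A \<nu> \<A>" and x: "x \<in> GU_fields \<Omega>"
  shows "linear_functional_on (GU_fields \<Omega>) (\<lambda>y. pairing \<Omega> (\<lambda>t. \<A> (fst y t)) (fst x))"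
proof -
  have lin: "linear \<A>" using A by (simp add: constitutive_def)
  have L2: "subspace (Lp_space 2 \<Omega> :: (real^'n \<Rightarrow> real^'n^'n) set)" by (rule Lp_space_subspace) simp
  have "linear_functional_on (Lp_space 2 \<Omega>) (\<lambda>H. pairing \<Omega> H (fst x))"
    using x by (intro linear_functional_on_pairing_left[where p = 2]) (auto simp: GU_fields_def)
  note l = linear_functional_onD(1,2)[OF this L2]
  have m: "(\<lambda>t. \<A> (fst y t)) \<in> Lp_space 2 \<Omega>" if "y \<in> GU_fields \<Omega>" for y
    using that by (intro Lp_space_linear_comp[OF lin]) (auto simp: GU_fields_def)
  have "(\<lambda>t. \<A> (fst (y + z) t)) = (\<lambda>t. \<A> (fst y t)) + (\<lambda>t. \<A> (fst z t))"
    "(\<lambda>t. \<A> (fst (c *\<^sub>R y) t)) = c *\<^sub>R (\<lambda>t. \<A> (fst y t))"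
    for c and y z :: "(real^'n \<Rightarrow> real^'n^'n) \<times> (real^'n \<Rightarrow> real^'n)"
    by (simp_all add: fun_eq_iff scaleR_fun_def linear_add[OF lin] linear_scale[OF lin])
  then show ?thesis
    using l m by (simp add: linear_functional_on_def)
qed

lemma constitutive_form_le:
  assumes A: "constitutive \<Omega> C\<^sub>A \<nu> \<A>" and C: "C\<^sub>A > 0"
    and x: "x \<in> GU_fields \<Omega>" and y: "y \<in> GU_fields \<Omega>"
  shows "pairing \<Omega> (\<lambda>t. \<A> (fst x t)) (fst y) \<le> C\<^sub>A * GU_pair_norm \<Omega> x * GU_pair_norm \<Omega> y"
proof -
  have "pairing \<Omega> (\<lambda>t. \<A> (fst x t)) (fst y) \<le> C\<^sub>A * Lp_norm 2 \<Omega> (fst x) * Lp_norm 2 \<Omega> (fst y)"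
    using A x y unfolding constitutive_def GU_fields_def mem_Times_iff by blast
  also have "\<dots> \<le> C\<^sub>A * GU_pair_norm \<Omega> x * GU_pair_norm \<Omega> y"
    using C
    by (intro mult_mono GU_pair_norm_ge mult_nonneg_nonneg Lp_norm_nonneg) (auto simp: GU_pair_norm_def GU_norm_def)
  finally show ?thesis .
qed

theorem theorem3p4:
  fixes \<Omega> :: "(real^'n) set"
    and \<A> :: "real^'n^'n \<Rightarrow> real^'n^'n"
    and C\<^sub>A \<nu> c\<^sub>b C\<^sub>0 :: real
    and hs :: "real set"
    and \<T> :: "real \<Rightarrow> (real^'n) set set"
    and VG VS :: "real \<Rightarrow> (real^'n \<Rightarrow> real^'n^'n) set"
    and VU :: "real \<Rightarrow> (real^'n \<Rightarrow> real^'n) set"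
  assumes "CARD('n) \<in> {2, 3}"
    and "bounded_lipschitz_domain \<Omega>"
    and "C\<^sub>A > 0" "\<nu> > 0" "constitutive \<Omega> C\<^sub>A \<nu> \<A>"
    and "regular_quasi_uniform_meshes \<Omega> hs \<T>"
    and "\<And>h. h \<in> hs \<Longrightarrow> fe_subspace \<Omega> (\<T> h) (G_space \<Omega>) (VG h)"
    and "\<And>h. h \<in> hs \<Longrightarrow> fe_subspace \<Omega> (\<T> h) (U_space \<Omega>) (VU h)"
    and "\<And>h. h \<in> hs \<Longrightarrow> fe_subspace \<Omega> (\<T> h) (S_space \<Omega>) (VS h)"
    and "c\<^sub>b > 0" "\<And>h. h \<in> hs \<Longrightarrow> inf_sup \<Omega> c\<^sub>b (VG h) (VU h) (VS h)"
    and "C\<^sub>0 > 0" "\<And>h. h \<in> hs \<Longrightarrow> kernel_bound \<Omega> C\<^sub>0 (VG h) (VU h) (VS h)"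
  shows "\<exists>\<delta>>0. \<forall>f G u S Gh uh Sh.
    f \<in> Lp_space (4/3) \<Omega> \<longrightarrow>
    solves \<Omega> \<A> f (G_space \<Omega>) (U_space \<Omega>) (S_space \<Omega>) G u S \<longrightarrow>
    (\<forall>h\<in>hs. solves \<Omega> \<A> f (VG h) (VU h) (VS h) (Gh h) (uh h) (Sh h)) \<longrightarrow>
    Lp_norm (4/3) \<Omega> f < \<delta> \<longrightarrow>
    (\<exists>C. \<forall>h\<in>hs.
      Lp_norm 2 \<Omega> (\<lambda>x. G x - Gh h x) + Lp_norm 4 \<Omega> (\<lambda>x. u x - uh h x)
        + S_norm \<Omega> (\<lambda>x. S x - Sh h x)
      \<le> C * ((INF H\<in>VG h. Lp_norm 2 \<Omega> (\<lambda>x. G x - H x))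
           + (INF v\<in>VU h. Lp_norm 4 \<Omega> (\<lambda>x. u x - v x))
           + (INF T\<in>VS h. S_norm \<Omega> (\<lambda>x. S x - T x))))"
proof -
  have \<Omega>: "open \<Omega>" "bounded \<Omega>"
    using assms(2) by (auto simp: bounded_lipschitz_domain_def)
  note CA = assms(3) and \<nu> = assms(4) and A = assms(5)
    and VG = assms(7) and VU = assms(8) and VS = assms(9)
    and cb = assms(10) and infsup = assms(11) and C0 = assms(12) and ker = assms(13)
  \<comment> \<open>Coercivity constant on the discrete kernels. It involves only
    \<open>\<nu>\<close> and \<open>C\<^sub>0\<close>, so the threshold is fixed before the load and
    the mesh.\<close>
  define \<alpha> where "\<alpha> = \<nu> / (1 + 2 * C\<^sub>0)\<^sup>2"
  have \<alpha>: "\<alpha> > 0" using \<nu> C0 by (simp add: \<alpha>_def)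
  have GL: "G_space \<Omega> \<subseteq> Lp_space 2 \<Omega>" and UL: "U_space \<Omega> \<subseteq> Lp_space 4 \<Omega>"
    and SH: "S_space \<Omega> \<subseteq> Hdiv_space \<Omega>"
    by (auto simp: G_space_def U_space_def S_space_def Hdiv_space_def)
  show ?thesis
  proof (rule exI[of _ "\<alpha>\<^sup>2 / 2"], intro conjI allI impI)
    show "\<alpha>\<^sup>2 / 2 > 0" using \<alpha> by simp
    fix f G u S Gh uh Sh
    assume f: "f \<in> Lp_space (4/3) \<Omega>"
      and sol: "solves \<Omega> \<A> f (G_space \<Omega>) (U_space \<Omega>) (S_space \<Omega>) G u S"
      and solh: "\<forall>h\<in>hs. solves \<Omega> \<A> f (VG h) (VU h) (VS h) (Gh h) (uh h) (Sh h)"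
      and small: "Lp_norm (4/3) \<Omega> f < \<alpha>\<^sup>2 / 2"
    define x where "x = (G, u)"
    define k where "k = 1 + 2 / c\<^sub>b"
    \<comment> \<open>Here the norm of the exact pair enters; \<open>K\<close>, \<open>P\<close> and
      \<open>C\<close> depend on the solution but not on \<open>h\<close>.\<close>
    define K where "K = C\<^sub>A + \<alpha> / 2 + GU_pair_norm \<Omega> x"
    define P where "P = k + 2 / \<alpha> * (K * k + 1)"
    define C where "C = P + 1 + (K * P + 1) / c\<^sub>b"
    have nonneg: "0 \<le> GU_pair_norm \<Omega> y" for y :: "(real^'n \<Rightarrow> real^'n^'n) \<times> (real^'n \<Rightarrow> real^'n)"
      by (simp add: GU_pair_norm_def GU_norm_def)
    have K0: "K \<ge> 0" using CA \<alpha> nonneg[of x] by (simp add: K_def)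
    have k0: "k \<ge> 0" using cb by (simp add: k_def)
    have P0: "P \<ge> 0" unfolding P_def using k0 K0 \<alpha> by (intro add_nonneg_nonneg mult_nonneg_nonneg) auto
    have Cpos: "C > 0" unfolding C_def using P0 K0 cb by (intro add_nonneg_pos add_pos_nonneg add_nonneg_nonneg) auto
    have x: "x \<in> GU_fields \<Omega>" and S: "S \<in> Hdiv_space \<Omega>"
      using sol GL UL SH by (auto simp: solves_def x_def GU_fields_def)
    have F: "pairing \<Omega> f (snd y) \<le> \<alpha>\<^sup>2 / 2 * GU_pair_norm \<Omega> y" if "y \<in> GU_fields \<Omega>" for y
    proof -
      have "pairing \<Omega> f (snd y) \<le> Lp_norm (4/3) \<Omega> f * Lp_norm 4 \<Omega> (snd y)"
        using f that by (intro pairing_le) (auto simp: GU_fields_def)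
      also have "\<dots> \<le> \<alpha>\<^sup>2 / 2 * GU_pair_norm \<Omega> y"
        using small by (intro mult_mono GU_pair_norm_ge Lp_norm_nonneg) auto
      finally show ?thesis .
    qed
    show "\<exists>C. \<forall>h\<in>hs.
      Lp_norm 2 \<Omega> (\<lambda>x. G x - Gh h x) + Lp_norm 4 \<Omega> (\<lambda>x. u x - uh h x)
        + S_norm \<Omega> (\<lambda>x. S x - Sh h x)
      \<le> C * ((INF H\<in>VG h. Lp_norm 2 \<Omega> (\<lambda>x. G x - H x))
           + (INF v\<in>VU h. Lp_norm 4 \<Omega> (\<lambda>x. u x - v x))
           + (INF T\<in>VS h. S_norm \<Omega> (\<lambda>x. S x - T x)))"
    \<comment> \<open>The abstract estimate controls the norm of the pair, which dominates the
      errors of \<open>G\<close> and of \<open>u\<close> separately; their sum costs the factor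
      2.\<close>
    proof (intro exI[of _ "2 * C"] ballI)
      fix h assume h: "h \<in> hs"
      note G = fe_subspaceD(1,2)[OF VG[OF h]] and U = fe_subspaceD(1,2)[OF VU[OF h]]
        and T = fe_subspaceD(1,2)[OF VS[OF h]]
      have ne: "VG h \<noteq> {}" "VU h \<noteq> {}" "VS h \<noteq> {}"
        using subspace_0[OF G(1)] subspace_0[OF U(1)] subspace_0[OF T(1)] by auto
      have sh: "solves \<Omega> \<A> f (VG h) (VU h) (VS h) (Gh h) (uh h) (Sh h)" using solh h by blast
      define xh where "xh = (Gh h, uh h)"
      have xh: "xh \<in> VG h \<times> VU h" and Shh: "Sh h \<in> VS h"
        using sh by (auto simp: solves_def xh_def)
      have XX: "VG h \<times> VU h \<subseteq> G_space \<Omega> \<times> U_space \<Omega>" using G(2) U(2) by auto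
      have X: "VG h \<times> VU h \<subseteq> GU_fields \<Omega>" using XX GL UL by (auto simp: GU_fields_def)
      have Y: "VS h \<subseteq> Hdiv_space \<Omega>" using T(2) SH by blast
      \<comment> \<open>The estimate holds for each discrete triple \<open>H\<close>,
        \<open>v\<close>, \<open>R\<close> with the same constant, so the infima can be taken
        afterwards.\<close>
      have bound: "Lp_norm 2 \<Omega> (\<lambda>x. G x - Gh h x) + Lp_norm 4 \<Omega> (\<lambda>x. u x - uh h x) + S_norm \<Omega> (\<lambda>x. S x - Sh h x)
          \<le> 2 * C * (Lp_norm 2 \<Omega> (\<lambda>x. G x - H x) + Lp_norm 4 \<Omega> (\<lambda>x. u x - v x) + S_norm \<Omega> (\<lambda>x. S x - R x))"
        if H: "H \<in> VG h" and v: "v \<in> VU h" and R: "R \<in> VS h" for H v R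
      proof -
        have y: "(H, v) \<in> VG h \<times> VU h" using H v by simp
        have "GU_pair_norm \<Omega> (x - xh) + S_norm \<Omega> (S - Sh h)
            \<le> (P + 1 + (K * P + 1) / c\<^sub>b) * (GU_pair_norm \<Omega> (x - (H, v)) + S_norm \<Omega> (S - R))"
        proof (rule galerkin_error_bound[where X = "GU_fields \<Omega>" and Y = "Hdiv_space \<Omega>"
              and Xh = "VG h \<times> VU h" and Yh = "VS h" and A = C\<^sub>A and \<alpha> = \<alpha>
              and a = "\<lambda>x y. pairing \<Omega> (\<lambda>t. \<A> (fst x t)) (fst y)" and c = "conv_form \<Omega>"
              and b = "\<lambda>x. b_form \<Omega> (fst x) (snd x)" and F = "\<lambda>y. pairing \<Omega> f (snd y)"])
          show "subspace (VG h \<times> VU h)" using G(1) U(1) by (rule subspace_Times)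
          show "conv_form \<Omega> w y z = - conv_form \<Omega> w z y" for w y z by (rule conv_form_antisym)
          show "c\<^sub>b * S_norm \<Omega> S \<le> m" if "S \<in> VS h"
            "\<And>y. y \<in> VG h \<times> VU h \<Longrightarrow> b_form \<Omega> (fst y) (snd y) S \<le> m * GU_pair_norm \<Omega> y" for S m
            using inf_supD[OF infsup[OF h] that] .
          show "\<exists>z\<in>VG h \<times> VU h. (\<forall>S\<in>VS h. b_form \<Omega> (fst z) (snd z) S = 0) \<and> GU_pair_norm \<Omega> (y - z) \<le> 2 * M / c\<^sub>b"
            if "y \<in> VG h \<times> VU h" "0 \<le> M" "\<And>S. S \<in> VS h \<Longrightarrow> b_form \<Omega> (fst y) (snd y) S \<le> M * S_norm \<Omega> S" for y M
            using discrete_kernel_approximation[OF \<Omega> VG[OF h] VU[OF h] VS[OF h] cb infsup[OF h] that] .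
          show "\<alpha> * (GU_pair_norm \<Omega> z)\<^sup>2 \<le> pairing \<Omega> (\<lambda>t. \<A> (fst z t)) (fst z)"
            if "z \<in> VG h \<times> VU h" "\<And>S. S \<in> VS h \<Longrightarrow> b_form \<Omega> (fst z) (snd z) S = 0" for z
            unfolding \<alpha>_def
            using kernel_coercive[OF A \<nu> ker[OF h] C0 order_trans[OF G(2) GL] that] .
          show "b_form \<Omega> (fst x) (snd x) R = 0" if "R \<in> VS h" for R
            using solves_equations(2)[OF sol] that T(2) by (auto simp: x_def)
          show "b_form \<Omega> (fst xh) (snd xh) R = 0" if "R \<in> VS h" for R
            using solves_equations(2)[OF sh] that by (simp add: xh_def)
          show "pairing \<Omega> (\<lambda>t. \<A> (fst x t)) (fst y) + conv_form \<Omega> x x y - b_form \<Omega> (fst y) (snd y) S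
              = pairing \<Omega> f (snd y)" if "y \<in> VG h \<times> VU h" for y
            using solves_equations(1)[OF sol subsetD[OF XX that]] by (simp only: x_def)
          show "pairing \<Omega> (\<lambda>t. \<A> (fst xh t)) (fst y) + conv_form \<Omega> xh xh y - b_form \<Omega> (fst y) (snd y) (Sh h)
              = pairing \<Omega> f (snd y)" if "y \<in> VG h \<times> VU h" for y
            using solves_equations(1)[OF sh that] by (simp only: xh_def)
        qed (use \<Omega> X Y x S xh Shh y R F T(1) cb \<alpha> CA in \<open>simp_all add: subspace_GU seminorm_on_GU_pair_norm
            subspace_Hdiv seminorm_on_S_norm constitutive_form_linear[OF A] constitutive_form_le[OF A] conv_form_linear conv_form_le b_form_linear
            b_form_le k_def K_def P_def\<close>)
        then have "GU_pair_norm \<Omega> (x - xh) + S_norm \<Omega> (S - Sh h) \<le> C * (GU_pair_norm \<Omega> (x - (H, v)) + S_norm \<Omega> (S - R))"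
          by (simp add: C_def)
        also have "\<dots> \<le> C * (Lp_norm 2 \<Omega> (G - H) + Lp_norm 4 \<Omega> (u - v) + S_norm \<Omega> (S - R))"
          using GU_pair_norm_le[of \<Omega> "x - (H, v)"] Cpos by (intro mult_left_mono) (auto simp: x_def)
        finally have "GU_pair_norm \<Omega> (x - xh) + S_norm \<Omega> (S - Sh h)
            \<le> C * (Lp_norm 2 \<Omega> (G - H) + Lp_norm 4 \<Omega> (u - v) + S_norm \<Omega> (S - R))" .
        moreover have "Lp_norm 2 \<Omega> (G - Gh h) \<le> GU_pair_norm \<Omega> (x - xh)" "Lp_norm 4 \<Omega> (u - uh h) \<le> GU_pair_norm \<Omega> (x - xh)"
          using GU_pair_norm_ge[of \<Omega> "x - xh"] by (auto simp: x_def xh_def)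
        moreover have "0 \<le> S_norm \<Omega> (S - Sh h)" by (simp add: S_norm_def)
        ultimately have "Lp_norm 2 \<Omega> (G - Gh h) + Lp_norm 4 \<Omega> (u - uh h) + S_norm \<Omega> (S - Sh h)
            \<le> 2 * C * (Lp_norm 2 \<Omega> (G - H) + Lp_norm 4 \<Omega> (u - v) + S_norm \<Omega> (S - R))"
          by linarith
        then show ?thesis
          by (simp only: fun_diff_def)
      qed
      show "Lp_norm 2 \<Omega> (\<lambda>x. G x - Gh h x) + Lp_norm 4 \<Omega> (\<lambda>x. u x - uh h x) + S_norm \<Omega> (\<lambda>x. S x - Sh h x)
          \<le> 2 * C * ((INF H\<in>VG h. Lp_norm 2 \<Omega> (\<lambda>x. G x - H x)) + (INF v\<in>VU h. Lp_norm 4 \<Omega> (\<lambda>x. u x - v x))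
            + (INF T\<in>VS h. S_norm \<Omega> (\<lambda>x. S x - T x)))"
        using Cpos ne bound by (intro le_mult_sum_INF) auto
    qed
  qed
qed

end
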